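(* With the notation of the context, write $\det(1-\Psi s\mid B/\mathbb{Z}_p[[\pi^{1/D}]])=\sum_{i\ge0}(-1)^ic_is^i$. Then the $T$-adic Newton polygon of $\det(1-\Psi^bs\mid B/\mathbb{Z}_q[[\pi^{1/D}]])$ is the lower convex closure of the points $(m,{\rm ord}_T(c_{bm}))$, $m=0,1,2,\dots$.
   Context: Let $p$ be a prime, $q=p^b$, $\mathbb{Z}_q=W(\mathbb{F}_q)$. Let $\triangle\supsetneq\{0\}$ be an integral convex polytope in $\mathbb{R}^n$, $C(\triangle)$ the cone it generates, $M(\triangle)=C(\triangle)\cap\mathbb{Z}^n$, $\deg(a)=\min\{c\ge0:a\in c\triangle\}$ for $a\in C(\triangle)$, and $D$ the least positive integer with $\deg(M(\triangle))\subseteq\frac1D\mathbb{Z}$. Let $f(x)=\sum_{u\in\triangle\cap\mathbb{Z}^n}(a_ux^u,0,\dots)$ with $a_u\in\mathbb{F}_q$ and $a_u\ne0$ for every vertex $u\neq0$ of $\triangle$. Let $E(t)=\exp(\sum_{i\ge0}t^{p^i}/p^i)$ be the Artin–Hasse exponential, $\pi\in\mathbb{Q}_p((T))$ with $E(\pi)=1+T$, and $\pi^{1/D}$ a fixed $D$-th root. Let $L=\{\sum_{u\in M(\triangle)}c_u\pi^{\deg(u)}x^u: c_u\in\mathbb{Z}_q[[\pi^{1/D}]]\}$, $E_f(x)=\prod_{a_u\neq0}E(\pi\hat a_ux^u)\in L$ ($\hat a$ the Teichmüller lift), $\sigma$ the Frobenius of $\mathbb{Q}_q/\mathbb{Q}_p$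 acting on coefficients (fixing $\pi^{1/D}$ and $x$), $\Psi_p(\sum c_ix^i)=\sum c_{pi}x^i$, and $\Psi=\sigma^{-1}\circ\Psi_p\circ E_f$ acting on $B=\{\sum_{u\in M(\triangle)}c_u\pi^{\deg(u)}x^u\in L:{\rm ord}_T(c_u)\to+\infty\text{ as }\deg(u)\to+\infty\}$. $\Psi$ is completely continuous and $\Psi^b$ is $\mathbb{Z}_q[[\pi^{1/D}]]$-linear, so the Fredholm determinants above are defined; ${\rm ord}_T$ is the $T$-adic valuation (with ${\rm ord}_T(\pi)=1$). *)

theory Defs
  imports "HOL-Analysis.Analysis" "HOL-Combinatorics.Permutations"
    "HOL-Computational_Algebra.Computational_Algebra"
begin

section \<open>Witt vectors of a finite field\<close>

text \<open>
  \<open>\<int>\<^sub>q = W(F\<^sub>q)\<close> is given together with its residue map, as the strict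
  \<open>p\<close>-ring with residue field \<open>F\<^sub>q\<close> (unique up to a unique isomorphism over \<open>F\<^sub>q\<close>):
  \<open>p\<close> is a non-zero-divisor, the ring is \<open>p\<close>-adically separated and complete, and the
  quotient by \<open>p\<close> is \<open>F\<^sub>q\<close>.
\<close>

definition ring_hom_on :: "('a::comm_ring_1 \<Rightarrow> 'b::comm_ring_1) \<Rightarrow> bool" where
  "ring_hom_on h \<longleftrightarrow> h 1 = 1 \<and> (\<forall>x y. h (x + y) = h x + h y) \<and> (\<forall>x y. h (x * y) = h x * h y)"

definition witt_vectors :: "nat \<Rightarrow> ('r::idom \<Rightarrow> 'k::{field,finite}) \<Rightarrow> bool" where
  "witt_vectors p red \<longleftrightarrow>
     ring_hom_on red \<and> surj red \<and> (\<forall>x. red x = 0 \<longleftrightarrow> of_nat p dvd x) \<and>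
     (of_nat p :: 'r) \<noteq> 0 \<and>
     (\<forall>x :: 'r. (\<forall>n. of_nat p ^ n dvd x) \<longrightarrow> x = 0) \<and>
     (\<forall>s :: nat \<Rightarrow> 'r. (\<forall>n. of_nat p ^ n dvd s (Suc n) - s n) \<longrightarrow>
        (\<exists>x. \<forall>n. of_nat p ^ n dvd x - s n))"

definition frobenius :: "nat \<Rightarrow> ('r::idom \<Rightarrow> 'r) \<Rightarrow> bool" where
  "frobenius p \<sigma> \<longleftrightarrow> ring_hom_on \<sigma> \<and> bij \<sigma> \<and> (\<forall>x. of_nat p dvd \<sigma> x - x ^ p)"

definition teichmueller :: "('r::idom \<Rightarrow> 'k::{field,finite}) \<Rightarrow> 'k \<Rightarrow> 'r" where
  "teichmueller red a = (THE z. red z = a \<and> z ^ CARD('k) = z)"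

text \<open>\<open>\<int>\<^sub>p\<close> inside \<open>\<int>\<^sub>q\<close>: the \<open>p\<close>-adic closure of the integers.\<close>

definition Zp :: "nat \<Rightarrow> 'r::idom set" where
  "Zp p = {x. \<forall>n. \<exists>m::int. of_nat p ^ n dvd x - of_int m}"


section \<open>The rings \<open>\<int>\<^sub>q[[\<pi>\<^bsup>1/D\<^esup>]]\<close> and \<open>\<int>\<^sub>p[[\<pi>\<^bsup>1/D\<^esup>]]\<close>, and the Artin--Hasse exponential\<close>

text \<open>
  \<open>\<int>\<^sub>q[[\<pi>\<^bsup>1/D\<^esup>]]\<close> is the type \<open>'r fps\<close>, with \<open>fps_X\<close> playing the role of
  \<open>\<pi>\<^bsup>1/D\<^esup>\<close>; so \<open>\<pi> = fps_X ^ D\<close>. Its library topology is the \<open>\<pi>\<^bsup>1/D\<^esup>\<close>-adic one; all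
  infinite sums \<open>infsum\<close> below are taken in it.
\<close>

definition Rp :: "nat \<Rightarrow> 'r::idom fps set" where
  "Rp p = {g. \<forall>i. fps_nth g i \<in> Zp p}"

definition ord_T :: "nat \<Rightarrow> 'r::idom fps \<Rightarrow> ereal" where
  "ord_T D g = (if g = 0 then \<infinity> else ereal (real (subdegree g) / real D))"

definition artin_hasse :: "nat \<Rightarrow> rat fps" where
  "artin_hasse p =
     fps_compose (fps_exp 1) (Abs_fps (\<lambda>k. if \<exists>i. k = p ^ i then 1 / of_nat k else 0))"

text \<open>The image in \<open>\<int>\<^sub>q\<close> of a rational number with denominator prime to \<open>p\<close>.\<close>

definition of_p_integral :: "rat \<Rightarrow> 'r::idom" where
  "of_p_integral x = (THE z. of_int (snd (quotient_of x)) * z = of_int (fst (quotient_of x)))"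

definition artin_hasse_coeff :: "nat \<Rightarrow> nat \<Rightarrow> 'r::idom" where
  "artin_hasse_coeff p k = of_p_integral (fps_nth (artin_hasse p) k)"

text \<open>
  \<open>T = E(\<pi>) - 1\<close>. The next lemma shows that it has the same order as \<open>\<pi>\<close>, so that \<open>ord_T\<close>
  is indeed the \<open>T\<close>-adic valuation with \<open>ord_T(T) = ord_T(\<pi>) = 1\<close>.
\<close>

definition T_elt :: "nat \<Rightarrow> nat \<Rightarrow> 'r::idom fps" where
  "T_elt p D = fps_compose (Abs_fps (artin_hasse_coeff p)) (fps_X ^ D) - 1"

lemma ord_T_pi: "D > 0 \<Longrightarrow> ord_T D (fps_X ^ D) = 1"
  by (simp add: ord_T_def one_ereal_def)

lemma ord_T_T:
  assumes "prime p" "D > 0"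
  shows "ord_T D (T_elt p D :: 'r::idom fps) = 1"
proof -
  have c0: "artin_hasse_coeff p 0 = (1::'r)"
    by (simp add: artin_hasse_coeff_def artin_hasse_def of_p_integral_def)
  have p1: "\<exists>i. Suc 0 = p ^ i" by (rule exI[of _ 0]) simp
  have "fps_nth (artin_hasse p) 1 = 1"
    using p1 by (simp add: artin_hasse_def fps_compose_nth)
  then have c1: "artin_hasse_coeff p 1 = (1::'r)"
    by (simp add: artin_hasse_coeff_def of_p_integral_def)
  have nth: "fps_nth (fps_compose (Abs_fps (artin_hasse_coeff p)) (fps_X ^ D)) n
      = (\<Sum>i=0..n. artin_hasse_coeff p i * (if n = D * i then 1 else (0::'r)))" for n
    by (simp add: fps_compose_nth power_mult[symmetric] fps_X_power_nth)
  have D: "fps_nth (T_elt p D :: 'r fps) D = 1"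
  proof -
    have "(\<Sum>i=0..D. artin_hasse_coeff p i * (if D = D * i then 1 else (0::'r)))
       = (\<Sum>i\<in>{0..D}. if i = 1 then artin_hasse_coeff p i else 0)"
      using assms(2) by (intro sum.cong) auto
    also have "\<dots> = 1" using assms(2) c1 by (subst sum.delta) auto
    finally show ?thesis using assms(2) by (simp add: T_elt_def nth)
  qed
  have lt: "fps_nth (T_elt p D :: 'r fps) n = 0" if "n < D" for n
  proof (cases "n = 0")
    case True
    then show ?thesis by (simp add: T_elt_def nth c0)
  next
    case False
    have "n \<noteq> D * i" for i using that False by (cases i) auto
    then have "(\<Sum>i=0..n. artin_hasse_coeff p i * (if n = D * i then 1 else (0::'r))) = 0"
      by simp
    then show ?thesis using False by (simp add: T_elt_def nth)
  qed
  have "subdegree (T_elt p D :: 'r fps) = D"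
    using D lt by (intro subdegreeI) auto
  moreover have "(T_elt p D :: 'r fps) \<noteq> 0" using D by auto
  ultimately show ?thesis using assms(2) by (simp add: ord_T_def one_ereal_def)
qed


section \<open>The polytope\<close>

definition rvec :: "int ^ 'n \<Rightarrow> real ^ 'n" where
  "rvec u = (\<chi> i. real_of_int (u $ i))"

definition integral_polytope :: "(real ^ 'n) set \<Rightarrow> bool" where
  "integral_polytope \<Delta> \<longleftrightarrow> polytope \<Delta> \<and> (\<forall>v. v extreme_point_of \<Delta> \<longrightarrow> v \<in> range rvec)"

definition cone_lattice :: "(real ^ 'n) set \<Rightarrow> (int ^ 'n) set" where
  "cone_lattice \<Delta> = {u. rvec u \<in> convex_cone hull \<Delta>}"

definition deg :: "(real ^ 'n) set \<Rightarrow> int ^ 'n \<Rightarrow> real" where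
  "deg \<Delta> u = (LEAST c. 0 \<le> c \<and> rvec u \<in> (\<lambda>x. c *\<^sub>R x) ` \<Delta>)"

definition denom :: "(real ^ 'n) set \<Rightarrow> nat" where
  "denom \<Delta> = (LEAST d. d > 0 \<and> (\<forall>u\<in>cone_lattice \<Delta>. \<exists>k::int. deg \<Delta> u = real_of_int k / real d))"

text \<open>\<open>\<pi>\<^bsup>deg(u)\<^esup>\<close>; here \<open>D deg(u)\<close> is a nonnegative integer, so taking the floor is harmless.\<close>

definition pi_deg :: "(real ^ 'n) set \<Rightarrow> int ^ 'n \<Rightarrow> 'r::idom fps" where
  "pi_deg \<Delta> u = fps_X ^ nat \<lfloor>real (denom \<Delta>) * deg \<Delta> u\<rfloor>"


section \<open>The modules \<open>L\<close> and \<open>B\<close> and the operator \<open>\<Psi>\<close>\<close>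

text \<open>A formal sum \<open>\<Sum>\<^sub>u g\<^sub>u x\<^sup>u\<close> is the function \<open>u \<mapsto> g\<^sub>u\<close>.\<close>

type_synonym ('r, 'n) series = "int ^ 'n \<Rightarrow> 'r fps"

definition weighted :: "(real ^ 'n) set \<Rightarrow> ('r::idom, 'n) series \<Rightarrow> ('r, 'n) series" where
  "weighted \<Delta> c = (\<lambda>u. if u \<in> cone_lattice \<Delta> then c u * pi_deg \<Delta> u else 0)"

definition L_module :: "(real ^ 'n) set \<Rightarrow> ('r::idom, 'n) series set" where
  "L_module \<Delta> = range (weighted \<Delta>)"

definition B_module :: "(real ^ 'n) set \<Rightarrow> ('r::idom, 'n) series set" where
  "B_module \<Delta> = {weighted \<Delta> c |c.
     \<forall>N::real. \<exists>K. \<forall>u\<in>cone_lattice \<Delta>. deg \<Delta> u \<ge> K \<longrightarrow> ord_T (denom \<Delta>) (c u) \<ge> ereal N}"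

lemma B_module_subset_L_module: "B_module \<Delta> \<subseteq> L_module \<Delta>"
  by (auto simp: B_module_def L_module_def)

definition series_mult :: "('r::idom, 'n::finite) series \<Rightarrow> ('r, 'n) series \<Rightarrow> ('r, 'n) series" where
  "series_mult g h = (\<lambda>w. \<Sum>\<^sub>\<infinity>v. g (w - v) * h v)"

text \<open>The product of a finite family of formal sums, expanded.\<close>

definition series_prod :: "'i set \<Rightarrow> ('i \<Rightarrow> ('r::idom, 'n::finite) series) \<Rightarrow> ('r, 'n) series" where
  "series_prod I g =
     (\<lambda>w. \<Sum>\<^sub>\<infinity>v\<in>{v \<in> I \<rightarrow>\<^sub>E UNIV. (\<Sum>i\<in>I. v i) = w}. \<Prod>i\<in>I. g i (v i))"

text \<open>
  \<open>E(\<pi> z x\<^sup>u) = \<Sum>\<^sub>k \<lambda>\<^sub>k \<pi>\<^sup>k z\<^sup>k x\<^bsup>ku\<^esup>\<close>. The sum over all \<open>k\<close> with \<open>ku = w\<close> has more than one term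
  only if \<open>u = w = 0\<close>.
\<close>

definition artin_hasse_monomial :: "nat \<Rightarrow> nat \<Rightarrow> 'r::idom \<Rightarrow> int ^ 'n \<Rightarrow> ('r, 'n) series" where
  "artin_hasse_monomial p D z u =
     (\<lambda>w. \<Sum>\<^sub>\<infinity>k\<in>{k. of_nat k *s u = w}.
        fps_const (artin_hasse_coeff p k * z ^ k) * (fps_X ^ D) ^ k)"

definition E_f ::
  "nat \<Rightarrow> ('r::idom \<Rightarrow> 'k::{field,finite}) \<Rightarrow> (real ^ 'n) set \<Rightarrow> (int ^ 'n \<Rightarrow> 'k) \<Rightarrow> ('r, 'n) series"
  where
  "E_f p red \<Delta> a = series_prod {u. rvec u \<in> \<Delta> \<and> a u \<noteq> 0}
     (\<lambda>u. artin_hasse_monomial p (denom \<Delta>) (teichmueller red (a u)) u)"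

definition Psi_p :: "nat \<Rightarrow> ('r::idom, 'n::finite) series \<Rightarrow> ('r, 'n) series" where
  "Psi_p p g = (\<lambda>u. g (of_nat p *s u))"

definition coeff_map :: "('r::idom \<Rightarrow> 'r) \<Rightarrow> ('r, 'n::finite) series \<Rightarrow> ('r, 'n) series" where
  "coeff_map h g = (\<lambda>u. Abs_fps (\<lambda>i. h (fps_nth (g u) i)))"

definition Psi ::
  "nat \<Rightarrow> ('r::idom \<Rightarrow> 'k::{field,finite}) \<Rightarrow> ('r \<Rightarrow> 'r) \<Rightarrow> (real ^ 'n) set \<Rightarrow> (int ^ 'n \<Rightarrow> 'k)
    \<Rightarrow> ('r, 'n) series \<Rightarrow> ('r, 'n) series"
  where
  "Psi p red \<sigma> \<Delta> a = coeff_map (inv \<sigma>) \<circ> Psi_p p \<circ> series_mult (E_f p red \<Delta> a)"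


section \<open>Fredholm determinants\<close>

text \<open>
  The norm on \<open>B\<close>, written additively: the least \<open>ord_T\<close> of the coefficients with respect to the
  \<open>\<pi>\<^bsup>deg(u)\<^esup> x\<^sup>u\<close>.
\<close>

definition ord_B :: "(real ^ 'n) set \<Rightarrow> ('r::idom, 'n) series \<Rightarrow> ereal" where
  "ord_B \<Delta> g = (INF u\<in>cone_lattice \<Delta>. ord_T (denom \<Delta>) (g u) - ereal (deg \<Delta> u))"

text \<open>
  \<open>R\<close> is the ground ring. A basis is a set of vectors indexed by itself; \<open>coords \<Delta> R E c g\<close> says that
  \<open>g = \<Sum>\<^sub>e c\<^sub>e e\<close>, convergent in \<open>B\<close>, where the \<open>c\<^sub>e \<in> R\<close> tend to \<open>0\<close>.
\<close>

definition coords ::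
  "(real ^ 'n) set \<Rightarrow> 'r::idom fps set \<Rightarrow> ('r, 'n) series set \<Rightarrow> (('r, 'n) series \<Rightarrow> 'r fps)
    \<Rightarrow> ('r, 'n) series \<Rightarrow> bool"
  where
  "coords \<Delta> R E c g \<longleftrightarrow>
     (\<forall>e\<in>E. c e \<in> R) \<and> (\<forall>e. e \<notin> E \<longrightarrow> c e = 0) \<and>
     (\<forall>N::real. finite {e\<in>E. ord_T (denom \<Delta>) (c e) < ereal N}) \<and>
     (\<forall>N::real. \<forall>\<^sub>F F in finite_subsets_at_top E.
        ord_B \<Delta> (\<lambda>u. g u - (\<Sum>e\<in>F. c e * e u)) \<ge> ereal N)"

definition orthonormal_basis ::
  "(real ^ 'n) set \<Rightarrow> 'r::idom fps set \<Rightarrow> ('r, 'n) series set \<Rightarrow> bool" where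
  "orthonormal_basis \<Delta> R E \<longleftrightarrow> E \<subseteq> B_module \<Delta> \<and>
     (\<forall>g\<in>B_module \<Delta>. \<exists>!c. coords \<Delta> R E c g) \<and>
     (\<forall>g\<in>B_module \<Delta>. \<forall>c. coords \<Delta> R E c g \<longrightarrow> ord_B \<Delta> g = (INF e\<in>E. ord_T (denom \<Delta>) (c e)))"

definition matrix_of ::
  "(real ^ 'n) set \<Rightarrow> 'r::idom fps set \<Rightarrow> ('r, 'n) series set
    \<Rightarrow> (('r, 'n) series \<Rightarrow> ('r, 'n) series) \<Rightarrow> ('r, 'n) series \<Rightarrow> ('r, 'n) series \<Rightarrow> 'r fps"
  where
  "matrix_of \<Delta> R E \<Phi> i j = (THE c. coords \<Delta> R E c (\<Phi> j)) i"

definition principal_minor :: "('i \<Rightarrow> 'i \<Rightarrow> 'c::comm_ring_1) \<Rightarrow> 'i set \<Rightarrow> 'c" where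
  "principal_minor A S = (\<Sum>\<tau> | \<tau> permutes S. of_int (sign \<tau>) * (\<Prod>i\<in>S. A i (\<tau> i)))"

text \<open>\<open>det(1 - A s) = \<Sum>\<^sub>m (-1)\<^sup>m (sum of the principal minors of size m) s\<^sup>m\<close>.\<close>

definition det_series :: "'i set \<Rightarrow> ('i \<Rightarrow> 'i \<Rightarrow> 'r::idom fps) \<Rightarrow> 'r fps fps" where
  "det_series I A = Abs_fps (\<lambda>m.
     (-1) ^ m * (\<Sum>\<^sub>\<infinity>S\<in>{S. S \<subseteq> I \<and> finite S \<and> card S = m}. principal_minor A S))"

text \<open>
  \<open>det(1 - \<Phi> s | B / R)\<close>, for a completely continuous \<open>R\<close>-linear \<open>\<Phi>\<close>: computed in an orthonormal
  basis of \<open>B\<close> over \<open>R\<close>, independently of the choice of that basis.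
\<close>

definition fredholm_det ::
  "(real ^ 'n) set \<Rightarrow> 'r::idom fps set \<Rightarrow> (('r, 'n) series \<Rightarrow> ('r, 'n) series) \<Rightarrow> 'r fps fps"
  where
  "fredholm_det \<Delta> R \<Phi> =
     (THE F. \<exists>E. orthonormal_basis \<Delta> R E \<and> F = det_series E (matrix_of \<Delta> R E \<Phi>))"


section \<open>Newton polygons\<close>

text \<open>
  The lower convex closure of the points \<open>(m, y\<^sub>m)\<close>, as the function whose graph it is: the lower
  boundary of the convex hull of the region on and above the points. Points with \<open>y\<^sub>m = \<infinity>\<close> contribute
  nothing, and the value is \<open>\<infinity>\<close> outside the range of abscissae.
\<close>

definition lower_convex_closure :: "(nat \<Rightarrow> ereal) \<Rightarrow> real \<Rightarrow> ereal" where
  "lower_convex_closure y x =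
     (INF t\<in>{t. (x, t) \<in> convex hull {(real m, t) |m t. y m \<le> ereal t}}. ereal t)"

definition newton_polygon :: "nat \<Rightarrow> 'r::idom fps fps \<Rightarrow> real \<Rightarrow> ereal" where
  "newton_polygon D F = lower_convex_closure (\<lambda>m. ord_T D (fps_nth F m))"

end

theory Submission
  imports Defs "HOL-Library.Function_Algebras"
begin

text \<open>
  In fact \<open>det(1 - \<Psi>s | B/\<int>\<^sub>p[[\<pi>\<^bsup>1/D\<^esup>]]) = F(s\<^sup>b)\<close> for \<open>F(s) = det(1 - \<Psi>\<^sup>bs | B/\<int>\<^sub>q[[\<pi>\<^bsup>1/D\<^esup>]])\<close>, so that the two
  families of points coincide. By Newton's identities a Fredholm determinant in characteristic zero
  is determined by the traces of the powers of the operator. If \<open>M\<^sub>u\<close> are the diagonal matrix entries of the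
  \<open>\<sigma>\<^bsup>-k\<^esup>\<close>-linear map \<open>\<Psi>\<^sup>k\<close>, its trace over \<open>\<int>\<^sub>p[[\<pi>\<^bsup>1/D\<^esup>]]\<close> is the sum of the traces of the maps
  \<open>x \<mapsto> M\<^sub>u \<sigma>\<^bsup>-k\<^esup>(x)\<close> of \<open>\<int>\<^sub>q\<close> over \<open>\<int>\<^sub>p\<close>. These vanish if \<open>b\<close> does not divide \<open>k\<close>. Otherwise
  \<open>\<sigma>\<^sup>k = 1\<close>, the trace of \<open>\<Psi>\<^sup>k\<close> over \<open>\<int>\<^sub>q[[\<pi>\<^bsup>1/D\<^esup>]]\<close> is fixed by \<open>\<sigma>\<close> since \<open>\<Psi>\<close> commutes with \<open>\<Psi>\<^sup>k\<close>, and the trace over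
  \<open>\<int>\<^sub>p[[\<pi>\<^bsup>1/D\<^esup>]]\<close> is \<open>b\<close> times it. The same commutation argument for traces, applied to a change of
  basis, shows that Fredholm determinants do not depend on the orthonormal basis.
\<close>

section \<open>Lattice polytopes\<close>

text \<open>\<open>fredholm_det\<close> is a definite description over all orthonormal bases,
  \<open>deg\<close> and \<open>denom\<close> are least elements, and the infinite sums may a priori
  diverge, so these notions must be secured before anything can be computed. What makes the infinite
  matrices tractable is one estimate: \<open>Psi_p\<close> reads off the coefficient at pu, whose
  weight is p times that of u, so \<Psi> gains a factor \<pi>^{(p-1) deg(u)} at u. Modulo a fixed
  power of \<pi>^{1/D} only finitely many exponents matter, and the same finite set serves all
  powers of \<Psi> and both ground rings. Identities are therefore proved for finite blocks, modulo
  every power of \<open>fps_X\<close>. \<Psi> is only semilinear over Z_q, so its own determinant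
  has to be taken over Z_p. There each exponent u carries a block of size b, and traces treat these
  blocks one by one. The substitution of s^b comes from exp(- sum_k tr(\<Psi>^k) s^k / k): only k =
  bj survives, and the factor b in its trace cancels the b in 1/(bj).\<close>

lemma rvec_simps [simp]:
  "rvec (u + v) = rvec u + rvec v" "rvec (u - v) = rvec u - rvec v" "rvec 0 = 0"
  "rvec (of_nat k *s u) = real k *\<^sub>R rvec u" "rvec (of_int l *s u) = real_of_int l *\<^sub>R rvec u"
  by (simp_all add: rvec_def vec_eq_iff)

lemma inj_rvec: "inj rvec"
  by (auto simp: inj_on_def rvec_def vec_eq_iff)

lemma rvec_sum: "rvec (\<Sum>i\<in>I. f i) = (\<Sum>i\<in>I. rvec (f i))"
  by (induction I rule: infinite_finite_induct) simp_all

lemma finite_lattice_points: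
  fixes S :: "(real ^ 'n) set"
  assumes "bounded S"
  shows "finite {u. rvec u \<in> S}"
proof -
  obtain K where K: "\<And>x. x \<in> S \<Longrightarrow> norm x \<le> K"
    using assms by (auto simp: bounded_iff)
  define N where "N = \<lceil>K\<rceil>"
  have "finite (vec_lambda ` (UNIV \<rightarrow>\<^sub>E {-N..N}) :: (int ^ 'n) set)"
    by (intro finite_imageI finite_PiE) auto
  moreover have "{u. rvec u \<in> S} \<subseteq> vec_lambda ` (UNIV \<rightarrow>\<^sub>E {-N..N})"
  proof
    fix u :: "int ^ 'n" assume u: "u \<in> {u. rvec u \<in> S}"
    have "\<bar>u $ i\<bar> \<le> N" for i
    proof -
      have "\<bar>real_of_int (u $ i)\<bar> \<le> norm (rvec u)"
        using component_le_norm_cart[of "rvec u" i] by (simp add: rvec_def)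
      also have "\<dots> \<le> K" using u K by auto
      finally show ?thesis unfolding N_def by linarith
    qed
    then have "vec_nth u \<in> UNIV \<rightarrow>\<^sub>E {-N..N}" by (auto simp: abs_le_iff) (smt (verit))
    then show "u \<in> vec_lambda ` (UNIV \<rightarrow>\<^sub>E {-N..N})"
      by (metis image_eqI vec_nth_inverse)
  qed
  ultimately show ?thesis by (rule finite_subset[rotated])
qed

text \<open>Pigeonhole on residues modulo 1: two multiples i d and j d with the same representative
  in A differ by an integer, so m = j - i works.\<close>

lemma bounded_multiples_rational:
  fixes d :: real
  assumes "finite A" "\<And>k::nat. \<exists>r\<in>A. \<exists>l::int. real k * d = real_of_int l + r"
  shows "\<exists>m>0. \<exists>l::int. real m * d = real_of_int l"
proof -
  obtain r l where r: "\<And>k::nat. r k \<in> A" "\<And>k::nat. real k * d = real_of_int (l k) + r k"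
    using assms(2) by metis
  have "\<not> inj r"
    using assms(1) r(1) by (metis finite_imageD finite_subset image_subsetI infinite_UNIV_nat)
  then obtain i j where ij: "i < j" "r i = r j"
    by (metis injI linorder_neqE_nat)
  have "real (j - i) * d = real_of_int (l j - l i)"
    using r(2)[of i] r(2)[of j] ij by (simp add: of_nat_diff algebra_simps)
  with ij show ?thesis by (metis zero_less_diff)
qed

section \<open>The cone of lattice points and the degree function\<close>

locale lattice_polytope =
  fixes \<Delta> :: "(real ^ 'n) set"
  assumes integral: "integral_polytope \<Delta>" and zero_mem: "0 \<in> \<Delta>"
begin

lemma convex: "convex \<Delta>" and compact: "compact \<Delta>"
  using integral by (auto simp: integral_polytope_def polytope_imp_convex polytope_imp_compact)

lemma cone_lattice_iff: "u \<in> cone_lattice \<Delta> \<longleftrightarrow> (\<exists>c\<ge>0. rvec u \<in> (\<lambda>x. c *\<^sub>R x) ` \<Delta>)"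
proof -
  have "convex_cone hull \<Delta> = (\<Union>x \<in> \<Delta>. \<Union>c\<in>{0..}. {c *\<^sub>R x})"
    using zero_mem by (subst convex_cone_hull_convex_hull_nonempty) (auto simp: convex convex_hull_eq[THEN iffD2])
  then show ?thesis by (auto simp: cone_lattice_def)
qed

lemma zero_in_cone_lattice [simp]: "0 \<in> cone_lattice \<Delta>"
  using zero_mem by (auto simp: cone_lattice_iff intro!: exI[of _ 0])

lemma scaled_bounded: "bounded {x. \<exists>c\<in>{0..K}. x \<in> (\<lambda>x. c *\<^sub>R x) ` \<Delta>}"
proof -
  have "compact ((\<lambda>(c, x). c *\<^sub>R x) ` ({0..K} \<times> \<Delta>))"
    by (intro compact_continuous_image compact_Times compact)
      (auto simp: case_prod_unfold intro!: continuous_intros)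
  moreover have "{x. \<exists>c\<in>{0..K}. x \<in> (\<lambda>x. c *\<^sub>R x) ` \<Delta>} = (\<lambda>(c, x). c *\<^sub>R x) ` ({0..K} \<times> \<Delta>)"
    by force
  ultimately show ?thesis by (simp add: compact_imp_bounded)
qed

text \<open>\<open>deg\<close> is a \<open>LEAST\<close> over real numbers, which is meaningful only
  if the minimum is attained. It is: below any admissible K the pairs (c, x) with c x = u form a
  compact set, and its projection to c has a least element.\<close>

lemma deg_attained:
  assumes "u \<in> cone_lattice \<Delta>"
  shows deg_nonneg: "0 \<le> deg \<Delta> u"
    and rvec_in_deg: "rvec u \<in> (\<lambda>x. deg \<Delta> u *\<^sub>R x) ` \<Delta>"
    and deg_le: "\<And>c. 0 \<le> c \<Longrightarrow> rvec u \<in> (\<lambda>x. c *\<^sub>R x) ` \<Delta> \<Longrightarrow> deg \<Delta> u \<le> c"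
proof -
  let ?P = "\<lambda>c. 0 \<le> c \<and> rvec u \<in> (\<lambda>x. c *\<^sub>R x) ` \<Delta>"
  obtain K where K: "?P K" using assms by (auto simp: cone_lattice_iff)
  define S where "S = {cx \<in> {0..K} \<times> \<Delta>. fst cx *\<^sub>R snd cx = rvec u}"
  have "closed {cx :: real \<times> (real ^ 'n). fst cx *\<^sub>R snd cx = rvec u}"
    by (intro closed_Collect_eq continuous_intros)
  moreover have "S = ({0..K} \<times> \<Delta>) \<inter> {cx. fst cx *\<^sub>R snd cx = rvec u}" by (auto simp: S_def)
  ultimately have "compact S"
    by (simp add: compact_Int_closed compact_Times compact)
  then have "compact (fst ` S)"
    by (intro compact_continuous_image continuous_on_fst continuous_on_id)
  moreover have "fst ` S \<noteq> {}" using K by (force simp: S_def)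
  ultimately obtain c where c: "c \<in> fst ` S" "\<And>d. d \<in> fst ` S \<Longrightarrow> c \<le> d"
    using compact_attains_inf by metis
  have Pc: "?P c" using c(1) by (auto simp: S_def image_iff) metis
  have "c \<le> d" if "?P d" for d
  proof (cases "d \<le> K")
    case True
    then have "d \<in> fst ` S" using that by (force simp: S_def)
    then show ?thesis by (rule c(2))
  next
    case False
    then show ?thesis using c(1) by (auto simp: S_def)
  qed
  then have "deg \<Delta> u = c" unfolding deg_def using Pc by (intro Least_equality) auto
  with Pc \<open>\<And>d. ?P d \<Longrightarrow> c \<le> d\<close>
  show "0 \<le> deg \<Delta> u" "rvec u \<in> (\<lambda>x. deg \<Delta> u *\<^sub>R x) ` \<Delta>"
    "\<And>c. 0 \<le> c \<Longrightarrow> rvec u \<in> (\<lambda>x. c *\<^sub>R x) ` \<Delta> \<Longrightarrow> deg \<Delta> u \<le> c"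
    by auto
qed

lemma finite_deg_le: "finite {u \<in> cone_lattice \<Delta>. deg \<Delta> u \<le> K}"
proof (rule finite_subset)
  show "{u \<in> cone_lattice \<Delta>. deg \<Delta> u \<le> K} \<subseteq> {u. rvec u \<in> {x. \<exists>c\<in>{0..K}. x \<in> (\<lambda>x. c *\<^sub>R x) ` \<Delta>}}"
    using deg_nonneg rvec_in_deg by fastforce
qed (intro finite_lattice_points scaled_bounded)

text \<open>Convexity with weights c/(c+d) and d/(c+d). This is the source of the subadditivity of
  \<open>deg\<close>.\<close>

lemma scaled_add:
  assumes "0 \<le> c" "0 \<le> d" "x \<in> (\<lambda>x. c *\<^sub>R x) ` \<Delta>" "y \<in> (\<lambda>x. d *\<^sub>R x) ` \<Delta>"
  shows "x + y \<in> (\<lambda>x. (c + d) *\<^sub>R x) ` \<Delta>"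
proof (cases "c + d = 0")
  case True
  then have "c = 0" "d = 0" using assms by auto
  then show ?thesis using assms by auto
next
  case False
  then have pos: "c + d > 0" using assms by auto
  obtain x' y' where xy: "x' \<in> \<Delta>" "y' \<in> \<Delta>" "x = c *\<^sub>R x'" "y = d *\<^sub>R y'" using assms by auto
  have "(c / (c + d)) *\<^sub>R x' + (d / (c + d)) *\<^sub>R y' \<in> \<Delta>"
    using pos assms xy by (intro convexD[OF convex]) (auto simp: add_divide_distrib[symmetric])
  moreover have "x + y = (c + d) *\<^sub>R ((c / (c + d)) *\<^sub>R x' + (d / (c + d)) *\<^sub>R y')"
    using pos by (simp add: xy scaleR_add_right)
  ultimately show ?thesis by blast
qed

lemma cone_lattice_add:
  assumes "u \<in> cone_lattice \<Delta>" "v \<in> cone_lattice \<Delta>"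
  shows "u + v \<in> cone_lattice \<Delta>" and deg_add_le: "deg \<Delta> (u + v) \<le> deg \<Delta> u + deg \<Delta> v"
proof -
  have *: "rvec (u + v) \<in> (\<lambda>x. (deg \<Delta> u + deg \<Delta> v) *\<^sub>R x) ` \<Delta>"
    using scaled_add[OF deg_nonneg deg_nonneg rvec_in_deg rvec_in_deg] assms by simp
  have "0 \<le> deg \<Delta> u + deg \<Delta> v" using deg_nonneg assms by simp
  with * show "u + v \<in> cone_lattice \<Delta>" unfolding cone_lattice_iff by blast
  then show "deg \<Delta> (u + v) \<le> deg \<Delta> u + deg \<Delta> v"
    using * deg_nonneg assms by (intro deg_le) auto
qed

lemma deg_zero [simp]: "deg \<Delta> 0 = 0"
  using deg_nonneg[of 0] deg_le[of 0 0] zero_mem by (force simp: image_iff)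

text \<open>Both directions matter for \<open>Psi_p\<close>, which takes the coefficient at pu: it
  has to vanish exactly by the same rule as the one at u.\<close>

lemma cone_lattice_scale_iff:
  assumes "k > 0"
  shows "of_nat k *s u \<in> cone_lattice \<Delta> \<longleftrightarrow> u \<in> cone_lattice \<Delta>"
proof -
  have "(real k * c) *\<^sub>R x = rvec (of_nat k *s u) \<longleftrightarrow> c *\<^sub>R x = rvec u" for c x
    using assms by (simp flip: scaleR_scaleR)
  then have *: "rvec (of_nat k *s u) \<in> (\<lambda>x. (real k * c) *\<^sub>R x) ` \<Delta> \<longleftrightarrow> rvec u \<in> (\<lambda>x. c *\<^sub>R x) ` \<Delta>" for c
    by (auto simp: image_iff) (metis+)?
  show ?thesis
  proof
    assume "of_nat k *s u \<in> cone_lattice \<Delta>"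
    then obtain c where c: "c \<ge> 0" "rvec (of_nat k *s u) \<in> (\<lambda>x. c *\<^sub>R x) ` \<Delta>"
      by (auto simp: cone_lattice_iff)
    then show "u \<in> cone_lattice \<Delta>"
      using *[of "c / k"] assms by (auto simp: cone_lattice_iff intro!: exI[of _ "c / k"])
  next
    assume "u \<in> cone_lattice \<Delta>"
    then obtain c where c: "c \<ge> 0" "rvec u \<in> (\<lambda>x. c *\<^sub>R x) ` \<Delta>"
      by (auto simp: cone_lattice_iff)
    then show "of_nat k *s u \<in> cone_lattice \<Delta>"
      using *[of c] assms unfolding cone_lattice_iff by (intro exI[of _ "real k * c"]) auto
  qed
qed

lemma deg_scale:
  assumes "u \<in> cone_lattice \<Delta>"
  shows "deg \<Delta> (of_nat k *s u) = real k * deg \<Delta> u"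
proof (cases "k = 0")
  case False
  have ku: "of_nat k *s u \<in> cone_lattice \<Delta>" using assms False by (simp add: cone_lattice_scale_iff)
  obtain x where x: "x \<in> \<Delta>" "rvec u = deg \<Delta> u *\<^sub>R x" using rvec_in_deg assms by blast
  obtain y where y: "y \<in> \<Delta>" "rvec (of_nat k *s u) = deg \<Delta> (of_nat k *s u) *\<^sub>R y"
    using rvec_in_deg ku by blast
  have "deg \<Delta> (of_nat k *s u) \<le> real k * deg \<Delta> u"
    using x deg_nonneg[OF assms] by (intro deg_le ku) (auto intro!: image_eqI[of _ _ x])
  moreover have "rvec u = (deg \<Delta> (of_nat k *s u) / real k) *\<^sub>R y"
  proof -
    have "real k *\<^sub>R rvec u = deg \<Delta> (of_nat k *s u) *\<^sub>R y" using y by simp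
    then have "(1 / real k) *\<^sub>R real k *\<^sub>R rvec u = (1 / real k) *\<^sub>R deg \<Delta> (of_nat k *s u) *\<^sub>R y"
      by simp
    then show ?thesis using False by simp
  qed
  then have "deg \<Delta> u \<le> deg \<Delta> (of_nat k *s u) / real k"
    using y deg_nonneg[OF ku] by (intro deg_le assms) auto
  then have "real k * deg \<Delta> u \<le> deg \<Delta> (of_nat k *s u)"
    using False by (simp add: field_simps)
  ultimately show ?thesis by simp
qed simp

section \<open>Vertex representations and the common denominator of all degrees\<close>

definition vertices :: "(int ^ 'n) set" where
  "vertices = {v. rvec v extreme_point_of \<Delta>}"

lemma finite_vertices: "finite vertices"
proof (rule finite_subset)
  show "vertices \<subseteq> {u. rvec u \<in> \<Delta>}" by (auto simp: vertices_def extreme_point_of_def)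
qed (intro finite_lattice_points compact_imp_bounded compact)

lemma hull_vertices: "\<Delta> = convex hull (rvec ` vertices)"
proof -
  have "{x. x extreme_point_of \<Delta>} = rvec ` vertices"
    using integral by (auto simp: vertices_def integral_polytope_def)
  then show ?thesis using Krein_Milman_Minkowski[OF compact convex] by simp
qed

text \<open>Scaled convex combinations of vertices. Consequently the degree is the least total mass
  of a nonnegative vertex combination. For c = 0 all coefficients vanish, which matches the scaled
  polytope being {0}.\<close>

lemma scaled_iff_vertices:
  assumes "0 \<le> c"
  shows "x \<in> (\<lambda>x. c *\<^sub>R x) ` \<Delta> \<longleftrightarrow>
    (\<exists>t. (\<forall>v\<in>vertices. 0 \<le> t v) \<and> sum t vertices = c \<and> (\<Sum>v\<in>vertices. t v *\<^sub>R rvec v) = x)"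
    (is "_ \<longleftrightarrow> (\<exists>t. ?P t)")
proof -
  have hull: "y \<in> \<Delta> \<longleftrightarrow> (\<exists>t. (\<forall>v\<in>vertices. 0 \<le> t v) \<and> sum t vertices = 1 \<and>
      (\<Sum>v\<in>vertices. t v *\<^sub>R rvec v) = y)" for y
  proof -
    have "y \<in> \<Delta> \<longleftrightarrow> (\<exists>s. (\<forall>x\<in>rvec ` vertices. 0 \<le> s x) \<and> sum s (rvec ` vertices) = 1 \<and>
      (\<Sum>x\<in>rvec ` vertices. s x *\<^sub>R x) = y)"
    proof -
      have "y \<in> \<Delta> \<longleftrightarrow> y \<in> convex hull (rvec ` vertices)"
        by (rule arg_cong[OF hull_vertices, of "\<lambda>S. y \<in> S"])
      then show ?thesis
        by (simp only: convex_hull_finite[OF finite_imageI[OF finite_vertices]] mem_Collect_eq)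
    qed
    also have "\<dots> \<longleftrightarrow> (\<exists>s. (\<forall>v\<in>vertices. 0 \<le> s (rvec v)) \<and> (\<Sum>v\<in>vertices. s (rvec v)) = 1 \<and>
      (\<Sum>v\<in>vertices. s (rvec v) *\<^sub>R rvec v) = y)"
      by (simp add: sum.reindex[OF inj_on_subset[OF inj_rvec]])
    also have "\<dots> \<longleftrightarrow> (\<exists>t. (\<forall>v\<in>vertices. 0 \<le> t v) \<and> sum t vertices = 1 \<and>
      (\<Sum>v\<in>vertices. t v *\<^sub>R rvec v) = y)"
    proof
      assume "\<exists>t. (\<forall>v\<in>vertices. 0 \<le> t v) \<and> sum t vertices = 1 \<and> (\<Sum>v\<in>vertices. t v *\<^sub>R rvec v) = y"
      then obtain t where "(\<forall>v\<in>vertices. 0 \<le> t v) \<and> sum t vertices = 1 \<and> (\<Sum>v\<in>vertices. t v *\<^sub>R rvec v) = y" ..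
      then show "\<exists>s. (\<forall>v\<in>vertices. 0 \<le> s (rvec v)) \<and> (\<Sum>v\<in>vertices. s (rvec v)) = 1 \<and>
        (\<Sum>v\<in>vertices. s (rvec v) *\<^sub>R rvec v) = y"
        by (intro exI[of _ "t \<circ> inv rvec"]) (simp add: inv_f_f[OF inj_rvec])
    next
      assume "\<exists>s. (\<forall>v\<in>vertices. 0 \<le> s (rvec v)) \<and> (\<Sum>v\<in>vertices. s (rvec v)) = 1 \<and>
        (\<Sum>v\<in>vertices. s (rvec v) *\<^sub>R rvec v) = y"
      then obtain s where "(\<forall>v\<in>vertices. 0 \<le> s (rvec v)) \<and> (\<Sum>v\<in>vertices. s (rvec v)) = 1 \<and>
        (\<Sum>v\<in>vertices. s (rvec v) *\<^sub>R rvec v) = y" ..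
      then show "\<exists>t. (\<forall>v\<in>vertices. 0 \<le> t v) \<and> sum t vertices = 1 \<and> (\<Sum>v\<in>vertices. t v *\<^sub>R rvec v) = y"
        by (intro exI[of _ "s \<circ> rvec"]) simp
    qed
    finally show ?thesis .
  qed
  show ?thesis
  proof
    assume "x \<in> (\<lambda>x. c *\<^sub>R x) ` \<Delta>"
    then obtain y where y: "y \<in> \<Delta>" "x = c *\<^sub>R y" by blast
    then obtain t where "(\<forall>v\<in>vertices. 0 \<le> t v) \<and> sum t vertices = 1 \<and>
      c *\<^sub>R (\<Sum>v\<in>vertices. t v *\<^sub>R rvec v) = x" unfolding hull by metis
    then have "?P (\<lambda>v. c * t v)"
      using assms by (auto simp: scaleR_sum_right sum_distrib_left[symmetric])
    then show "\<exists>t. ?P t" by (intro exI[of _ "\<lambda>v. c * t v"])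
  next
    assume "\<exists>t. ?P t"
    then obtain t where t: "?P t" ..
    show "x \<in> (\<lambda>x. c *\<^sub>R x) ` \<Delta>"
    proof (cases "c = 0")
      case True
      then have "\<forall>v\<in>vertices. t v = 0"
        using t finite_vertices sum_nonneg_eq_0_iff[of vertices t] by blast
      then have "x = 0" using t by force
      then show ?thesis using zero_mem True by force
    next
      case False
      have "(1 / c) *\<^sub>R x \<in> \<Delta>"
        unfolding hull using t False assms
        by (intro exI[of _ "\<lambda>v. t v / c"]) (auto simp: scaleR_sum_right sum_divide_distrib[symmetric])
      then show ?thesis using False by (force simp: image_iff)
    qed
  qed
qed

text \<open>
  Write \<open>u = \<Sum>\<^sub>v t\<^sub>v v\<close> over the vertices with \<open>\<Sum>\<^sub>v t\<^sub>v = deg u\<close> minimal. The fractional parts of the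
  \<open>t\<^sub>v\<close> represent an integral point \<open>r\<close> of a bounded region, again minimally, so that \<open>deg u - deg r\<close>
  is an integer.
\<close>

lemma finite_deg_mod_1:
  "\<exists>A. finite A \<and> A \<subseteq> cone_lattice \<Delta> \<and>
    (\<forall>u\<in>cone_lattice \<Delta>. \<exists>r\<in>A. \<exists>l::int. deg \<Delta> u = real_of_int l + deg \<Delta> r)"
proof (intro exI[of _ "{r \<in> cone_lattice \<Delta>. deg \<Delta> r \<le> card vertices}"] conjI ballI)
  show "finite {r \<in> cone_lattice \<Delta>. deg \<Delta> r \<le> card vertices}" by (rule finite_deg_le)
  fix u assume u: "u \<in> cone_lattice \<Delta>"
  obtain t where t: "\<And>v. v \<in> vertices \<Longrightarrow> 0 \<le> t v" "sum t vertices = deg \<Delta> u"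
      "(\<Sum>v\<in>vertices. t v *\<^sub>R rvec v) = rvec u"
    using rvec_in_deg[OF u] scaled_iff_vertices[OF deg_nonneg[OF u]] by blast
  define r where "r = u - (\<Sum>v\<in>vertices. of_int \<lfloor>t v\<rfloor> *s v)"
  have frac: "0 \<le> frac x" "frac x \<le> 1" for x :: real
    using frac_lt_1[of x] by auto
  have "rvec r = (\<Sum>v\<in>vertices. t v *\<^sub>R rvec v - real_of_int \<lfloor>t v\<rfloor> *\<^sub>R rvec v)"
    by (simp only: r_def rvec_simps rvec_sum t(3)[symmetric] sum_subtractf)
  also have "\<dots> = (\<Sum>v\<in>vertices. frac (t v) *\<^sub>R rvec v)"
    by (simp add: frac_def scaleR_diff_left)
  finally have rr: "rvec r = (\<Sum>v\<in>vertices. frac (t v) *\<^sub>R rvec v)" .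
  define c where "c = (\<Sum>v\<in>vertices. frac (t v))"
  have c0: "0 \<le> c" by (auto simp: c_def intro!: sum_nonneg frac)
  have rc: "rvec r \<in> (\<lambda>x. c *\<^sub>R x) ` \<Delta>"
    unfolding scaled_iff_vertices[OF c0]
    by (rule exI[of _ "\<lambda>v. frac (t v)"]) (simp add: rr c_def frac)
  then have r: "r \<in> cone_lattice \<Delta>" using c0 by (auto simp: cone_lattice_iff)
  have "deg \<Delta> r \<le> c" using deg_le[OF r c0 rc] .
  moreover have "c \<le> real (card vertices)"
    using sum_mono[of vertices "\<lambda>v. frac (t v)" "\<lambda>_. 1"] by (simp add: c_def frac)
  moreover have "deg \<Delta> u - deg \<Delta> r = (\<Sum>v\<in>vertices. real_of_int \<lfloor>t v\<rfloor>)"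
  proof -
    obtain s where s: "\<And>v. v \<in> vertices \<Longrightarrow> 0 \<le> s v" "sum s vertices = deg \<Delta> r"
        "(\<Sum>v\<in>vertices. s v *\<^sub>R rvec v) = rvec r"
      using rvec_in_deg[OF r] scaled_iff_vertices[OF deg_nonneg[OF r]] by blast
    \<comment> \<open>Adding the floors back to an optimal representation of r gives a
      representation of u of mass \<open>?e\<close>. This bounds the degree of u from above; the
      bound of the degree of r by c gives the reverse inequality.\<close>
    let ?e = "(\<Sum>v\<in>vertices. s v + real_of_int \<lfloor>t v\<rfloor>)"
    have e0: "0 \<le> ?e" using s(1) t(1) by (intro sum_nonneg add_nonneg_nonneg) auto
    have "(\<Sum>v\<in>vertices. (s v + real_of_int \<lfloor>t v\<rfloor>) *\<^sub>R rvec v)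
        = rvec r + rvec (\<Sum>v\<in>vertices. of_int \<lfloor>t v\<rfloor> *s v)"
      by (simp only: rvec_sum rvec_simps s(3)[symmetric] sum.distrib[symmetric] scaleR_add_left)
    also have "\<dots> = rvec u"
      unfolding rvec_simps(1)[symmetric] by (simp add: r_def)
    finally have "rvec u \<in> (\<lambda>x. ?e *\<^sub>R x) ` \<Delta>"
      unfolding scaled_iff_vertices[OF e0] using s(1) t(1)
      by (intro exI[of _ "\<lambda>v. s v + real_of_int \<lfloor>t v\<rfloor>"]) auto
    then have "deg \<Delta> u \<le> deg \<Delta> r + (\<Sum>v\<in>vertices. real_of_int \<lfloor>t v\<rfloor>)"
      using deg_le[OF u e0] s(2) by (simp add: sum.distrib)
    moreover have "deg \<Delta> u = c + (\<Sum>v\<in>vertices. real_of_int \<lfloor>t v\<rfloor>)"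
      unfolding t(2)[symmetric] c_def sum.distrib[symmetric] by (simp add: frac_def)
    ultimately show ?thesis using \<open>deg \<Delta> r \<le> c\<close> by simp
  qed
  ultimately show "\<exists>r\<in>{r \<in> cone_lattice \<Delta>. deg \<Delta> r \<le> card vertices}.
      \<exists>l::int. deg \<Delta> u = real_of_int l + deg \<Delta> r"
    using r by (intro bexI[of _ r] exI[of _ "\<Sum>v\<in>vertices. \<lfloor>t v\<rfloor>"]) auto
qed auto

text \<open>Gives the \<open>LEAST\<close> in \<open>denom\<close> a witness. By
  \<open>finite_deg_mod_1\<close> the multiples of the degree of a representative r take finitely
  many values modulo 1, so this degree is rational by pigeonhole; the product of the denominators
  over the finite set of representatives serves every u.\<close>

lemma common_denominator:
  "\<exists>d>0. \<forall>u\<in>cone_lattice \<Delta>. \<exists>k::int. deg \<Delta> u = real_of_int k / real d"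
proof -
  obtain A where A: "finite A" "A \<subseteq> cone_lattice \<Delta>"
    "\<And>u. u \<in> cone_lattice \<Delta> \<Longrightarrow> \<exists>r\<in>A. \<exists>l::int. deg \<Delta> u = real_of_int l + deg \<Delta> r"
    using finite_deg_mod_1 by blast
  have "\<exists>m>0. \<exists>l::int. real m * deg \<Delta> r = real_of_int l" if "r \<in> A" for r
  proof (rule bounded_multiples_rational[of "deg \<Delta> ` A"])
    fix k :: nat
    have r: "r \<in> cone_lattice \<Delta>" using that A by auto
    have "of_nat k *s r \<in> cone_lattice \<Delta>"
      using r by (cases "k = 0") (simp_all add: cone_lattice_scale_iff)
    then show "\<exists>s\<in>deg \<Delta> ` A. \<exists>l::int. real k * deg \<Delta> r = real_of_int l + s"
      using A(3) by (auto simp: deg_scale[OF r, symmetric])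
  qed (use A in auto)
  then obtain m where m: "\<And>r. r \<in> A \<Longrightarrow> 0 < m r" "\<And>r. r \<in> A \<Longrightarrow> \<exists>l::int. real (m r) * deg \<Delta> r = real_of_int l"
    by metis
  define d where "d = (\<Prod>r\<in>A. m r)"
  have d0: "d > 0" using m A(1) by (auto simp: d_def intro!: prod_pos)
  moreover have "\<exists>k::int. deg \<Delta> u = real_of_int k / real d" if u: "u \<in> cone_lattice \<Delta>" for u
  proof -
    obtain r l where r: "r \<in> A" "deg \<Delta> u = real_of_int l + deg \<Delta> r" using A(3)[OF u] by blast
    obtain l' where l': "real (m r) * deg \<Delta> r = real_of_int l'" using m r by blast
    obtain e where e: "d = m r * e" using r A(1) unfolding d_def by (metis dvdE dvd_prodI)
    have "real d * deg \<Delta> u = real_of_int (int d * l + int e * l')"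
      using l' by (simp add: r e algebra_simps)
    then show ?thesis using d0 by (intro exI[of _ "int d * l + int e * l'"]) (simp add: field_simps)
  qed
  ultimately show ?thesis by blast
qed

lemma denom_pos: "denom \<Delta> > 0"
  and denom_deg: "u \<in> cone_lattice \<Delta> \<Longrightarrow> \<exists>k::int. deg \<Delta> u = real_of_int k / real (denom \<Delta>)"
  using LeastI_ex[OF common_denominator] unfolding denom_def by auto

text \<open>The exponent of \<open>fps_X\<close> in \<open>pi_deg\<close>. Being a natural number,
  it turns bounds on \<open>ord_T\<close> into divisibility by powers of
  \<open>fps_X\<close>.\<close>

definition wt :: "int ^ 'n \<Rightarrow> nat" where
  "wt u = nat \<lfloor>real (denom \<Delta>) * deg \<Delta> u\<rfloor>"

lemma pi_deg_eq: "pi_deg \<Delta> u = fps_X ^ wt u"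
  by (simp add: pi_deg_def wt_def)

lemma wt_eq: "u \<in> cone_lattice \<Delta> \<Longrightarrow> real (wt u) = real (denom \<Delta>) * deg \<Delta> u"
proof -
  assume u: "u \<in> cone_lattice \<Delta>"
  obtain k where k: "deg \<Delta> u = real_of_int k / real (denom \<Delta>)" using denom_deg[OF u] by blast
  then have "real (denom \<Delta>) * deg \<Delta> u = real_of_int k" using denom_pos by simp
  moreover have "0 \<le> real (denom \<Delta>) * deg \<Delta> u" using deg_nonneg[OF u] by simp
  ultimately show ?thesis by (simp add: wt_def)
qed

lemma deg_eq: "u \<in> cone_lattice \<Delta> \<Longrightarrow> deg \<Delta> u = real (wt u) / real (denom \<Delta>)"
  using denom_pos by (simp add: wt_eq)

lemma wt_zero [simp]: "wt 0 = 0"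
  by (simp add: wt_def)

lemma wt_add_le:
  assumes "u \<in> cone_lattice \<Delta>" "v \<in> cone_lattice \<Delta>"
  shows "wt (u + v) \<le> wt u + wt v"
proof -
  have "real (wt (u + v)) \<le> real (wt u + wt v)"
    using assms denom_pos by (simp add: wt_eq cone_lattice_add deg_add_le flip: distrib_left)
  then show ?thesis by linarith
qed

lemma wt_scale:
  assumes "u \<in> cone_lattice \<Delta>"
  shows "wt (of_nat k *s u) = k * wt u"
proof (cases "k = 0")
  case False
  then have "real (wt (of_nat k *s u)) = real (k * wt u)"
    using assms by (simp add: wt_eq cone_lattice_scale_iff deg_scale)
  then show ?thesis by linarith
qed simp

text \<open>Points of the polytope have degree at most 1. This is what puts the Artin--Hasse
  factors, with one \<pi> for each x^u, into L.\<close>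

lemma wt_le_denom:
  assumes "rvec u \<in> \<Delta>"
  shows "u \<in> cone_lattice \<Delta>" "wt u \<le> denom \<Delta>"
proof -
  have 1: "rvec u \<in> (\<lambda>x. 1 *\<^sub>R x) ` \<Delta>" using assms by simp
  then show u: "u \<in> cone_lattice \<Delta>" unfolding cone_lattice_iff by (meson zero_le_one)
  have "deg \<Delta> u \<le> 1" using deg_le[OF u _ 1] by simp
  then have "real (wt u) \<le> real (denom \<Delta>)" using denom_pos u by (simp add: wt_eq)
  then show "wt u \<le> denom \<Delta>" by linarith
qed

lemma finite_wt_le: "finite {u \<in> cone_lattice \<Delta>. wt u \<le> n}"
proof (rule finite_subset)
  show "{u \<in> cone_lattice \<Delta>. wt u \<le> n} \<subseteq> {u \<in> cone_lattice \<Delta>. deg \<Delta> u \<le> real n}"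
  proof clarify
    fix u assume u: "u \<in> cone_lattice \<Delta>" "wt u \<le> n"
    have "deg \<Delta> u = real (wt u) / real (denom \<Delta>)" using u by (simp add: deg_eq)
    also have "\<dots> \<le> real (wt u) / 1"
      using denom_pos by (intro divide_left_mono) auto
    finally show "deg \<Delta> u \<le> real n" using u by linarith
  qed
qed (rule finite_deg_le)

end

section \<open>Power series modulo powers of the variable\<close>

lemma fps_X_power_dvd_iff:
  fixes f :: "'r::comm_ring_1 fps"
  shows "fps_X ^ n dvd f \<longleftrightarrow> (\<forall>i<n. fps_nth f i = 0)"
proof
  assume "\<forall>i<n. fps_nth f i = 0"
  then have "f = fps_X ^ n * fps_shift n f"
    by (intro fps_ext) (auto simp: fps_X_power_mult_nth)
  then show "fps_X ^ n dvd f" by (metis dvd_triv_left)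
qed (auto simp: fps_X_power_mult_nth elim!: dvdE)

lemma fps_X_power_mult_shift:
  fixes f :: "'r::comm_ring_1 fps"
  assumes "fps_X ^ n dvd f"
  shows "fps_X ^ n * fps_shift n f = f"
  using assms by (intro fps_ext) (auto simp: fps_X_power_mult_nth fps_X_power_dvd_iff)

lemma fps_X_power_dvd_shift_iff:
  fixes f :: "'r::idom fps"
  assumes "fps_X ^ n dvd f"
  shows "fps_X ^ k dvd fps_shift n f \<longleftrightarrow> fps_X ^ (k + n) dvd f"
proof -
  have "fps_X ^ (k + n) dvd fps_X ^ n * fps_shift n f \<longleftrightarrow> fps_X ^ k dvd fps_shift n f"
    unfolding power_add mult.commute[of "fps_X ^ k"] by (subst dvd_mult_cancel_left) auto
  then show ?thesis by (simp add: fps_X_power_mult_shift[OF assms])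
qed

text \<open>The working relation for everything infinite: modulo a fixed power of the variable
  infinite sums and matrices become finite, and congruence for all n is equality by
  \<open>fps_eq_mod_all_imp_eq\<close>.\<close>

definition fps_eq_mod :: "nat \<Rightarrow> 'r::comm_ring_1 fps \<Rightarrow> 'r fps \<Rightarrow> bool" where
  "fps_eq_mod n f g \<longleftrightarrow> fps_X ^ n dvd f - g"

lemma fps_eq_mod_refl [simp, intro]: "fps_eq_mod n f f"
  and fps_eq_mod_sym: "fps_eq_mod n f g \<Longrightarrow> fps_eq_mod n g f"
  and fps_eq_mod_trans [trans]: "fps_eq_mod n f g \<Longrightarrow> fps_eq_mod n g h \<Longrightarrow> fps_eq_mod n f h"
  and fps_eq_mod_mult: "fps_eq_mod n f g \<Longrightarrow> fps_eq_mod n f' g' \<Longrightarrow> fps_eq_mod n (f * f') (g * g')"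
  and fps_eq_mod_add: "fps_eq_mod n f g \<Longrightarrow> fps_eq_mod n f' g' \<Longrightarrow> fps_eq_mod n (f + f') (g + g')"
proof -
  show "fps_eq_mod n f f" by (simp add: fps_eq_mod_def)
  show "fps_eq_mod n g f" if "fps_eq_mod n f g"
    using that by (metis fps_eq_mod_def dvd_minus_iff minus_diff_eq)
  show "fps_eq_mod n f h" if "fps_eq_mod n f g" "fps_eq_mod n g h"
    using dvd_add[OF that[unfolded fps_eq_mod_def]] by (simp add: fps_eq_mod_def)
  show "fps_eq_mod n (f * f') (g * g')" if "fps_eq_mod n f g" "fps_eq_mod n f' g'"
  proof -
    have "f * f' - g * g' = f * (f' - g') + (f - g) * g'" by (simp add: algebra_simps)
    then show ?thesis using that by (auto simp: fps_eq_mod_def)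
  qed
  show "fps_eq_mod n (f + f') (g + g')" if "fps_eq_mod n f g" "fps_eq_mod n f' g'"
    using dvd_add[OF that[unfolded fps_eq_mod_def]] by (simp add: fps_eq_mod_def algebra_simps)
qed

lemma fps_eq_mod_sum:
  "(\<And>i. i \<in> I \<Longrightarrow> fps_eq_mod n (f i) (g i)) \<Longrightarrow> fps_eq_mod n (sum f I) (sum g I)"
  by (induction I rule: infinite_finite_induct) (auto intro!: fps_eq_mod_add)

lemma fps_eq_mod_0_iff [simp]: "fps_eq_mod n f 0 \<longleftrightarrow> fps_X ^ n dvd f"
  by (simp add: fps_eq_mod_def)

lemma fps_eq_mod_all_imp_eq:
  assumes "\<And>n. fps_eq_mod n f g"
  shows "f = g"
proof (rule fps_ext)
  fix i
  have "fps_X ^ Suc i dvd f - g" using assms by (simp only: fps_eq_mod_def)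
  then have "fps_nth (f - g) i = 0" unfolding fps_X_power_dvd_iff by blast
  then show "fps_nth f i = fps_nth g i" by simp
qed

lemma fps_eq_mod_nth: "fps_eq_mod n f g \<longleftrightarrow> (\<forall>i<n. fps_nth f i = fps_nth g i)"
  by (simp add: fps_eq_mod_def fps_X_power_dvd_iff)

lemma fps_eq_mod_sum_superset:
  assumes "finite G" "F \<subseteq> G" "\<And>v. v \<in> G - F \<Longrightarrow> fps_X ^ n dvd f v"
  shows "fps_eq_mod n (sum f G) (sum f F)"
proof -
  have "sum f G - sum f F = sum f (G - F)"
    using assms by (simp add: sum_diff)
  then show ?thesis using assms(3) by (auto simp: fps_eq_mod_def intro!: dvd_sum)
qed

text \<open>Each coefficient of the partial sums is eventually that of the limit, and a non-summable
  family has \<open>infsum\<close> equal to 0 by convention. So weight bounds pass from the terms to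
  the sums that make up \<open>E_f\<close>.\<close>

lemma fps_X_power_dvd_infsum:
  fixes f :: "'a \<Rightarrow> 'r::comm_ring_1 fps"
  assumes "\<And>v. v \<in> A \<Longrightarrow> fps_X ^ n dvd f v"
  shows "fps_X ^ n dvd infsum f A"
proof (cases "f summable_on A")
  case True
  then have lim: "(sum f \<longlongrightarrow> infsum f A) (finite_subsets_at_top A)"
    by (simp add: has_sum_infsum flip: has_sum_def)
  have "fps_nth (infsum f A) i = 0" if "i < n" for i
  proof -
    have "\<forall>\<^sub>F F in finite_subsets_at_top A. fps_nth (sum f F) i = fps_nth (infsum f A) i"
      using lim by (simp add: tendsto_fps_iff)
    then obtain F where F: "finite F" "F \<subseteq> A" "fps_nth (sum f F) i = fps_nth (infsum f A) i"
      by (auto simp: eventually_finite_subsets_at_top)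
    have "fps_X ^ n dvd sum f F" using F assms by (auto intro!: dvd_sum)
    then show ?thesis using F that by (simp add: fps_X_power_dvd_iff)
  qed
  then show ?thesis by (simp add: fps_X_power_dvd_iff)
qed (simp add: infsum_not_exists)

text \<open>Terms tending to 0, the nonarchimedean form of summability in the complete ring of power
  series.\<close>

definition null_family :: "('a \<Rightarrow> 'r::comm_ring_1 fps) \<Rightarrow> 'a set \<Rightarrow> bool" where
  "null_family f A \<longleftrightarrow> (\<forall>n. finite {v \<in> A. \<not> fps_X ^ n dvd f v})"

text \<open>Convergence of power series is coefficientwise: every partial sum over a set containing
  F is congruent to s, which fixes its first n coefficients.\<close>

lemma infsum_fpsI:
  fixes f :: "'a \<Rightarrow> 'r::comm_ring_1 fps"
  assumes "\<And>n. \<exists>F. finite F \<and> F \<subseteq> A \<and> (\<forall>v\<in>A - F. fps_X ^ n dvd f v) \<and> fps_eq_mod n (sum f F) s"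
  shows "infsum f A = s"
proof (rule infsumI)
  show "(f has_sum s) A"
    unfolding has_sum_def
  proof (rule tendsto_fpsI)
    fix i
    obtain F where F: "finite F" "F \<subseteq> A" "\<And>v. v \<in> A - F \<Longrightarrow> fps_X ^ Suc i dvd f v"
        "fps_eq_mod (Suc i) (sum f F) s"
      using assms by meson
    have "fps_nth (sum f G) i = fps_nth s i" if "finite G" "F \<subseteq> G" "G \<subseteq> A" for G
    proof -
      have "fps_eq_mod (Suc i) (sum f G) (sum f F)"
        using that F by (intro fps_eq_mod_sum_superset) auto
      then have "fps_eq_mod (Suc i) (sum f G) s"
        using F(4) fps_eq_mod_trans by blast
      then show ?thesis unfolding fps_eq_mod_nth by blast
    qed
    then show "\<forall>\<^sub>F G in finite_subsets_at_top A. fps_nth (sum f G) i = fps_nth s i"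
      using F(1,2) by (auto simp: eventually_finite_subsets_at_top)
  qed
qed

lemma infsum_fps_eq_mod:
  fixes f :: "'a \<Rightarrow> 'r::comm_ring_1 fps"
  assumes "null_family f A" "finite F" "F \<subseteq> A" "\<And>v. v \<in> A - F \<Longrightarrow> fps_X ^ n dvd f v"
  shows "fps_eq_mod n (infsum f A) (sum f F)"
proof -
  define F' where "F' m = {v \<in> A. \<not> fps_X ^ m dvd f v}" for m
  have fin: "finite (F' m)" for m using assms(1) by (simp add: F'_def null_family_def)
  \<comment> \<open>The limit is assembled coefficientwise: coefficient i is final once the terms
    not divisible by \<open>fps_X ^ Suc i\<close> have been summed.\<close>
  define s where "s = Abs_fps (\<lambda>i. fps_nth (sum f (F' (Suc i))) i)"
  have s: "fps_eq_mod m (sum f (F' m)) s" for m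
    unfolding fps_eq_mod_nth
  proof (intro allI impI)
    fix i assume "i < m"
    have "fps_eq_mod (Suc i) (sum f (F' m)) (sum f (F' (Suc i)))"
    proof (rule fps_eq_mod_sum_superset)
      show "F' (Suc i) \<subseteq> F' m"
        using dvd_trans[OF le_imp_power_dvd[OF Suc_leI[OF \<open>i < m\<close>]]] unfolding F'_def by blast
    qed (use fin in \<open>auto simp: F'_def\<close>)
    then show "fps_nth (sum f (F' m)) i = fps_nth s i"
      by (simp add: fps_eq_mod_nth s_def)
  qed
  have "infsum f A = s"
    by (rule infsum_fpsI) (use s fin in \<open>auto simp: F'_def intro!: exI[of _ "F' n" for n]\<close>)
  moreover have "fps_eq_mod n (sum f F) (sum f (F' n))"
    using assms fin by (intro fps_eq_mod_sum_superset) (auto simp: F'_def)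
  ultimately show ?thesis using s fps_eq_mod_sym fps_eq_mod_trans by blast
qed

lemma null_family_obtain:
  assumes "null_family f A"
  obtains F where "finite F" "F \<subseteq> A" "\<And>v. v \<in> A - F \<Longrightarrow> fps_X ^ n dvd f v"
proof (rule that[of "{v \<in> A. \<not> fps_X ^ n dvd f v}"])
  show "finite {v \<in> A. \<not> fps_X ^ n dvd f v}" using assms by (simp add: null_family_def)
qed auto

lemma null_family_mono:
  assumes "null_family f A" "\<And>n v. v \<in> A \<Longrightarrow> fps_X ^ n dvd f v \<Longrightarrow> fps_X ^ n dvd g v"
  shows "null_family g A"
  unfolding null_family_def
proof
  fix n
  have "finite {v \<in> A. \<not> fps_X ^ n dvd f v}" using assms(1) by (simp add: null_family_def)
  then show "finite {v \<in> A. \<not> fps_X ^ n dvd g v}"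
    by (rule rev_finite_subset) (use assms(2) in auto)
qed

lemma null_family_add:
  assumes "null_family f A" "null_family g A"
  shows "null_family (\<lambda>v. f v + g v) A"
  unfolding null_family_def
proof
  fix n
  have "finite ({v \<in> A. \<not> fps_X ^ n dvd f v} \<union> {v \<in> A. \<not> fps_X ^ n dvd g v})"
    using assms by (simp add: null_family_def)
  then show "finite {v \<in> A. \<not> fps_X ^ n dvd f v + g v}"
    by (rule rev_finite_subset) auto
qed

lemma infsum_fps_add:
  fixes f g :: "'a \<Rightarrow> 'r::comm_ring_1 fps"
  assumes "null_family f A" "null_family g A"
  shows "infsum (\<lambda>v. f v + g v) A = infsum f A + infsum g A"
proof (rule infsum_fpsI)
  fix n
  obtain F where F: "finite F" "F \<subseteq> A" "\<And>v. v \<in> A - F \<Longrightarrow> fps_X ^ n dvd f v"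
    using null_family_obtain[OF assms(1)] by blast
  obtain G where G: "finite G" "G \<subseteq> A" "\<And>v. v \<in> A - G \<Longrightarrow> fps_X ^ n dvd g v"
    using null_family_obtain[OF assms(2)] by blast
  have FG: "finite (F \<union> G)" "F \<union> G \<subseteq> A" using F G by auto
  have "fps_eq_mod n (infsum f A) (sum f (F \<union> G))"
    by (rule infsum_fps_eq_mod[OF assms(1) FG]) (rule F(3), simp)
  moreover have "fps_eq_mod n (infsum g A) (sum g (F \<union> G))"
    by (rule infsum_fps_eq_mod[OF assms(2) FG]) (rule G(3), simp)
  ultimately have "fps_eq_mod n (\<Sum>v\<in>F \<union> G. f v + g v) (infsum f A + infsum g A)"
    unfolding sum.distrib by (simp add: fps_eq_mod_add fps_eq_mod_sym)
  then show "\<exists>F. finite F \<and> F \<subseteq> A \<and> (\<forall>v\<in>A - F. fps_X ^ n dvd f v + g v) \<and>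
      fps_eq_mod n (\<Sum>v\<in>F. f v + g v) (infsum f A + infsum g A)"
    using FG F(3) G(3) by (intro exI[of _ "F \<union> G"] conjI ballI dvd_add) auto
qed

lemma infsum_fps_cmult:
  fixes f :: "'a \<Rightarrow> 'r::comm_ring_1 fps"
  assumes "null_family f A"
  shows "infsum (\<lambda>v. c * f v) A = c * infsum f A"
proof (rule infsum_fpsI)
  fix n
  obtain F where F: "finite F" "F \<subseteq> A" "\<And>v. v \<in> A - F \<Longrightarrow> fps_X ^ n dvd f v"
    using null_family_obtain[OF assms(1)] by blast
  have "fps_eq_mod n (c * sum f F) (c * infsum f A)"
    by (rule fps_eq_mod_mult[OF fps_eq_mod_refl fps_eq_mod_sym[OF infsum_fps_eq_mod[OF assms F]]])
  then show "\<exists>F. finite F \<and> F \<subseteq> A \<and> (\<forall>v\<in>A - F. fps_X ^ n dvd c * f v) \<and>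
      fps_eq_mod n (\<Sum>v\<in>F. c * f v) (c * infsum f A)"
    using F by (intro exI[of _ F] conjI ballI dvd_mult) (simp_all add: sum_distrib_left)
qed

section \<open>Coefficientwise maps of power series\<close>

definition fps_map :: "('a \<Rightarrow> 'b) \<Rightarrow> 'a fps \<Rightarrow> 'b fps" where
  "fps_map h f = Abs_fps (\<lambda>i. h (fps_nth f i))"

lemma fps_nth_map [simp]: "fps_nth (fps_map h f) i = h (fps_nth f i)"
  by (simp add: fps_map_def)

lemma fps_map_map: "fps_map g (fps_map h f) = fps_map (\<lambda>x. g (h x)) f"
  by (simp add: fps_eq_iff)

lemma fps_map_ident: "(\<And>x. h x = x) \<Longrightarrow> fps_map h f = f"
  by (simp add: fps_eq_iff)

lemma fps_X_power_dvd_map: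
  fixes h :: "'r::comm_ring_1 \<Rightarrow> 'r"
  assumes "h 0 = 0" "fps_X ^ n dvd f"
  shows "fps_X ^ n dvd fps_map h f"
  using assms by (simp add: fps_X_power_dvd_iff)

lemma fps_map_add:
  assumes "\<And>x y. h (x + y) = h x + h y"
  shows "fps_map h (f + g) = fps_map h f + fps_map h (g :: 'r::comm_ring_1 fps)"
  using assms by (simp add: fps_eq_iff)

lemma fps_map_0: "h 0 = 0 \<Longrightarrow> fps_map h 0 = 0"
  by (simp add: fps_eq_iff)

lemma fps_map_sum:
  assumes "h (0 :: 'r::comm_ring_1) = (0 :: 's::comm_ring_1)" "\<And>x y. h (x + y) = h x + h y"
  shows "fps_map h (sum f A) = (\<Sum>i\<in>A. fps_map h (f i))"
  using assms by (induction A rule: infinite_finite_induct) (auto simp: fps_map_0 fps_map_add)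

text \<open>Covers ring homomorphisms (\<open>g = h\<close>) and maps that are linear over the coefficients of \<open>f\<close> (\<open>g\<close> the identity).\<close>

lemma fps_map_mult:
  fixes h :: "'r::comm_ring_1 \<Rightarrow> 's::comm_ring_1"
  assumes "h 0 = 0" "\<And>x y. h (x + y) = h x + h y"
    and "\<And>i y. h (fps_nth f i * y) = g (fps_nth f i) * h y"
  shows "fps_map h (f * f') = fps_map g f * fps_map h f'"
proof (rule fps_ext)
  fix n
  have "h (\<Sum>i\<in>A. k i) = (\<Sum>i\<in>A. h (k i))" for k and A :: "nat set"
    using assms(1,2) by (induction A rule: infinite_finite_induct) auto
  then show "fps_nth (fps_map h (f * f')) n = fps_nth (fps_map g f * fps_map h f') n"
    by (simp add: fps_mult_nth assms(3))
qed

lemma fps_eq_mod_map: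
  fixes h :: "'r::comm_ring_1 \<Rightarrow> 'r"
  shows "fps_eq_mod n f g \<Longrightarrow> fps_eq_mod n (fps_map h f) (fps_map h g)"
  by (simp add: fps_eq_mod_nth)

section \<open>Newton's identities for principal minors\<close>

text \<open>Indices 0, ..., m - 1 allow rows and columns to be labelled by tuples in which an index
  of the matrix repeats.\<close>

definition ndet :: "nat \<Rightarrow> (nat \<Rightarrow> nat \<Rightarrow> 'c::comm_ring_1) \<Rightarrow> 'c" where
  "ndet m B = principal_minor B {..<m}"

lemma ndet_cong: "(\<And>i j. i < m \<Longrightarrow> j < m \<Longrightarrow> B i j = C i j) \<Longrightarrow> ndet m B = ndet m C"
  unfolding ndet_def principal_minor_def
  by (intro sum.cong refl arg_cong2[of _ _ _ _ "(*)"] prod.cong) (auto dest: permutes_in_image)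

lemma principal_minor_image:
  assumes inj: "inj_on f S" and S: "finite S"
  shows "principal_minor A (f ` S) = principal_minor (\<lambda>i j. A (f i) (f j)) S"
proof -
  have bij: "bij_betw f S (f ` S)" using inj by (rule inj_on_imp_bij_betw)
  have bij_perm: "bij_betw (map_permutation S f) {\<tau>. \<tau> permutes S} {\<tau>. \<tau> permutes f ` S}"
  proof -
    have "map_permutation S f = (\<lambda>\<tau> x. if x \<in> f ` S then f (\<tau> (inv_into S f x)) else x)"
      by (auto simp: fun_eq_iff map_permutation_def restrict_id_def)
    then show ?thesis using bij_betw_permutations[OF bij] by simp
  qed
  have "principal_minor A (f ` S)
      = (\<Sum>\<tau> | \<tau> permutes S. of_int (sign (map_permutation S f \<tau>)) * (\<Prod>i\<in>f ` S. A i (map_permutation S f \<tau> i)))"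
    unfolding principal_minor_def
    by (rule sum.reindex_bij_betw[OF bij_perm, symmetric])
  also have "\<dots> = principal_minor (\<lambda>i j. A (f i) (f j)) S"
    unfolding principal_minor_def
    by (intro sum.cong refl arg_cong2[of _ _ _ _ "(*)"])
      (auto simp: sign_map_permutation[OF inj _ S] prod.reindex[OF inj] map_permutation_apply[OF inj]
         intro!: prod.cong)
  finally show ?thesis .
qed

lemma principal_minor_reindex_rows:
  assumes "\<rho> permutes S" "finite S"
  shows "principal_minor (\<lambda>i j. B (\<rho> i) (\<rho> j)) S = principal_minor B S"
  using principal_minor_image[of \<rho> S B] assms by (simp add: permutes_inj_on permutes_image)

text \<open>Composing all permutations with the transposition of a and b reverses the signs and
  keeps the products, so the minor is its own negative.\<close>

lemma principal_minor_equal_columns: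
  fixes B :: "'i \<Rightarrow> 'i \<Rightarrow> 'c::idom"
  assumes S: "finite S" "a \<in> S" "b \<in> S" "a \<noteq> b" and eq: "\<And>i. B i a = B i b"
    and char: "(2::'c) \<noteq> 0"
  shows "principal_minor B S = 0"
proof -
  let ?t = "Transposition.transpose a b"
  have t: "?t permutes S" using S by (simp add: permutes_swap_id)
  have "principal_minor B S = (\<Sum>\<tau> | \<tau> permutes S. of_int (sign (?t \<circ> \<tau>)) * (\<Prod>i\<in>S. B i ((?t \<circ> \<tau>) i)))"
    unfolding principal_minor_def by (rule setum_permutations_compose_left[OF t])
  also have "\<dots> = (\<Sum>\<tau> | \<tau> permutes S. - (of_int (sign \<tau>) * (\<Prod>i\<in>S. B i (\<tau> i))))"
  proof (intro sum.cong refl)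
    fix \<tau> assume "\<tau> \<in> {\<tau>. \<tau> permutes S}"
    then have "sign (?t \<circ> \<tau>) = - sign \<tau>"
      using S sign_compose[of ?t \<tau>] permutes_imp_permutation[of S \<tau>]
      by (simp add: permutation_swap_id sign_swap_id)
    moreover have "B i (?t x) = B i x" for i x
      by (simp add: Transposition.transpose_def eq)
    ultimately show "of_int (sign (?t \<circ> \<tau>)) * (\<Prod>i\<in>S. B i ((?t \<circ> \<tau>) i))
        = - (of_int (sign \<tau>) * (\<Prod>i\<in>S. B i (\<tau> i)))" by simp
  qed
  also have "\<dots> = - principal_minor B S"
    by (simp add: principal_minor_def sum_negf)
  finally have "2 * principal_minor B S = 0" by simp
  then show ?thesis using char by simp
qed

definition minor_sum :: "('i \<Rightarrow> 'i \<Rightarrow> 'c::comm_ring_1) \<Rightarrow> 'i set \<Rightarrow> nat \<Rightarrow> 'c" where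
  "minor_sum A J m = (\<Sum>S | S \<subseteq> J \<and> card S = m. principal_minor A S)"

text \<open>An ordered version of \<open>minor_sum\<close> with repetitions allowed. Summing
  independently over the entries of a tuple is what lets a row expansion turn into a matrix
  product.\<close>

definition tuple_sum :: "('i \<Rightarrow> 'i \<Rightarrow> 'c::comm_ring_1) \<Rightarrow> 'i set \<Rightarrow> nat \<Rightarrow> 'c" where
  "tuple_sum A J m = (\<Sum>s\<in>{..<m} \<rightarrow>\<^sub>E J. ndet m (\<lambda>i j. A (s i) (s j)))"

lemma card_bijections:
  assumes "finite S" "card S = m"
  shows "card {s \<in> {..<m} \<rightarrow>\<^sub>E J. inj_on s {..<m} \<and> s ` {..<m} = S} = (if S \<subseteq> J then fact m else 0)"
proof (cases "S \<subseteq> J")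
  case True
  have "{s \<in> {..<m} \<rightarrow>\<^sub>E J. inj_on s {..<m} \<and> s ` {..<m} = S} = {s \<in> {..<m} \<rightarrow>\<^sub>E S. inj_on s {..<m}}"
  proof (intro equalityI subsetI)
    fix s assume s: "s \<in> {s \<in> {..<m} \<rightarrow>\<^sub>E S. inj_on s {..<m}}"
    then have "s ` {..<m} = S"
      using assms by (intro card_subset_eq) (auto simp: card_image)
    then show "s \<in> {s \<in> {..<m} \<rightarrow>\<^sub>E J. inj_on s {..<m} \<and> s ` {..<m} = S}"
      using s True by (auto simp: PiE_def Pi_def)
  qed (auto simp: PiE_def Pi_def)
  also have "card \<dots> = fact m"
    using card_inj_on_subset_funcset[of "{..<m}" S "{..<m}"] assms
    by (simp add: fact_prod_rev atLeast0LessThan)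
  finally show ?thesis using True by simp
next
  case False
  then have "{s \<in> {..<m} \<rightarrow>\<^sub>E J. inj_on s {..<m} \<and> s ` {..<m} = S} = {}"
    by (auto simp: PiE_def Pi_def)
  then show ?thesis using False by (simp only: card.empty if_False)
qed

text \<open>A tuple with a repetition has two equal columns and contributes 0; each m-subset is the
  image of m! injective tuples with the same minor.\<close>

lemma tuple_sum_eq_minor_sum:
  fixes A :: "'i \<Rightarrow> 'i \<Rightarrow> 'c::idom"
  assumes J: "finite J" and char: "(2::'c) \<noteq> 0"
  shows "tuple_sum A J m = of_nat (fact m) * minor_sum A J m"
proof -
  let ?I = "{s \<in> {..<m} \<rightarrow>\<^sub>E J. inj_on s {..<m}}"
  have fin: "finite ({..<m} \<rightarrow>\<^sub>E J)" using J by (simp add: finite_PiE)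
  have finI: "finite ?I" using fin by simp
  have "tuple_sum A J m = (\<Sum>s\<in>?I. ndet m (\<lambda>i j. A (s i) (s j)))"
    unfolding tuple_sum_def
  proof (rule sum.mono_neutral_right)
    show "\<forall>s\<in>({..<m} \<rightarrow>\<^sub>E J) - ?I. ndet m (\<lambda>i j. A (s i) (s j)) = 0"
    proof
      fix s assume "s \<in> ({..<m} \<rightarrow>\<^sub>E J) - ?I"
      then obtain a b where "a < m" "b < m" "a \<noteq> b" "s a = s b"
        by (auto simp: inj_on_def)
      then show "ndet m (\<lambda>i j. A (s i) (s j)) = 0"
        unfolding ndet_def using char by (intro principal_minor_equal_columns[of _ a b]) auto
    qed
  qed (use fin in auto)
  also have "\<dots> = (\<Sum>s\<in>?I. principal_minor A (s ` {..<m}))"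
    by (intro sum.cong refl) (auto simp: ndet_def principal_minor_image)
  also have "\<dots> = (\<Sum>S | S \<subseteq> J \<and> card S = m. \<Sum>s\<in>{s \<in> ?I. s ` {..<m} = S}. principal_minor A (s ` {..<m}))"
    using finI J by (intro sum.group[symmetric]) (auto simp: card_image PiE_def Pi_def)
  also have "\<dots> = (\<Sum>S | S \<subseteq> J \<and> card S = m. of_nat (fact m) * principal_minor A S)"
  proof (intro sum.cong refl)
    fix S assume S: "S \<in> {S. S \<subseteq> J \<and> card S = m}"
    have "{s \<in> ?I. s ` {..<m} = S} = {s \<in> {..<m} \<rightarrow>\<^sub>E J. inj_on s {..<m} \<and> s ` {..<m} = S}" by auto
    then have "card {s \<in> ?I. s ` {..<m} = S} = fact m"
      using S J card_bijections[of S m J] finite_subset[of S J] by simp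
    then show "(\<Sum>s\<in>{s \<in> ?I. s ` {..<m} = S}. principal_minor A (s ` {..<m})) = of_nat (fact m) * principal_minor A S"
      by simp
  qed
  finally show ?thesis by (simp add: minor_sum_def sum_distrib_left)
qed

text \<open>
  Expanding these bordered determinants along the additional row gives a recursion for the
  matrices \<open>bordered_sum A J m\<close>, and taking traces gives Newton's identities.
\<close>

definition bordered_sum :: "('i \<Rightarrow> 'i \<Rightarrow> 'c::comm_ring_1) \<Rightarrow> 'i set \<Rightarrow> nat \<Rightarrow> 'i \<Rightarrow> 'i \<Rightarrow> 'c" where
  "bordered_sum A J m x y =
     (\<Sum>s\<in>{..<m} \<rightarrow>\<^sub>E J. ndet (Suc m) (\<lambda>i j. A ((s(m := x)) i) ((s(m := y)) j)))"

lemma sum_PiE_lessThan_Suc: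
  "(\<Sum>s\<in>{..<Suc m} \<rightarrow>\<^sub>E J. f s) = (\<Sum>x\<in>J. \<Sum>s\<in>{..<m} \<rightarrow>\<^sub>E J. f (s(m := x)))"
proof -
  have "(\<Sum>s\<in>{..<Suc m} \<rightarrow>\<^sub>E J. f s) = sum f ((\<lambda>(x, s). s(m := x)) ` (J \<times> ({..<m} \<rightarrow>\<^sub>E J)))"
    by (simp add: lessThan_Suc PiE_insert_eq)
  also have "\<dots> = (\<Sum>(x, s)\<in>J \<times> ({..<m} \<rightarrow>\<^sub>E J). f (s(m := x)))"
    by (subst sum.reindex[OF inj_combinator]) (auto simp: case_prod_unfold)
  finally show ?thesis by (simp add: sum.cartesian_product)
qed

lemma tuple_sum_Suc: "tuple_sum A J (Suc m) = (\<Sum>x\<in>J. bordered_sum A J m x x)"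
  unfolding tuple_sum_def bordered_sum_def by (rule sum_PiE_lessThan_Suc)

text \<open>Each permutation of 0, ..., m is the transposition of m with some l composed with a
  permutation fixing m. For l < m the cofactor appears, up to sign, as the determinant with column l
  replaced by column m, which avoids renumbering.\<close>

lemma ndet_expand_last_row:
  "ndet (Suc m) B = B m m * ndet m B - (\<Sum>l<m. B m l * ndet m (\<lambda>i j. B i (if j = l then m else j)))"
proof -
  have *: "of_int (sign (Transposition.transpose m l \<circ> \<tau>)) * (\<Prod>i\<in>insert m {..<m}. B i ((Transposition.transpose m l \<circ> \<tau>) i))
      = - (B m l * (of_int (sign \<tau>) * (\<Prod>i<m. B i (if \<tau> i = l then m else \<tau> i))))"
    if l: "l < m" and \<tau>: "\<tau> permutes {..<m}" for l \<tau>
  proof -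
    have "sign (Transposition.transpose m l \<circ> \<tau>) = - sign \<tau>"
      using sign_compose[of "Transposition.transpose m l" \<tau>] l permutes_imp_permutation[OF _ \<tau>]
      by (simp add: permutation_swap_id sign_swap_id)
    moreover have "(Transposition.transpose m l \<circ> \<tau>) m = l"
      using permutes_not_in[OF \<tau>, of m] by simp
    moreover have "(Transposition.transpose m l \<circ> \<tau>) i = (if \<tau> i = l then m else \<tau> i)" if "i < m" for i
      using permutes_in_image[OF \<tau>, of i] that by (auto simp: Transposition.transpose_def)
    ultimately show ?thesis by simp
  qed
  have **: "of_int (sign \<tau>) * (\<Prod>i\<in>insert m {..<m}. B i (\<tau> i))
      = B m m * (of_int (sign \<tau>) * (\<Prod>i<m. B i (\<tau> i)))" if \<tau>: "\<tau> permutes {..<m}" for \<tau>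
    using permutes_not_in[OF \<tau>, of m] by (simp add: mult_ac)
  have "ndet (Suc m) B = (\<Sum>l\<in>insert m {..<m}. \<Sum>\<tau> | \<tau> permutes {..<m}.
      of_int (sign (Transposition.transpose m l \<circ> \<tau>)) * (\<Prod>i\<in>insert m {..<m}. B i ((Transposition.transpose m l \<circ> \<tau>) i)))"
    unfolding ndet_def principal_minor_def lessThan_Suc
    by (rule sum_over_permutations_insert) auto
  also have "\<dots> = (\<Sum>\<tau> | \<tau> permutes {..<m}. B m m * (of_int (sign \<tau>) * (\<Prod>i<m. B i (\<tau> i))))
     + (\<Sum>l<m. \<Sum>\<tau> | \<tau> permutes {..<m}. - (B m l * (of_int (sign \<tau>) * (\<Prod>i<m. B i (if \<tau> i = l then m else \<tau> i)))))"
    by (subst sum.insert) (auto intro!: arg_cong2[of _ _ _ _ "(+)"] sum.cong simp del: prod.insert comp_apply simp: * **)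
  finally show ?thesis
    by (simp add: ndet_def principal_minor_def sum_distrib_left sum_negf)
qed

lemma sum_PiE_permute:
  assumes "\<rho> permutes {..<m}"
  shows "(\<Sum>s\<in>{..<m} \<rightarrow>\<^sub>E J. f (s \<circ> \<rho>)) = (\<Sum>s\<in>{..<m} \<rightarrow>\<^sub>E J. f s)"
proof (rule sum.reindex_bij_witness[of _ "\<lambda>s. s \<circ> inv \<rho>" "\<lambda>s. s \<circ> \<rho>"])
  have in_PiE: "s \<circ> \<pi> \<in> {..<m} \<rightarrow>\<^sub>E J" if "s \<in> {..<m} \<rightarrow>\<^sub>E J" "\<pi> permutes {..<m}" for s \<pi>
  proof (rule PiE_I)
    show "(s \<circ> \<pi>) i \<in> J" if "i \<in> {..<m}" for i
      using PiE_mem[OF \<open>s \<in> {..<m} \<rightarrow>\<^sub>E J\<close>, of "\<pi> i"]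
        permutes_in_image[OF \<open>\<pi> permutes {..<m}\<close>, of i] that by simp
    show "(s \<circ> \<pi>) i = undefined" if "i \<notin> {..<m}" for i
      using PiE_arb[OF \<open>s \<in> {..<m} \<rightarrow>\<^sub>E J\<close> that] permutes_not_in[OF \<open>\<pi> permutes {..<m}\<close> that]
      by (simp only: o_apply)
  qed
  fix s assume s: "s \<in> {..<m} \<rightarrow>\<^sub>E J"
  show "s \<circ> \<rho> \<in> {..<m} \<rightarrow>\<^sub>E J" by (rule in_PiE[OF s assms])
  show "s \<circ> inv \<rho> \<in> {..<m} \<rightarrow>\<^sub>E J" by (rule in_PiE[OF s permutes_inv[OF assms]])
qed (simp_all only: comp_assoc permutes_inv_o[OF assms] comp_id)

text \<open>Expansion along the row x. The corner entry gives \<open>A x y\<close> times the ordered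
  minors; in every other term some column l of the tuple is replaced by y.\<close>

lemma bordered_sum_Suc:
  "bordered_sum A J (Suc m) x y =
     A x y * tuple_sum A J (Suc m) - of_nat (Suc m) * (\<Sum>z\<in>J. A x z * bordered_sum A J m z y)"
proof -
  let ?n = "Suc m"
  let ?g = "\<lambda>s l. A x (s l) * ndet ?n (\<lambda>i j. A (s i) (if j = l then y else s j))"
  have expand: "ndet (Suc ?n) (\<lambda>i j. A ((s(?n := x)) i) ((s(?n := y)) j))
      = A x y * ndet ?n (\<lambda>i j. A (s i) (s j)) - (\<Sum>l<?n. ?g s l)" for s
  proof -
    have 1: "ndet ?n (\<lambda>i j. A ((s(?n := x)) i) ((s(?n := y)) j)) = ndet ?n (\<lambda>i j. A (s i) (s j))"
      by (rule ndet_cong) simp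
    have 2: "A ((s(?n := x)) ?n) ((s(?n := y)) l) *
        ndet ?n (\<lambda>i j. A ((s(?n := x)) i) ((s(?n := y)) (if j = l then ?n else j))) = ?g s l" if "l < ?n" for l
    proof -
      have "ndet ?n (\<lambda>i j. A ((s(?n := x)) i) ((s(?n := y)) (if j = l then ?n else j)))
          = ndet ?n (\<lambda>i j. A (s i) (if j = l then y else s j))"
        by (rule ndet_cong) simp
      then show ?thesis using that by simp
    qed
    show ?thesis
      unfolding ndet_expand_last_row[of ?n] 1
      by (intro arg_cong2[of _ _ _ _ "(-)"] sum.cong refl 2) simp_all
  qed
  have "bordered_sum A J ?n x y = (\<Sum>s\<in>{..<?n} \<rightarrow>\<^sub>E J. A x y * ndet ?n (\<lambda>i j. A (s i) (s j))
      - (\<Sum>l<?n. ?g s l))"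
    unfolding bordered_sum_def expand ..
  also have "\<dots> = A x y * tuple_sum A J ?n - (\<Sum>l<?n. \<Sum>s\<in>{..<?n} \<rightarrow>\<^sub>E J. ?g s l)"
    unfolding sum_subtractf tuple_sum_def sum_distrib_left by (subst (2) sum.swap) simp
  \<comment> \<open>Exchanging positions l and m of the tuple permutes rows and columns
    simultaneously, so every term equals the one with l = m. This is the origin of the factor
    \<open>Suc m\<close>.\<close>
  also have "(\<Sum>l<?n. \<Sum>s\<in>{..<?n} \<rightarrow>\<^sub>E J. ?g s l) = (\<Sum>l<?n. \<Sum>s\<in>{..<?n} \<rightarrow>\<^sub>E J. ?g s m)"
  proof (rule sum.cong[OF refl])
    fix l assume l: "l \<in> {..<?n}"
    define \<rho> where "\<rho> = Transposition.transpose l m"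
    have \<rho>: "\<rho> permutes {..<?n}" using l by (simp add: \<rho>_def permutes_swap_id)
    have eq: "?g (s \<circ> \<rho>) l = ?g s m" for s
    proof -
      have "ndet ?n (\<lambda>i j. A ((s \<circ> \<rho>) i) (if j = l then y else (s \<circ> \<rho>) j))
          = ndet ?n (\<lambda>i j. A (s (\<rho> i)) (if \<rho> j = m then y else s (\<rho> j)))"
        by (rule ndet_cong) (auto simp: \<rho>_def Transposition.transpose_def)
      also have "\<dots> = ndet ?n (\<lambda>i j. A (s i) (if j = m then y else s j))"
        unfolding ndet_def
        by (rule principal_minor_reindex_rows[OF \<rho>, of "\<lambda>i j. A (s i) (if j = m then y else s j)"]) simp
      finally show ?thesis by (simp add: \<rho>_def)
    qed
    show "(\<Sum>s\<in>{..<?n} \<rightarrow>\<^sub>E J. ?g s l) = (\<Sum>s\<in>{..<?n} \<rightarrow>\<^sub>E J. ?g s m)"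
      unfolding eq[symmetric] by (rule sum_PiE_permute[OF \<rho>, of "\<lambda>s. ?g s l" J, symmetric])
  qed
  also have "\<dots> = of_nat ?n * (\<Sum>s\<in>{..<?n} \<rightarrow>\<^sub>E J. ?g s m)" by simp
  \<comment> \<open>With the last entry of the tuple called z, the determinant has row z and column
    y in last place, as in \<open>bordered_sum A J m z y\<close>.\<close>
  also have "(\<Sum>s\<in>{..<?n} \<rightarrow>\<^sub>E J. ?g s m) = (\<Sum>z\<in>J. A x z * bordered_sum A J m z y)"
    unfolding sum_PiE_lessThan_Suc bordered_sum_def sum_distrib_left
    by (intro sum.cong refl arg_cong2[of _ _ _ _ "(*)"] ndet_cong) auto
  finally show ?thesis .
qed

lemma bordered_sum_0: "bordered_sum A J 0 x y = A x y"
  by (simp add: bordered_sum_def ndet_def principal_minor_def lessThan_Suc permutes_sing)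

primrec mat_pow :: "('i \<Rightarrow> 'i \<Rightarrow> 'c::comm_ring_1) \<Rightarrow> 'i set \<Rightarrow> nat \<Rightarrow> 'i \<Rightarrow> 'i \<Rightarrow> 'c" where
  "mat_pow A J 0 x y = (if x = y then 1 else 0)"
| "mat_pow A J (Suc k) x y = (\<Sum>z\<in>J. A x z * mat_pow A J k z y)"

lemma minor_sum_0: "finite J \<Longrightarrow> minor_sum A J 0 = 1"
proof -
  assume "finite J"
  then have "{S. S \<subseteq> J \<and> card S = 0} = {{}}" by (auto simp: finite_subset)
  then show ?thesis by (simp add: minor_sum_def principal_minor_def)
qed

text \<open>The recursion unrolled. Divided by m!, these matrices are up to sign A times those of
  the Faddeev-LeVerrier algorithm, the coefficients of the adjugate of s - A on the block J.\<close>

lemma bordered_sum_eq: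
  fixes A :: "'i \<Rightarrow> 'i \<Rightarrow> 'c::idom"
  assumes "finite J" "(2::'c) \<noteq> 0" "x \<in> J" "y \<in> J"
  shows "bordered_sum A J m x y =
    (\<Sum>k\<le>m. (-1) ^ k * of_nat (fact m) * minor_sum A J (m - k) * mat_pow A J (Suc k) x y)"
  using assms(3)
proof (induction m arbitrary: x)
  case 0
  have "(\<Sum>z\<in>J. A x z * (if z = y then 1 else 0)) = A x y"
    using assms(1,4) by (simp add: if_distrib sum.delta' cong: if_cong)
  then show ?case by (simp add: bordered_sum_0 minor_sum_0 assms(1))
next
  case (Suc m)
  have 1: "mat_pow A J (Suc 0) x y = A x y"
    using assms(1,4) by (simp add: if_distrib sum.delta' cong: if_cong)
  have "(\<Sum>z\<in>J. A x z * bordered_sum A J m z y)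
      = (\<Sum>z\<in>J. \<Sum>k\<le>m. (-1) ^ k * of_nat (fact m) * minor_sum A J (m - k) * (A x z * mat_pow A J (Suc k) z y))"
    by (intro sum.cong refl) (simp only: Suc.IH sum_distrib_left mult_ac)
  also have "\<dots> = (\<Sum>k\<le>m. (-1) ^ k * of_nat (fact m) * minor_sum A J (m - k) * mat_pow A J (Suc (Suc k)) x y)"
    by (subst sum.swap) (simp only: mat_pow.simps(2) sum_distrib_left)
  finally have *: "(\<Sum>z\<in>J. A x z * bordered_sum A J m z y) = (\<Sum>k\<le>m. (-1) ^ k * of_nat (fact m) * minor_sum A J (m - k) * mat_pow A J (Suc (Suc k)) x y)" .
  have "of_nat (Suc m) * (\<Sum>z\<in>J. A x z * bordered_sum A J m z y)
      = - (\<Sum>k\<le>m. (-1) ^ Suc k * of_nat (fact (Suc m)) * minor_sum A J (Suc m - Suc k) * mat_pow A J (Suc (Suc k)) x y)"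
    unfolding * sum_distrib_left sum_negf[symmetric]
    by (intro sum.cong refl) (simp add: algebra_simps del: mat_pow.simps)
  then have "bordered_sum A J (Suc m) x y = (-1) ^ 0 * of_nat (fact (Suc m)) * minor_sum A J (Suc m - 0) * mat_pow A J (Suc 0) x y
     + (\<Sum>k\<le>m. (-1) ^ Suc k * of_nat (fact (Suc m)) * minor_sum A J (Suc m - Suc k) * mat_pow A J (Suc (Suc k)) x y)"
    unfolding bordered_sum_Suc 1 tuple_sum_eq_minor_sum[OF assms(1,2)] by (simp add: mult_ac del: mat_pow.simps)
  then show ?case by (subst sum.atMost_Suc_shift)
qed

theorem newton_identities:
  fixes A :: "'i \<Rightarrow> 'i \<Rightarrow> 'c::idom"
  assumes "finite J" and char: "\<And>k. k > 0 \<Longrightarrow> (of_nat k :: 'c) \<noteq> 0"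
  shows "of_nat (Suc m) * minor_sum A J (Suc m) =
    (\<Sum>k\<le>m. (-1) ^ k * (\<Sum>x\<in>J. mat_pow A J (Suc k) x x) * minor_sum A J (m - k))"
proof -
  have 2: "(2::'c) \<noteq> 0" using char[of 2] by simp
  have "of_nat (fact m) * (of_nat (Suc m) * minor_sum A J (Suc m)) = tuple_sum A J (Suc m)"
    unfolding tuple_sum_eq_minor_sum[OF assms(1) 2] by (simp add: algebra_simps)
  also have "\<dots> = (\<Sum>x\<in>J. \<Sum>k\<le>m. (-1) ^ k * of_nat (fact m) * minor_sum A J (m - k) * mat_pow A J (Suc k) x x)"
    unfolding tuple_sum_Suc by (intro sum.cong refl bordered_sum_eq assms 2)
  also have "\<dots> = of_nat (fact m) * (\<Sum>k\<le>m. (-1) ^ k * (\<Sum>x\<in>J. mat_pow A J (Suc k) x x) * minor_sum A J (m - k))"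
    by (subst sum.swap) (simp only: sum_distrib_left sum_distrib_right mult_ac)
  finally show ?thesis using char[of "fact m"] by (simp del: mat_pow.simps of_nat_Suc)
qed

section \<open>Traces and characteristic coefficients of completely continuous operators\<close>

lemma fps_map_ring_hom:
  fixes s :: "'r::comm_ring_1 \<Rightarrow> 'r"
  assumes "ring_hom_on s"
  shows "s 0 = 0" "fps_map s (f + g) = fps_map s f + fps_map s g"
    "fps_map s (f * g) = fps_map s f * fps_map s g" "fps_map s (fps_X ^ n) = fps_X ^ n"
    "fps_map s 0 = 0" "fps_map s (sum F A) = (\<Sum>i\<in>A. fps_map s (F i))"
proof -
  have add: "\<And>x y. s (x + y) = s x + s y" using assms by (simp add: ring_hom_on_def)
  have "s 0 + s 0 = s 0" using add[of 0 0] by simp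
  then show 0: "s 0 = 0" by simp
  show "fps_map s (f + g) = fps_map s f + fps_map s g" using add by (rule fps_map_add)
  show "fps_map s (f * g) = fps_map s f * fps_map s g"
    using 0 add assms by (intro fps_map_mult) (auto simp: ring_hom_on_def)
  show "fps_map s (fps_X ^ n) = fps_X ^ n"
    using 0 assms by (auto simp: fps_eq_iff fps_X_power_nth ring_hom_on_def)
  show "fps_map s 0 = 0" using 0 by (rule fps_map_0)
  show "fps_map s (sum F A) = (\<Sum>i\<in>A. fps_map s (F i))" using 0 add by (rule fps_map_sum)
qed

text \<open>V is a module over all power series, while R is the ground ring for linearity and bases;
  this covers B over Z_q[[\<pi>^{1/D}]] and over Z_p[[\<pi>^{1/D}]] at once. Powers of the variable
  lie in R, so that R-linear maps respect congruence modulo these powers.\<close>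

locale fps_module = module sc
  for sc :: "'r::idom fps \<Rightarrow> 'v::ab_group_add \<Rightarrow> 'v" +
  fixes V :: "'v set" and R :: "'r fps set"
  assumes V_0: "0 \<in> V" and V_add: "g \<in> V \<Longrightarrow> h \<in> V \<Longrightarrow> g + h \<in> V" and V_sc: "g \<in> V \<Longrightarrow> sc c g \<in> V"
    and R_0: "0 \<in> R" and R_X: "fps_X ^ n \<in> R"
    and R_add: "c \<in> R \<Longrightarrow> d \<in> R \<Longrightarrow> c + d \<in> R" and R_mult: "c \<in> R \<Longrightarrow> d \<in> R \<Longrightarrow> c * d \<in> R"
begin

lemma V_sum: "(\<And>i. i \<in> I \<Longrightarrow> f i \<in> V) \<Longrightarrow> sum f I \<in> V"
  by (induction I rule: infinite_finite_induct) (auto intro: V_0 V_add)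

definition veq :: "nat \<Rightarrow> 'v \<Rightarrow> 'v \<Rightarrow> bool" where
  "veq n g h \<longleftrightarrow> (\<exists>k\<in>V. g = h + sc (fps_X ^ n) k)"

text \<open>Scalars are taken from R only. Thus \<Psi> is semilinear for the inverse Frobenius over
  Z_q[[\<pi>^{1/D}]], and semilinear for the identity, that is linear, over
  Z_p[[\<pi>^{1/D}]].\<close>

definition semilinear :: "('r \<Rightarrow> 'r) \<Rightarrow> ('v \<Rightarrow> 'v) \<Rightarrow> bool" where
  "semilinear s \<Phi> \<longleftrightarrow> ring_hom_on s \<and> (\<forall>c\<in>R. fps_map s c \<in> R) \<and> (\<forall>g\<in>V. \<Phi> g \<in> V) \<and>
     (\<forall>g\<in>V. \<forall>h\<in>V. \<Phi> (g + h) = \<Phi> g + \<Phi> h) \<and> (\<forall>c\<in>R. \<forall>g\<in>V. \<Phi> (sc c g) = sc (fps_map s c) (\<Phi> g))"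

lemma semilinearD:
  assumes "semilinear s \<Phi>"
  shows "ring_hom_on s" "c \<in> R \<Longrightarrow> fps_map s c \<in> R" "g \<in> V \<Longrightarrow> \<Phi> g \<in> V"
    "g \<in> V \<Longrightarrow> h \<in> V \<Longrightarrow> \<Phi> (g + h) = \<Phi> g + \<Phi> h" "c \<in> R \<Longrightarrow> g \<in> V \<Longrightarrow> \<Phi> (sc c g) = sc (fps_map s c) (\<Phi> g)"
  using assms unfolding semilinear_def by blast+

lemma semilinear_sum:
  assumes \<Phi>: "semilinear s \<Phi>" and "\<And>i. i \<in> I \<Longrightarrow> c i \<in> R" "\<And>i. i \<in> I \<Longrightarrow> g i \<in> V"
  shows "\<Phi> (\<Sum>i\<in>I. sc (c i) (g i)) = (\<Sum>i\<in>I. sc (fps_map s (c i)) (\<Phi> (g i)))"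
proof -
  have "\<Phi> 0 = 0"
    using semilinearD(4)[OF \<Phi> V_0 V_0] by simp
  then show ?thesis
    using assms(2,3)
    by (induction I rule: infinite_finite_induct)
      (auto simp: semilinearD(4,5)[OF \<Phi>] V_sum V_sc)
qed

lemma semilinear_veq:
  assumes "semilinear s \<Phi>" "veq n g h" "h \<in> V"
  shows "veq n (\<Phi> g) (\<Phi> h)"
proof -
  obtain k where k: "k \<in> V" "g = h + sc (fps_X ^ n) k" using assms(2) by (auto simp: veq_def)
  then have "\<Phi> g = \<Phi> h + sc (fps_X ^ n) (\<Phi> k)"
    using semilinearD[OF assms(1)] assms(3) by (simp add: V_sc R_X fps_map_ring_hom)
  then show ?thesis using k semilinearD(3)[OF assms(1)] by (auto simp: veq_def)
qed

lemma semilinear_ident: "semilinear (\<lambda>x. x) (\<lambda>g. g)"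
  by (simp add: semilinear_def ring_hom_on_def fps_map_ident)

lemma semilinear_comp:
  assumes "semilinear s S" "semilinear t T"
  shows "semilinear (\<lambda>x. s (t x)) (\<lambda>g. S (T g))"
  using assms by (auto simp: semilinear_def ring_hom_on_def fps_map_map[symmetric])

lemma semilinear_funpow:
  assumes "semilinear s S"
  shows "semilinear (s ^^ k) (S ^^ k)"
proof (induction k)
  case 0
  show ?case using semilinear_ident by (simp add: id_def)
next
  case (Suc k)
  show ?case using semilinear_comp[OF assms Suc] by (simp add: comp_def)
qed

definition trace :: "'v set \<Rightarrow> ('v \<Rightarrow> 'v \<Rightarrow> 'r fps) \<Rightarrow> ('v \<Rightarrow> 'v) \<Rightarrow> 'r fps" where
  "trace E \<kappa> \<Phi> = infsum (\<lambda>e. \<kappa> (\<Phi> e) e) E"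

text \<open>Modulo \<open>X\<^sup>n\<close>, the image of \<open>V\<close> lies in the span of the finite set \<open>J\<close> of basis vectors.\<close>

definition range_mod :: "nat \<Rightarrow> 'v set \<Rightarrow> ('v \<Rightarrow> 'v \<Rightarrow> 'r fps) \<Rightarrow> ('v \<Rightarrow> 'v) \<Rightarrow> 'v set \<Rightarrow> bool" where
  "range_mod n E \<kappa> \<Phi> J \<longleftrightarrow>
     finite J \<and> J \<subseteq> E \<and> (\<forall>e\<in>E - J. \<forall>g\<in>V. fps_X ^ n dvd \<kappa> (\<Phi> g) e)"

text \<open>Complete continuity: the finite set J depends on n but not on the vector to which the
  operator is applied.\<close>

definition compact_op :: "'v set \<Rightarrow> ('v \<Rightarrow> 'v \<Rightarrow> 'r fps) \<Rightarrow> ('v \<Rightarrow> 'v) \<Rightarrow> bool" where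
  "compact_op E \<kappa> \<Phi> \<longleftrightarrow> (\<forall>n. \<exists>J. range_mod n E \<kappa> \<Phi> J)"

lemma range_modD:
  assumes "range_mod n E \<kappa> \<Phi> J"
  shows "finite J" "J \<subseteq> E" "e \<in> E \<Longrightarrow> e \<notin> J \<Longrightarrow> g \<in> V \<Longrightarrow> fps_X ^ n dvd \<kappa> (\<Phi> g) e"
  using assms by (auto simp: range_mod_def)

lemma range_mod_comp:
  assumes "range_mod n E \<kappa> S J" "T \<in> V \<rightarrow> V"
  shows "range_mod n E \<kappa> (\<lambda>g. S (T g)) J"
  using assms unfolding range_mod_def Pi_iff by blast

lemma compact_op_comp:
  assumes "compact_op E \<kappa> S" "T \<in> V \<rightarrow> V"
  shows "compact_op E \<kappa> (\<lambda>g. S (T g))"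
  using assms unfolding compact_op_def by (blast intro: range_mod_comp)

lemma semilinear_maps: "semilinear s S \<Longrightarrow> S \<in> V \<rightarrow> V"
  by (simp add: semilinear_def)

lemma funpow_maps: "S \<in> V \<rightarrow> V \<Longrightarrow> S ^^ k \<in> V \<rightarrow> V" for S :: "'v \<Rightarrow> 'v"
  by (induction k) auto

end

text \<open>What an orthonormal basis contributes to the trace arguments. In \<open>approx\<close>
  the truncation error is a multiple of \<open>fps_X ^ n\<close> within V, rather than just a vector
  with small coordinates, so semilinear operators map it to an error of the same kind.\<close>

locale fps_basis = fps_module sc V R
  for sc :: "'r::idom fps \<Rightarrow> 'v::ab_group_add \<Rightarrow> 'v" and V R +
  fixes E :: "'v set" and \<kappa> :: "'v \<Rightarrow> 'v \<Rightarrow> 'r fps"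
  assumes basis_in_V: "e \<in> E \<Longrightarrow> e \<in> V"
    and coord_in_R: "g \<in> V \<Longrightarrow> e \<in> E \<Longrightarrow> \<kappa> g e \<in> R"
    and coord_add: "g \<in> V \<Longrightarrow> h \<in> V \<Longrightarrow> e \<in> E \<Longrightarrow> \<kappa> (g + h) e = \<kappa> g e + \<kappa> h e"
    and coord_sc: "c \<in> R \<Longrightarrow> g \<in> V \<Longrightarrow> e \<in> E \<Longrightarrow> \<kappa> (sc c g) e = c * \<kappa> g e"
    and coord_null: "g \<in> V \<Longrightarrow> null_family (\<kappa> g) E"
    and coord_basis: "e \<in> E \<Longrightarrow> e' \<in> E \<Longrightarrow> \<kappa> e e' = (if e = e' then 1 else 0)"
    and approx: "g \<in> V \<Longrightarrow> finite F \<Longrightarrow> F \<subseteq> E \<Longrightarrow> (\<And>e. e \<in> E - F \<Longrightarrow> fps_X ^ n dvd \<kappa> g e) \<Longrightarrow>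
      veq n g (\<Sum>e\<in>F. sc (\<kappa> g e) e)"
begin

lemma coord_sum:
  assumes "e \<in> E" "\<And>i. i \<in> I \<Longrightarrow> c i \<in> R" "\<And>i. i \<in> I \<Longrightarrow> g i \<in> V"
  shows "\<kappa> (\<Sum>i\<in>I. sc (c i) (g i)) e = (\<Sum>i\<in>I. c i * \<kappa> (g i) e)"
proof -
  have "\<kappa> 0 e = 0" using coord_sc[OF R_0 V_0 assms(1)] by simp
  then show ?thesis
    using assms(2,3) by (induction I rule: infinite_finite_induct)
      (auto simp: coord_add coord_sc assms(1) V_sum V_sc)
qed

lemma coord_veq:
  assumes "veq n g h" "h \<in> V" "e \<in> E"
  shows "fps_eq_mod n (\<kappa> g e) (\<kappa> h e)"
proof -
  obtain k where "k \<in> V" "g = h + sc (fps_X ^ n) k" using assms(1) by (auto simp: veq_def)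
  then show ?thesis using assms by (simp add: coord_add coord_sc V_sc R_X fps_eq_mod_def)
qed

text \<open>Column expansion of the image of g, possibly from one basis to another: truncating g
  causes an error in \<open>fps_X ^ n\<close> times V, and \<Phi> keeps it there.\<close>

lemma coord_expand:
  assumes \<Phi>: "semilinear s \<Phi>" and g: "g \<in> V"
    and F: "finite F" "F \<subseteq> E" "\<And>e. e \<in> E - F \<Longrightarrow> fps_X ^ n dvd \<kappa> g e"
    and B: "fps_basis sc V R E' \<kappa>'" and e: "e' \<in> E'"
  shows "fps_eq_mod n (\<kappa>' (\<Phi> g) e') (\<Sum>e\<in>F. fps_map s (\<kappa> g e) * \<kappa>' (\<Phi> e) e')"
proof -
  interpret B: fps_basis sc V R E' \<kappa>' by (rule B)
  have FV: "\<And>e. e \<in> F \<Longrightarrow> e \<in> V" and FR: "\<And>e. e \<in> F \<Longrightarrow> \<kappa> g e \<in> R"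
    using F(2) basis_in_V coord_in_R g by auto
  have V: "(\<Sum>e\<in>F. sc (\<kappa> g e) e) \<in> V" by (intro V_sum V_sc FV)
  have "veq n g (\<Sum>e\<in>F. sc (\<kappa> g e) e)" by (rule approx[OF g F])
  then have "veq n (\<Phi> g) (\<Phi> (\<Sum>e\<in>F. sc (\<kappa> g e) e))"
    by (rule semilinear_veq[OF \<Phi> _ V])
  then have "fps_eq_mod n (\<kappa>' (\<Phi> g) e') (\<kappa>' (\<Phi> (\<Sum>e\<in>F. sc (\<kappa> g e) e)) e')"
    by (rule B.coord_veq[OF _ semilinearD(3)[OF \<Phi> V] e])
  also have "\<Phi> (\<Sum>e\<in>F. sc (\<kappa> g e) e) = (\<Sum>e\<in>F. sc (fps_map s (\<kappa> g e)) (\<Phi> e))"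
    by (rule semilinear_sum[OF \<Phi> FR FV])
  also have "\<kappa>' \<dots> e' = (\<Sum>e\<in>F. fps_map s (\<kappa> g e) * \<kappa>' (\<Phi> e) e')"
    by (rule B.coord_sum) (auto intro: e FR FV semilinearD(2,3)[OF \<Phi>])
  finally show ?thesis .
qed

lemma trace_eq_mod:
  assumes "compact_op E \<kappa> \<Phi>" "range_mod n E \<kappa> \<Phi> J"
  shows "fps_eq_mod n (trace E \<kappa> \<Phi>) (\<Sum>e\<in>J. \<kappa> (\<Phi> e) e)"
  unfolding trace_def
proof (rule infsum_fps_eq_mod[OF _ range_modD(1,2)[OF assms(2)]])
  show "null_family (\<lambda>e. \<kappa> (\<Phi> e) e) E"
    unfolding null_family_def
  proof
    fix n
    obtain K where K: "range_mod n E \<kappa> \<Phi> K" using assms(1) by (auto simp: compact_op_def)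
    have "{e \<in> E. \<not> fps_X ^ n dvd \<kappa> (\<Phi> e) e} \<subseteq> K"
      using range_modD(3)[OF K] basis_in_V by blast
    then show "finite {e \<in> E. \<not> fps_X ^ n dvd \<kappa> (\<Phi> e) e}"
      using range_modD(1)[OF K] finite_subset by blast
  qed
  show "fps_X ^ n dvd \<kappa> (\<Phi> e) e" if "e \<in> E - J" for e
    using range_modD(3)[OF assms(2)] that basis_in_V by blast
qed

lemma finite_coords:
  assumes "finite A" "A \<subseteq> V"
  obtains F where "finite F" "F \<subseteq> E" "\<And>g e. g \<in> A \<Longrightarrow> e \<in> E - F \<Longrightarrow> fps_X ^ n dvd \<kappa> g e"
proof (rule that[of "\<Union>g\<in>A. {e \<in> E. \<not> fps_X ^ n dvd \<kappa> g e}"])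
  show "finite (\<Union>g\<in>A. {e \<in> E. \<not> fps_X ^ n dvd \<kappa> g e})"
    using assms coord_null by (auto simp: null_family_def)
qed auto

end

section \<open>Traces of products of semilinear operators\<close>

context fps_module
begin

text \<open>Modulo \<open>fps_X ^ n\<close> the map T lands in the span of J, so S after T lands in
  the span of the finitely many images S f, and K collects their coordinates. The second conclusion
  expands these images over K in \<open>trace_commute\<close>.\<close>

lemma range_mod_comp_left:
  assumes B: "fps_basis sc V R F \<mu>" and B': "fps_basis sc V R E \<kappa>"
    and S: "semilinear s S" and T: "T \<in> V \<rightarrow> V" and J: "range_mod n F \<mu> T J"
  obtains K where "range_mod n E \<kappa> (\<lambda>g. S (T g)) K" "\<And>e f. e \<in> E - K \<Longrightarrow> f \<in> J \<Longrightarrow> fps_X ^ n dvd \<kappa> (S f) e"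
proof -
  interpret B: fps_basis sc V R F \<mu> by (rule B)
  interpret B': fps_basis sc V R E \<kappa> by (rule B')
  note J = J range_modD[OF J]
  have "S ` J \<subseteq> V" using J(3) B.basis_in_V semilinearD(3)[OF S] by auto
  then obtain K where K: "finite K" "K \<subseteq> E" "\<And>g e. g \<in> S ` J \<Longrightarrow> e \<in> E - K \<Longrightarrow> fps_X ^ n dvd \<kappa> g e"
    using B'.finite_coords[of "S ` J" n] J(2) by (metis finite_imageI)
  have *: "fps_X ^ n dvd \<kappa> (S f) e" if "e \<in> E - K" "f \<in> J" for e f
    using K(3) that by blast
  have "fps_X ^ n dvd \<kappa> (S (T g)) e" if e: "e \<in> E - K" and g: "g \<in> V" for e g
  proof -
    have Tg: "T g \<in> V" using T g by blast
    have "fps_eq_mod n (\<kappa> (S (T g)) e) (\<Sum>f\<in>J. fps_map s (\<mu> (T g) f) * \<kappa> (S f) e)"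
      using e g J by (intro B.coord_expand[OF S Tg J(2,3) _ B']) auto
    also have "fps_eq_mod n \<dots> 0"
      using * e by (auto intro!: dvd_sum dvd_mult)
    finally show ?thesis by simp
  qed
  then show thesis using K(1,2) * by (intro that[of K]) (auto simp: range_mod_def)
qed

lemma compact_op_comp_left:
  assumes B: "fps_basis sc V R F \<mu>" and B': "fps_basis sc V R E \<kappa>"
    and S: "semilinear s S" and T: "T \<in> V \<rightarrow> V" "compact_op F \<mu> T"
  shows "compact_op E \<kappa> (\<lambda>g. S (T g))"
  unfolding compact_op_def
proof
  fix n
  obtain J where "range_mod n F \<mu> T J" using T(2) by (auto simp: compact_op_def)
  then show "\<exists>K. range_mod n E \<kappa> (\<lambda>g. S (T g)) K"
    using range_mod_comp_left[OF B B' S T(1)] by metis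
qed

text \<open>Modulo \<open>fps_X ^ n\<close> both traces reduce to one finite double sum over K and J
  of entries of S and T, and \<open>s (t x) = x\<close> lets s be pulled out of both factors.
  Finiteness comes from T, so that S may be the identity as a change of basis.\<close>

theorem trace_commute:
  assumes B: "fps_basis sc V R F \<mu>" and B': "fps_basis sc V R E \<kappa>"
    and S: "semilinear s S" and T: "semilinear t T" "compact_op F \<mu> T"
    and st: "\<And>x. s (t x) = x"
  shows "trace E \<kappa> (\<lambda>g. S (T g)) = fps_map s (trace F \<mu> (\<lambda>g. T (S g)))"
proof (rule fps_eq_mod_all_imp_eq)
  fix n
  interpret B: fps_basis sc V R F \<mu> by (rule B)
  interpret B': fps_basis sc V R E \<kappa> by (rule B')
  note TV = semilinear_maps[OF T(1)] and SV = semilinear_maps[OF S]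
  have s: "ring_hom_on s" using semilinearD(1)[OF S] .
  obtain J where J: "range_mod n F \<mu> T J" using T(2) by (auto simp: compact_op_def)
  obtain K where K: "range_mod n E \<kappa> (\<lambda>g. S (T g)) K"
      "\<And>e f. e \<in> E - K \<Longrightarrow> f \<in> J \<Longrightarrow> fps_X ^ n dvd \<kappa> (S f) e"
    using range_mod_comp_left[OF B B' S TV J] by metis
  note J = J range_modD[OF J] and K = K range_modD[OF K(1)]
  have JV: "f \<in> V" if "f \<in> J" for f using that J(3) B.basis_in_V by blast
  have KV: "e \<in> V" if "e \<in> K" for e using that K(4) B'.basis_in_V by blast
  have "fps_eq_mod n (trace E \<kappa> (\<lambda>g. S (T g))) (\<Sum>e\<in>K. \<kappa> (S (T e)) e)"
    by (rule B'.trace_eq_mod[OF compact_op_comp_left[OF B B' S TV T(2)] K(1)])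
  also have "fps_eq_mod n \<dots> (\<Sum>e\<in>K. \<Sum>f\<in>J. fps_map s (\<mu> (T e) f) * \<kappa> (S f) e)"
  proof (rule fps_eq_mod_sum)
    fix e assume e: "e \<in> K"
    show "fps_eq_mod n (\<kappa> (S (T e)) e) (\<Sum>f\<in>J. fps_map s (\<mu> (T e) f) * \<kappa> (S f) e)"
      using e KV[OF e] TV J K(4) by (intro B.coord_expand[OF S _ J(2,3) _ B']) auto
  qed
  also have "\<dots> = fps_map s (\<Sum>f\<in>J. \<Sum>e\<in>K. fps_map t (\<kappa> (S f) e) * \<mu> (T e) f)"
  proof -
    have "fps_map s (fps_map t c) = c" for c by (simp add: fps_map_map st fps_map_ident)
    then show ?thesis
      by (subst sum.swap) (simp add: fps_map_ring_hom[OF s] mult.commute)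
  qed
  also have "fps_eq_mod n \<dots> (fps_map s (\<Sum>f\<in>J. \<mu> (T (S f)) f))"
  proof (intro fps_eq_mod_map fps_eq_mod_sum)
    fix f assume f: "f \<in> J"
    have "fps_eq_mod n (\<mu> (T (S f)) f) (\<Sum>e\<in>K. fps_map t (\<kappa> (S f) e) * \<mu> (T e) f)"
      using f JV[OF f] SV K J(3) by (intro B'.coord_expand[OF T(1) _ K(3,4) _ B]) auto
    then show "fps_eq_mod n (\<Sum>e\<in>K. fps_map t (\<kappa> (S f) e) * \<mu> (T e) f) (\<mu> (T (S f)) f)"
      by (rule fps_eq_mod_sym)
  qed
  also have "fps_eq_mod n \<dots> (fps_map s (trace F \<mu> (\<lambda>g. T (S g))))"
    by (intro fps_eq_mod_map, rule fps_eq_mod_sym)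
      (rule B.trace_eq_mod[OF compact_op_comp[OF T(2) SV] range_mod_comp[OF J(1) SV]])
  finally show "fps_eq_mod n (trace E \<kappa> (\<lambda>g. S (T g))) (fps_map s (trace F \<mu> (\<lambda>g. T (S g))))" .
qed

corollary trace_basis_independent:
  assumes B: "fps_basis sc V R F \<mu>" and B': "fps_basis sc V R E \<kappa>"
    and T: "semilinear (\<lambda>x. x) T" "compact_op F \<mu> T"
  shows "trace E \<kappa> T = trace F \<mu> T"
  using trace_commute[OF B B' semilinear_ident T] by (simp add: fps_map_ident)

end

section \<open>Characteristic coefficients and Newton's identities in infinite rank\<close>

context fps_basis
begin

definition char_coeff :: "('v \<Rightarrow> 'v) \<Rightarrow> nat \<Rightarrow> 'r fps" where
  "char_coeff \<Phi> m = (\<Sum>\<^sub>\<infinity>S\<in>{S. S \<subseteq> E \<and> finite S \<and> card S = m}. principal_minor (\<lambda>i j. \<kappa> (\<Phi> j) i) S)"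

text \<open>Modulo \<open>fps_X ^ n\<close> the iterates of a vector of J stay in the span of J, so
  powers of the infinite matrix can be computed in the block on J.\<close>

lemma coord_funpow:
  assumes \<Phi>: "semilinear (\<lambda>x. x) \<Phi>"
    and J: "range_mod n E \<kappa> \<Phi> J"
    and e: "e \<in> J" and x: "x \<in> E"
  shows "fps_eq_mod n (\<kappa> ((\<Phi> ^^ k) e) x) (mat_pow (\<lambda>i j. \<kappa> (\<Phi> j) i) J k x e)"
  using x
proof (induction k arbitrary: x)
  case 0
  then show ?case using range_modD(2)[OF J] e by (auto simp: coord_basis)
next
  case (Suc k)
  note J = range_modD[OF J]
  have V: "(\<Phi> ^^ k) e \<in> V" for k
    using J(2) e basis_in_V funpow_maps[OF semilinear_maps[OF \<Phi>], of k] by blast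
  have "fps_X ^ n dvd \<kappa> ((\<Phi> ^^ k) e) f" if "f \<in> E - J" for f
    using that J(3) V J(2) e by (cases k) (auto simp: coord_basis)
  then have "fps_eq_mod n (\<kappa> (\<Phi> ((\<Phi> ^^ k) e)) x) (\<Sum>f\<in>J. fps_map (\<lambda>x. x) (\<kappa> ((\<Phi> ^^ k) e) f) * \<kappa> (\<Phi> f) x)"
    using Suc.prems by (intro coord_expand[OF \<Phi> V J(1,2) _ fps_basis_axioms])
  also have "fps_eq_mod n \<dots> (\<Sum>f\<in>J. \<kappa> (\<Phi> f) x * mat_pow (\<lambda>i j. \<kappa> (\<Phi> j) i) J k f e)"
    using J(2) Suc.IH by (intro fps_eq_mod_sum) (auto simp: fps_map_ident mult.commute[of "\<kappa> (\<Phi> _) x"] intro!: fps_eq_mod_mult)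
  finally show ?case by simp
qed

text \<open>A minor whose index set contains some e outside J has a row divisible by
  \<open>fps_X ^ n\<close>, because the entries of that row are e-coordinates of images under
  \<Phi>.\<close>

lemma char_coeff_eq_mod:
  assumes \<Phi>: "compact_op E \<kappa> \<Phi>"
    and J: "range_mod n E \<kappa> \<Phi> J"
  shows "fps_eq_mod n (char_coeff \<Phi> m) (minor_sum (\<lambda>i j. \<kappa> (\<Phi> j) i) J m)"
proof -
  let ?A = "\<lambda>i j. \<kappa> (\<Phi> j) i" and ?Q = "{S. S \<subseteq> E \<and> finite S \<and> card S = m}"
  have *: "fps_X ^ n dvd principal_minor ?A S"
    if S: "S \<subseteq> E" "finite S" "\<not> S \<subseteq> J" and J: "range_mod n E \<kappa> \<Phi> J"
    for n S J
  proof -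
    obtain e where e: "e \<in> S" "e \<notin> J" using S by blast
    have "fps_X ^ n dvd (\<Prod>i\<in>S. ?A i (\<tau> i))" if "\<tau> permutes S" for \<tau>
    proof -
      have "\<tau> e \<in> V" using permutes_in_image[OF that, of e] e S(1) basis_in_V by blast
      then have "fps_X ^ n dvd ?A e (\<tau> e)" using e S range_modD(3)[OF J] by blast
      then show ?thesis using e S(2) by (meson dvd_prodI dvd_trans)
    qed
    then show ?thesis unfolding principal_minor_def by (auto intro!: dvd_sum dvd_mult)
  qed
  have "null_family (principal_minor ?A) ?Q"
    unfolding null_family_def
  proof
    fix n
    obtain J where J: "range_mod n E \<kappa> \<Phi> J" using \<Phi> by (auto simp: compact_op_def)
    have "{S \<in> ?Q. \<not> fps_X ^ n dvd principal_minor ?A S} \<subseteq> Pow J"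
      using *[OF _ _ _ J] by blast
    then show "finite {S \<in> ?Q. \<not> fps_X ^ n dvd principal_minor ?A S}"
      using range_modD(1)[OF J] by (meson finite_Pow_iff finite_subset)
  qed
  moreover have "finite {S. S \<subseteq> J \<and> card S = m}" using range_modD(1)[OF J] by simp
  moreover have "{S. S \<subseteq> J \<and> card S = m} \<subseteq> ?Q" using range_modD(1,2)[OF J] finite_subset by blast
  moreover have "fps_X ^ n dvd principal_minor ?A S" if "S \<in> ?Q - {S. S \<subseteq> J \<and> card S = m}" for S
    using that by (intro *[OF _ _ _ J]) auto
  ultimately show ?thesis
    unfolding char_coeff_def minor_sum_def by (rule infsum_fps_eq_mod)
qed

lemma range_mod_funpow_Suc:
  "range_mod n E \<kappa> \<Phi> J \<Longrightarrow> \<Phi> \<in> V \<rightarrow> V \<Longrightarrow> range_mod n E \<kappa> (\<Phi> ^^ Suc k) J"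
  using range_mod_comp[OF _ funpow_maps, of n E \<kappa> \<Phi> J \<Phi> k] by (simp add: comp_def)

lemma compact_op_funpow_Suc:
  "compact_op E \<kappa> \<Phi> \<Longrightarrow> \<Phi> \<in> V \<rightarrow> V \<Longrightarrow> compact_op E \<kappa> (\<Phi> ^^ Suc k)"
  using range_mod_funpow_Suc unfolding compact_op_def by blast

text \<open>One J serves all terms, since the range of a positive power of \<Phi> is contained in
  that of \<Phi>. Modulo \<open>fps_X ^ n\<close> this is the finite identity for the block on
  J.\<close>

theorem char_coeff_newton:
  assumes \<Phi>: "semilinear (\<lambda>x. x) \<Phi>" "compact_op E \<kappa> \<Phi>"
    and char: "\<And>k. k > 0 \<Longrightarrow> (of_nat k :: 'r) \<noteq> 0"
  shows "of_nat (Suc m) * char_coeff \<Phi> (Suc m) =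
    (\<Sum>k\<le>m. (-1) ^ k * trace E \<kappa> (\<Phi> ^^ Suc k) * char_coeff \<Phi> (m - k))"
proof (rule fps_eq_mod_all_imp_eq)
  fix n
  let ?A = "\<lambda>i j. \<kappa> (\<Phi> j) i"
  note V = semilinear_maps[OF \<Phi>(1)]
  obtain J where J: "range_mod n E \<kappa> \<Phi> J" using \<Phi>(2) by (auto simp: compact_op_def)
  have charX: "(of_nat k :: 'r fps) \<noteq> 0" if "k > 0" for k
    using char[OF that] by (metis fps_of_nat fps_const_eq_0_iff)
  have tr: "fps_eq_mod n (trace E \<kappa> (\<Phi> ^^ Suc k)) (\<Sum>x\<in>J. mat_pow ?A J (Suc k) x x)" for k
  proof -
    have "fps_eq_mod n (trace E \<kappa> (\<Phi> ^^ Suc k)) (\<Sum>x\<in>J. \<kappa> ((\<Phi> ^^ Suc k) x) x)"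
      by (intro trace_eq_mod compact_op_funpow_Suc range_mod_funpow_Suc \<Phi>(2) V J)
    also have "fps_eq_mod n \<dots> (\<Sum>x\<in>J. mat_pow ?A J (Suc k) x x)"
      using range_modD(2)[OF J] by (intro fps_eq_mod_sum coord_funpow[OF \<Phi>(1) J]) auto
    finally show ?thesis .
  qed
  have "fps_eq_mod n (of_nat (Suc m) * char_coeff \<Phi> (Suc m)) (of_nat (Suc m) * minor_sum ?A J (Suc m))"
    by (intro fps_eq_mod_mult fps_eq_mod_refl char_coeff_eq_mod[OF \<Phi>(2) J])
  also have "\<dots> = (\<Sum>k\<le>m. (-1) ^ k * (\<Sum>x\<in>J. mat_pow ?A J (Suc k) x x) * minor_sum ?A J (m - k))"
    by (rule newton_identities[OF range_modD(1)[OF J] charX])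
  also have "fps_eq_mod n \<dots> (\<Sum>k\<le>m. (-1) ^ k * trace E \<kappa> (\<Phi> ^^ Suc k) * char_coeff \<Phi> (m - k))"
    by (rule fps_eq_mod_sym)
      (intro fps_eq_mod_sum fps_eq_mod_mult fps_eq_mod_refl tr char_coeff_eq_mod[OF \<Phi>(2) J])
  finally show "fps_eq_mod n (of_nat (Suc m) * char_coeff \<Phi> (Suc m))
    (\<Sum>k\<le>m. (-1) ^ k * trace E \<kappa> (\<Phi> ^^ Suc k) * char_coeff \<Phi> (m - k))" .
qed

lemma char_coeff_0: "char_coeff \<Phi> 0 = 1"
proof -
  have "{S. S \<subseteq> E \<and> finite S \<and> card S = 0} = {{}}" by auto
  then show ?thesis by (simp add: char_coeff_def principal_minor_def)
qed

end

lemma newton_recursion_unique: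
  fixes d d' :: "nat \<Rightarrow> 'c::idom"
  assumes "d 0 = d' 0"
    and "\<And>m. of_nat (Suc m) * d (Suc m) = (\<Sum>k\<le>m. q k * d (m - k))"
    and "\<And>m. of_nat (Suc m) * d' (Suc m) = (\<Sum>k\<le>m. q k * d' (m - k))"
    and char: "\<And>k. k > 0 \<Longrightarrow> (of_nat k :: 'c) \<noteq> 0"
  shows "d = d'"
proof
  fix m
  show "d m = d' m"
  proof (induction m rule: less_induct)
    case (less m)
    show ?case
    proof (cases m)
      case 0
      then show ?thesis using assms(1) by simp
    next
      case (Suc l)
      have "of_nat m * d m = of_nat m * d' m"
        unfolding Suc assms(2,3) by (intro sum.cong refl) (simp add: less Suc)
      then show ?thesis using char[of m] Suc by simp
    qed
  qed
qed

context fps_module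
begin

theorem char_coeff_basis_independent:
  assumes B: "fps_basis sc V R F \<mu>" and B': "fps_basis sc V R E \<kappa>"
    and \<Phi>: "semilinear (\<lambda>x. x) \<Phi>" "compact_op F \<mu> \<Phi>"
    and char: "\<And>k. k > 0 \<Longrightarrow> (of_nat k :: 'r) \<noteq> 0"
  shows "fps_basis.char_coeff E \<kappa> \<Phi> = fps_basis.char_coeff F \<mu> \<Phi>"
proof -
  interpret B: fps_basis sc V R F \<mu> by (rule B)
  interpret B': fps_basis sc V R E \<kappa> by (rule B')
  note V = semilinear_maps[OF \<Phi>(1)]
  have c: "compact_op E \<kappa> \<Phi>"
    using compact_op_comp_left[OF B B' semilinear_ident V \<Phi>(2)] .
  have lin: "semilinear (\<lambda>x. x) (\<Phi> ^^ k)" for k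
    using semilinear_funpow[OF \<Phi>(1), of k] by (simp add: id_def[symmetric])
  have tr: "trace E \<kappa> (\<Phi> ^^ Suc k) = trace F \<mu> (\<Phi> ^^ Suc k)" for k
    by (intro trace_basis_independent[OF B B' lin] B.compact_op_funpow_Suc \<Phi>(2) V)
  have charX: "(of_nat k :: 'r fps) \<noteq> 0" if "k > 0" for k
    using char[OF that] by (metis fps_of_nat fps_const_eq_0_iff)
  show ?thesis
  proof (rule newton_recursion_unique[OF _ _ _ charX])
    show "of_nat (Suc m) * B.char_coeff \<Phi> (Suc m)
        = (\<Sum>k\<le>m. (- 1) ^ k * trace F \<mu> (\<Phi> ^^ Suc k) * B.char_coeff \<Phi> (m - k))" for m
      by (rule B.char_coeff_newton[OF \<Phi> char])
    show "of_nat (Suc m) * B'.char_coeff \<Phi> (Suc m)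
        = (\<Sum>k\<le>m. (- 1) ^ k * trace F \<mu> (\<Phi> ^^ Suc k) * B'.char_coeff \<Phi> (m - k))" for m
      unfolding tr[symmetric] by (rule B'.char_coeff_newton[OF \<Phi>(1) c char])
  qed (simp_all add: B.char_coeff_0 B'.char_coeff_0)
qed

end

section \<open>The Frobenius of the Witt vectors\<close>

text \<open>A ring that is finite free over a subring \<open>R0\<close>, with its coordinate
  functionals. Two instances occur, Z_q over Z_p with a basis of b elements and Z_q over itself with
  basis {1}, so that both determinants come from one construction.\<close>

locale free_coeffs =
  fixes R0 :: "'r::idom set" and \<Xi> :: "'r set" and cf :: "'r \<Rightarrow> 'r \<Rightarrow> 'r"
  assumes fin: "finite \<Xi>"
    and R0_0: "0 \<in> R0" and R0_1: "1 \<in> R0"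
    and R0_add: "x \<in> R0 \<Longrightarrow> y \<in> R0 \<Longrightarrow> x + y \<in> R0" and R0_mult: "x \<in> R0 \<Longrightarrow> y \<in> R0 \<Longrightarrow> x * y \<in> R0"
    and cf_in: "\<xi> \<in> \<Xi> \<Longrightarrow> cf \<xi> x \<in> R0"
    and cf_add: "\<xi> \<in> \<Xi> \<Longrightarrow> cf \<xi> (x + y) = cf \<xi> x + cf \<xi> y"
    and cf_mult: "\<xi> \<in> \<Xi> \<Longrightarrow> c \<in> R0 \<Longrightarrow> cf \<xi> (c * x) = c * cf \<xi> x"
    and cf_basis: "\<xi> \<in> \<Xi> \<Longrightarrow> \<eta> \<in> \<Xi> \<Longrightarrow> cf \<xi> \<eta> = (if \<xi> = \<eta> then 1 else 0)"
    and cf_expand: "(\<Sum>\<xi>\<in>\<Xi>. cf \<xi> x * \<xi>) = x"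
begin

lemma cf_0: "\<xi> \<in> \<Xi> \<Longrightarrow> cf \<xi> 0 = 0"
  using cf_mult[of \<xi> 0 0] R0_0 by simp

lemma cf_sum: "\<xi> \<in> \<Xi> \<Longrightarrow> cf \<xi> (sum f A) = (\<Sum>i\<in>A. cf \<xi> (f i))"
  by (induction A rule: infinite_finite_induct) (auto simp: cf_0 cf_add)

definition linear0 :: "('r \<Rightarrow> 'r) \<Rightarrow> bool" where
  "linear0 \<phi> \<longleftrightarrow> (\<forall>x y. \<phi> (x + y) = \<phi> x + \<phi> y) \<and> (\<forall>c\<in>R0. \<forall>x. \<phi> (c * x) = c * \<phi> x)"

definition trace0 :: "('r \<Rightarrow> 'r) \<Rightarrow> 'r" where
  "trace0 \<phi> = (\<Sum>\<xi>\<in>\<Xi>. cf \<xi> (\<phi> \<xi>))"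

lemma linear0_expand:
  assumes "linear0 \<phi>"
  shows "\<phi> x = (\<Sum>\<eta>\<in>\<Xi>. cf \<eta> x * \<phi> \<eta>)"
proof -
  have 0: "\<phi> 0 = 0" using assms R0_0 unfolding linear0_def by (metis mult_zero_left)
  have "\<phi> (\<Sum>\<eta>\<in>A. cf \<eta> x * \<eta>) = (\<Sum>\<eta>\<in>A. cf \<eta> x * \<phi> \<eta>)" if "A \<subseteq> \<Xi>" for A
    using finite_subset[OF that fin] that
    by (induction A rule: finite_induct) (use assms 0 cf_in in \<open>auto simp: linear0_def\<close>)
  from this[OF order.refl] show ?thesis by (simp add: cf_expand)
qed

lemma trace0_comp:
  assumes "linear0 \<phi>"
  shows "trace0 (\<lambda>x. \<phi> (\<psi> x)) = (\<Sum>\<xi>\<in>\<Xi>. \<Sum>\<eta>\<in>\<Xi>. cf \<eta> (\<psi> \<xi>) * cf \<xi> (\<phi> \<eta>))"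
  unfolding trace0_def
  by (subst linear0_expand[OF assms]) (simp add: cf_sum cf_mult cf_in)

lemma trace0_commute:
  assumes "linear0 \<phi>" "linear0 \<psi>"
  shows "trace0 (\<lambda>x. \<phi> (\<psi> x)) = trace0 (\<lambda>x. \<psi> (\<phi> x))"
  unfolding trace0_comp[OF assms(1)] trace0_comp[OF assms(2)]
  by (subst sum.swap) (simp add: mult.commute)

lemma trace0_cmult: "c \<in> R0 \<Longrightarrow> trace0 (\<lambda>x. c * \<phi> x) = c * trace0 \<phi>"
  by (simp add: trace0_def cf_mult sum_distrib_left)

lemma trace0_ident: "trace0 (\<lambda>x. x) = of_nat (card \<Xi>)"
  by (simp add: trace0_def cf_basis)

end

lemma free_coeffs_trivial: "free_coeffs UNIV {1 :: 'r::idom} (\<lambda>_ x. x)"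
  by unfold_locales auto

lemma finite_field_power_card:
  fixes x :: "'k::{field,finite}"
  shows "x ^ CARD('k) = x"
proof (cases "x = 0")
  case True
  then show ?thesis by (simp add: zero_power)
next
  case False
  let ?U = "UNIV - {0 :: 'k}"
  have bij: "bij_betw ((*) x) ?U ?U"
    by (rule bij_betwI[of _ _ _ "\<lambda>y. y / x"]) (use False in auto)
  have "(\<Prod>y\<in>?U. y) = (\<Prod>y\<in>?U. x * y)"
    using prod.reindex_bij_betw[OF bij, of "\<lambda>y. y"] by simp
  also have "\<dots> = x ^ card ?U * (\<Prod>y\<in>?U. y)" by (simp add: prod.distrib)
  finally have *: "x ^ card ?U = 1" by simp
  have "CARD('k) = Suc (card ?U)" by (simp add: card_Diff_singleton card_gt_0_iff)
  then show ?thesis by (simp only: power_Suc * mult_1_right)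
qed

lemma card_power_fixpoints_le:
  fixes m :: nat
  assumes "m > 1"
  shows "card {y :: 'k::{field,finite}. y ^ m = y} \<le> m"
proof -
  let ?P = "monom (1::'k) m - monom 1 1"
  have c: "coeff ?P m = 1" using assms by simp
  then have "?P \<noteq> 0" by (metis coeff_0 zero_neq_one)
  moreover have "degree ?P \<le> m" using assms by (intro degree_diff_le) (auto simp: degree_monom_eq)
  moreover have "{y. y ^ m = y} = {y. poly ?P y = 0}" by (auto simp: poly_monom)
  ultimately show ?thesis using card_poly_roots_bound[of ?P] by simp
qed

section \<open>Reduction modulo p and the Frobenius\<close>

locale witt_frobenius =
  fixes p b :: nat and red :: "'r::idom \<Rightarrow> 'k::{field,finite}" and \<sigma> :: "'r \<Rightarrow> 'r"
  assumes prime: "prime p" and card_k: "CARD('k) = p ^ b"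
    and witt: "witt_vectors p red" and frob: "frobenius p \<sigma>"
begin

lemma red_hom: "red 1 = 1" "red (x + y) = red x + red y" "red (x * y) = red x * red y"
  using witt by (auto simp: witt_vectors_def ring_hom_on_def)

lemma red_0_iff: "red x = 0 \<longleftrightarrow> of_nat p dvd x"
  and surj_red: "surj red" and p_nz: "(of_nat p :: 'r) \<noteq> 0"
  using witt by (auto simp: witt_vectors_def)

lemma separated: "(\<And>n. of_nat p ^ n dvd x) \<Longrightarrow> x = (0::'r)"
  using witt by (auto simp: witt_vectors_def)

lemma complete:
  fixes s :: "nat \<Rightarrow> 'r"
  shows "(\<And>n. of_nat p ^ n dvd s (Suc n) - s n) \<Longrightarrow> \<exists>x. \<forall>n. of_nat p ^ n dvd x - s n"
  using witt by (auto simp: witt_vectors_def)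

lemma red_0 [simp]: "red 0 = 0"
  using red_0_iff[of 0] by simp

lemma red_diff: "red (x - y) = red x - red y"
  using red_hom(2)[of "x - y" y] by simp

lemma red_eq_iff: "red x = red y \<longleftrightarrow> of_nat p dvd x - y"
  using red_0_iff[of "x - y"] by (simp add: red_diff)

lemma red_simps [simp]:
  "red (of_nat n) = of_nat n" "red (of_int m) = of_int m" "red (x ^ n) = red x ^ n"
  "red (sum f A) = (\<Sum>i\<in>A. red (f i))"
proof -
  show n: "red (of_nat n) = of_nat n" for n by (induction n) (simp_all add: red_hom)
  show "red (of_int m) = of_int m"
    by (cases m rule: int_diff_cases) (simp add: red_diff n)
  show "red (x ^ n) = red x ^ n" by (induction n) (simp_all add: red_hom)
  show "red (sum f A) = (\<Sum>i\<in>A. red (f i))"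
    by (induction A rule: infinite_finite_induct) (simp_all add: red_hom)
qed

lemma p_gt_1: "p > 1"
  using prime prime_gt_1_nat by blast

lemma b_pos: "b > 0"
proof (rule ccontr)
  assume "\<not> b > 0"
  then have "card (UNIV :: 'k set) = 1" using card_k by simp
  then obtain x :: 'k where "UNIV = {x}" by (auto simp: card_1_singleton_iff)
  then have "(0::'k) = 1" by (metis UNIV_I singletonD)
  then show False by simp
qed

lemma of_int_k_eq_0_iff: "(of_int m :: 'k) = 0 \<longleftrightarrow> int p dvd m"
proof
  assume "int p dvd m"
  moreover have "(of_nat p :: 'k) = 0" using red_0_iff[of "of_nat p"] by simp
  ultimately show "(of_int m :: 'k) = 0" by (auto elim!: dvdE)
next
  assume m: "(of_int m :: 'k) = 0"
  show "int p dvd m"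
  proof (rule ccontr)
    assume "\<not> int p dvd m"
    then have "coprime (int p) m" using prime by (simp add: prime_imp_coprime)
    then obtain u v where "u * int p + v * m = 1" using bezout_int[of "int p" m] by auto
    then have "(of_int (u * int p + v * m) :: 'k) = 1" by simp
    moreover have "(of_nat p :: 'k) = 0" using red_0_iff[of "of_nat p"] by simp
    ultimately show False using m by simp
  qed
qed

text \<open>Factors p are split off, as p is nonzero in a domain, and an integer prime to p is
  nonzero already in the residue field. This permits the cancellations in Newton's
  recursion.\<close>

lemma char_0:
  assumes "n > 0"
  shows "(of_nat n :: 'r) \<noteq> 0"
  using assms
proof (induction n rule: less_induct)
  case (less n)
  show ?case
  proof (cases "p dvd n")
    case True
    then obtain m where m: "n = p * m" by blast
    then have "m > 0" "m < n" using less.prems p_gt_1 by auto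
    then show ?thesis using less.IH m p_nz by simp
  next
    case False
    have "red (of_nat n) \<noteq> 0"
      using of_int_k_eq_0_iff[of "int n"] False by simp
    then show ?thesis by (metis red_0)
  qed
qed

lemma p_power_dvd_mult_iff:
  "of_nat p ^ Suc n dvd of_nat p * x \<longleftrightarrow> of_nat p ^ n dvd (x :: 'r)"
  using p_nz by simp

lemma \<sigma>_hom: "\<sigma> 1 = 1" "\<sigma> (x + y) = \<sigma> x + \<sigma> y" "\<sigma> (x * y) = \<sigma> x * \<sigma> y"
  and bij_\<sigma>: "bij \<sigma>" and \<sigma>_cong: "of_nat p dvd \<sigma> x - x ^ p"
  using frob by (auto simp: frobenius_def ring_hom_on_def)

lemma \<sigma>_0 [simp]: "\<sigma> 0 = 0"
  using \<sigma>_hom(2)[of 0 0] by (simp only: add_0_right add_cancel_right_right)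

lemma \<sigma>_diff: "\<sigma> (x - y) = \<sigma> x - \<sigma> y"
  using \<sigma>_hom(2)[of "x - y" y] by simp

lemma \<sigma>_of_nat [simp]: "\<sigma> (of_nat n) = of_nat n"
  by (induction n) (simp_all add: \<sigma>_hom)

lemma \<sigma>_of_int [simp]: "\<sigma> (of_int m) = of_int m"
  by (cases m rule: int_diff_cases) (simp add: \<sigma>_diff)

lemma red_\<sigma>: "red (\<sigma> x) = red x ^ p"
  using \<sigma>_cong[of x] red_eq_iff[of "\<sigma> x" "x ^ p"] by simp

lemma red_\<sigma>_funpow: "red ((\<sigma> ^^ k) x) = red x ^ (p ^ k)"
  by (induction k) (simp_all add: red_\<sigma> power_mult[symmetric] mult.commute)

lemma \<sigma>_funpow_hom: "(\<sigma> ^^ k) (x + y) = (\<sigma> ^^ k) x + (\<sigma> ^^ k) y" "(\<sigma> ^^ k) (x * y) = (\<sigma> ^^ k) x * (\<sigma> ^^ k) y"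
  "(\<sigma> ^^ k) (of_nat n) = of_nat n" "(\<sigma> ^^ k) (x ^ n) = (\<sigma> ^^ k) x ^ n"
proof -
  show "(\<sigma> ^^ k) (x + y) = (\<sigma> ^^ k) x + (\<sigma> ^^ k) y" by (induction k) (simp_all add: \<sigma>_hom)
  show m: "(\<sigma> ^^ k) (x * y) = (\<sigma> ^^ k) x * (\<sigma> ^^ k) y" for x y by (induction k) (simp_all add: \<sigma>_hom)
  show "(\<sigma> ^^ k) (of_nat n) = of_nat n" for n by (induction k) simp_all
  from this[of 1] have "(\<sigma> ^^ k) 1 = 1" by simp
  then show "(\<sigma> ^^ k) (x ^ n) = (\<sigma> ^^ k) x ^ n" by (induction n) (simp_all add: m)
qed

text \<open>In x^p - y^p = (x - y) times a sum of p products, all products agree modulo p because x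
  and y do, so the second factor contributes one more p.\<close>

lemma dvd_power_p_diff:
  fixes x y :: 'r
  assumes "of_nat p ^ Suc n dvd x - y"
  shows "of_nat p ^ Suc (Suc n) dvd x ^ p - y ^ p"
proof -
  have "red x = red y"
    using assms unfolding red_eq_iff by (metis dvd_mult_left power_Suc)
  then have "red (\<Sum>i<p. y ^ (p - Suc i) * x ^ i) = (\<Sum>i<p. red y ^ (p - Suc i) * red y ^ i)"
    by (simp add: red_hom)
  also have "\<dots> = (\<Sum>i<p. red y ^ (p - 1))"
    by (intro sum.cong) (auto simp: power_add[symmetric])
  also have "\<dots> = red (of_nat p) * red y ^ (p - 1)" by simp
  also have "\<dots> = 0" using red_0_iff[of "of_nat p"] by simp
  finally have "of_nat p dvd (\<Sum>i<p. y ^ (p - Suc i) * x ^ i)" unfolding red_0_iff .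
  then show ?thesis
    unfolding power_diff_sumr2 power_Suc2[of _ "Suc n"] using assms by (intro mult_dvd_mono)
qed

text \<open>The residue field is perfect, so \<open>x = z\<^sup>p + p w\<close>; this improves congruences modulo \<open>p\<^sup>n\<close>.\<close>

lemma \<sigma>_funpow_b: "(\<sigma> ^^ b) x = x"
proof -
  have "of_nat p ^ Suc n dvd (\<sigma> ^^ b) x - x" for n x
  proof (induction n arbitrary: x)
    case 0
    have "red ((\<sigma> ^^ b) x) = red x"
      unfolding red_\<sigma>_funpow using finite_field_power_card[of "red x"] by (simp add: card_k)
    then show ?case by (simp add: red_eq_iff)
  next
    case (Suc n)
    \<comment> \<open>This residue is the p-th root of \<open>red x\<close>: raising to the power
      p^(b-1) and then to the power p is the identity of F_q.\<close>
    obtain z where z: "red z = red x ^ (p ^ (b - 1))" using surj_red by (metis surjD)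
    have "red (z ^ p) = red x"
      using finite_field_power_card[of "red x"] b_pos
      by (simp add: z card_k power_mult[symmetric] mult.commute power_eq_if[of p b])
    then have "of_nat p dvd x - z ^ p" by (metis red_eq_iff)
    then obtain w where "x - z ^ p = of_nat p * w" by (auto elim!: dvdE)
    then have w: "x = z ^ p + of_nat p * w" by (simp add: algebra_simps)
    have "(\<sigma> ^^ b) x - x = ((\<sigma> ^^ b) z ^ p - z ^ p) + of_nat p * ((\<sigma> ^^ b) w - w)"
      unfolding w by (simp add: \<sigma>_funpow_hom algebra_simps)
    moreover have "of_nat p ^ Suc (Suc n) dvd (\<sigma> ^^ b) z ^ p - z ^ p"
      by (intro dvd_power_p_diff Suc.IH)
    moreover have "of_nat p ^ Suc (Suc n) dvd of_nat p * ((\<sigma> ^^ b) w - w)"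
      unfolding p_power_dvd_mult_iff by (rule Suc.IH)
    ultimately show ?case by (metis dvd_add)
  qed
  then have "of_nat p ^ n dvd (\<sigma> ^^ b) x - x" for n
    by (cases n) (auto simp del: power_Suc)
  then have "(\<sigma> ^^ b) x - x = 0" by (rule separated)
  then show ?thesis by simp
qed

text \<open>The residues of 0, ..., p - 1 are already p distinct roots of Y^p - Y, which has no
  more.\<close>

lemma power_p_fixed_k:
  fixes y :: 'k
  assumes "y ^ p = y"
  obtains m :: int where "y = of_int m"
proof -
  have inj: "inj_on (of_nat :: nat \<Rightarrow> 'k) {..<p}"
  proof (rule inj_onI)
    fix i j assume ij: "i \<in> {..<p}" "j \<in> {..<p}" "(of_nat i :: 'k) = of_nat j"
    then have "int p dvd int i - int j" using of_int_k_eq_0_iff[of "int i - int j"] by simp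
    then have "int i mod int p = int j mod int p" by (simp add: mod_eq_dvd_iff)
    then show "i = j" using ij(1,2) by simp
  qed
  have "(of_nat i :: 'k) ^ p = of_nat i" for i
    using red_\<sigma>[of "of_nat i"] by simp
  then have "of_nat ` {..<p} \<subseteq> {y :: 'k. y ^ p = y}" by auto
  moreover have "card (of_nat ` {..<p} :: 'k set) = p" using inj by (simp add: card_image)
  ultimately have "of_nat ` {..<p} = {y :: 'k. y ^ p = y}"
    using card_power_fixpoints_le[of p, where 'k = 'k] p_gt_1 by (intro card_seteq) auto
  then obtain i where "y = of_nat i" using assms by auto
  then show thesis using that[of "int i"] by simp
qed

text \<open>In one direction, \<sigma> fixes integers arbitrarily close to x. In the other, the
  residue of a fixed x lies in the prime field, so x = m + p y with an integer m, and y is fixed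
  again.\<close>

lemma Zp_iff: "x \<in> Zp p \<longleftrightarrow> \<sigma> x = x"
proof
  assume x: "x \<in> Zp p"
  have "of_nat p ^ n dvd \<sigma> x - x" for n
  proof -
    obtain m k where mk: "x - of_int m = of_nat p ^ n * k"
      using x by (fastforce simp: Zp_def elim!: dvdE)
    have "\<sigma> x - of_int m = \<sigma> (x - of_int m)" by (simp add: \<sigma>_diff)
    also have "\<dots> = \<sigma> (of_nat (p ^ n) * k)" by (simp add: mk)
    also have "\<dots> = of_nat p ^ n * \<sigma> k" unfolding \<sigma>_hom \<sigma>_of_nat by simp
    finally have "\<sigma> x - x = of_nat p ^ n * (\<sigma> k - k)" using mk by (simp add: algebra_simps)
    then show ?thesis by simp
  qed
  then have "\<sigma> x - x = 0" by (rule separated)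
  then show "\<sigma> x = x" by simp
next
  assume x: "\<sigma> x = x"
  have "\<exists>m::int. of_nat p ^ n dvd x - of_int m" for n
    using x
  proof (induction n arbitrary: x)
    case (Suc n)
    have "red x ^ p = red x" using red_\<sigma>[of x] Suc.prems by simp
    then obtain m where "red x = of_int m" by (rule power_p_fixed_k)
    then have "red x = red (of_int m)" by simp
    then obtain y where y: "x - of_int m = of_nat p * y" unfolding red_eq_iff by (auto elim!: dvdE)
    have "of_nat p * \<sigma> y = \<sigma> (of_nat p * y)" by (simp add: \<sigma>_hom)
    also have "\<dots> = of_nat p * y" unfolding y[symmetric] by (simp add: \<sigma>_diff Suc.prems)
    finally have "\<sigma> y = y" using p_nz by simp
    then obtain l :: int where l: "of_nat p ^ n dvd y - of_int l" using Suc.IH by blast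
    have "x - of_int (m + int p * l) = of_nat p * (y - of_int l)" using y by (simp add: algebra_simps)
    then show ?case using l p_power_dvd_mult_iff[of n "y - of_int l"] by metis
  qed auto
  then show "x \<in> Zp p" by (simp add: Zp_def)
qed

section \<open>A basis of the Witt vectors over the \<open>p\<close>-adic integers\<close>

text \<open>The prime field has no type of its own here: F_p-linear combinations are written with
  integer coefficients, and vanishing of a coefficient becomes divisibility by p.\<close>

definition fp_spanning :: "'k set \<Rightarrow> bool" where
  "fp_spanning B \<longleftrightarrow> (\<forall>y. \<exists>m :: 'k \<Rightarrow> int. y = (\<Sum>x\<in>B. of_int (m x) * x))"

definition fp_independent :: "'k set \<Rightarrow> bool" where
  "fp_independent B \<longleftrightarrow> (\<forall>m. (\<Sum>x\<in>B. of_int (m x) * x) = 0 \<longrightarrow> (\<forall>x\<in>B. int p dvd m x))"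

lemma residue_basis:
  obtains B :: "'k set" where "fp_spanning B" "fp_independent B"
proof -
  have "fp_spanning UNIV"
    unfolding fp_spanning_def
  proof
    fix y :: 'k
    have "y = (\<Sum>x\<in>UNIV. of_int (if x = y then 1 else 0) * x)"
      by (simp add: if_distrib[of of_int] if_distrib[of "\<lambda>c. c * _"] cong: if_cong)
    then show "\<exists>m. y = (\<Sum>x\<in>UNIV. of_int (m x) * x)"
      by (rule exI[of _ "\<lambda>x. if x = y then 1 else 0"])
  qed
  then obtain B where B: "fp_spanning B" and min: "\<And>C. fp_spanning C \<Longrightarrow> card B \<le> card C"
    using ex_has_least_nat[of fp_spanning UNIV card] by blast
  have "int p dvd m x" if sum0: "(\<Sum>x\<in>B. of_int (m x) * x) = 0" and x: "x \<in> B" for m x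
  proof (rule ccontr)
    assume "\<not> int p dvd m x"
    then have "coprime (int p) (m x)" using prime by (simp add: prime_imp_coprime)
    then obtain u v where "u * int p + v * m x = 1" using bezout_int[of "int p" "m x"] by auto
    then have "(of_int (u * int p + v * m x) :: 'k) = 1" by simp
    then have v: "of_int v * of_int (m x) = (1::'k)"
      using of_int_k_eq_0_iff[of "int p"] by simp
    have "of_int (m x) * x = - (\<Sum>y\<in>B - {x}. of_int (m y) * y)"
      using sum0 x by (simp add: sum.remove[of B x] eq_neg_iff_add_eq_0)
    then have "of_int v * (of_int (m x) * x) = of_int v * - (\<Sum>y\<in>B - {x}. of_int (m y) * y)"
      by (rule arg_cong)
    then have xe: "x = (\<Sum>y\<in>B - {x}. of_int (- (v * m y)) * y)"
      using v by (simp add: mult.assoc[symmetric] sum_distrib_left sum_negf)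
    have "fp_spanning (B - {x})"
      unfolding fp_spanning_def
    proof
      fix y
      obtain l where "y = (\<Sum>z\<in>B. of_int (l z) * z)" using B by (auto simp: fp_spanning_def)
      also have "\<dots> = of_int (l x) * x + (\<Sum>z\<in>B - {x}. of_int (l z) * z)"
        using x by (simp add: sum.remove)
      also have "\<dots> = of_int (l x) * (\<Sum>z\<in>B - {x}. of_int (- (v * m z)) * z) + (\<Sum>z\<in>B - {x}. of_int (l z) * z)"
        using xe by (rule arg_cong)
      also have "\<dots> = (\<Sum>z\<in>B - {x}. of_int (l x * - (v * m z) + l z) * z)"
        by (simp add: sum_distrib_left sum.distrib algebra_simps sum_negf sum_subtractf)
      finally show "\<exists>l. y = (\<Sum>z\<in>B - {x}. of_int (l z) * z)"
        by (rule exI[of _ "\<lambda>z. l x * - (v * m z) + l z"])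
    qed
    from min[OF this] x show False
      by (metis card_Diff1_less finite leD)
  qed
  then have "fp_independent B" by (simp add: fp_independent_def)
  with B show thesis by (rule that)
qed

text \<open>Coefficient functions with values in 0, ..., p - 1 biject onto the residue field; count
  both sides.\<close>

lemma card_residue_basis:
  assumes span: "fp_spanning B" and indep: "fp_independent B"
  shows "card B = b"
proof -
  let ?f = "\<lambda>m. \<Sum>x\<in>B. of_nat (m x) * x"
  have "bij_betw ?f (B \<rightarrow>\<^sub>E {..<p}) UNIV"
    unfolding bij_betw_def
  proof
    show "inj_on ?f (B \<rightarrow>\<^sub>E {..<p})"
    proof (rule inj_onI)
      fix m l assume m: "m \<in> B \<rightarrow>\<^sub>E {..<p}" and l: "l \<in> B \<rightarrow>\<^sub>E {..<p}" and eq: "?f m = ?f l"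
      have "(\<Sum>x\<in>B. of_int (int (m x) - int (l x)) * x) = 0"
        using eq by (simp add: left_diff_distrib sum_subtractf)
      then have dvd: "int p dvd int (m x) - int (l x)" if "x \<in> B" for x
        using indep[unfolded fp_independent_def, rule_format, of "\<lambda>x. int (m x) - int (l x)"] that by blast
      show "m = l"
      proof (rule PiE_ext[OF m l])
        fix x assume x: "x \<in> B"
        then have "m x < p" "l x < p" using m l by (auto simp: PiE_iff)
        moreover have "int (m x) mod int p = int (l x) mod int p"
          using dvd[OF x] by (simp add: mod_eq_dvd_iff)
        ultimately show "m x = l x" by simp
      qed
    qed
    show "?f ` (B \<rightarrow>\<^sub>E {..<p}) = UNIV"
    proof (intro equalityI subsetI UNIV_I)
      fix y :: 'k
      obtain m where m: "y = (\<Sum>x\<in>B. of_int (m x) * x)" using span by (auto simp: fp_spanning_def)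
      define l where "l = restrict (\<lambda>x. nat (m x mod int p)) B"
      have "(of_int (m x) :: 'k) = of_nat (l x)" if "x \<in> B" for x
      proof -
        have "int (l x) = m x mod int p" using that p_gt_1 by (simp add: l_def)
        then have "int p dvd m x - int (l x)" by (metis dvd_minus_mod)
        then show ?thesis using of_int_k_eq_0_iff[of "m x - int (l x)"] by simp
      qed
      then have "y = ?f l" unfolding m by (intro sum.cong) auto
      moreover have "l \<in> B \<rightarrow>\<^sub>E {..<p}" using p_gt_1 by (auto simp: l_def nat_less_iff)
      ultimately show "y \<in> ?f ` (B \<rightarrow>\<^sub>E {..<p})" by blast
    qed
  qed
  then have "card (B \<rightarrow>\<^sub>E {..<p}) = CARD('k)" by (rule bij_betw_same_card)
  then have "p ^ card B = p ^ b" by (simp add: card_PiE card_k)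
  then show ?thesis using p_gt_1 by simp
qed

text \<open>Any lift of a residue basis works, as in Nakayama's lemma. Coordinates exist by p-adic
  digit expansion and completeness; they are unique because a relation can be divided by p
  indefinitely and the ring is separated.\<close>

lemma Zp_basis:
  obtains \<Xi> :: "'r set" and cf where "free_coeffs (Zp p) \<Xi> cf" "card \<Xi> = b"
proof -
  obtain B :: "'k set" where B: "fp_spanning B" "fp_independent B"
    using residue_basis by blast
  define lift where "lift = inv red"
  have red_lift: "red (lift x) = x" for x by (simp add: lift_def surj_f_inv_f[OF surj_red])
  then have inj_lift: "inj lift" by (metis injI)
  define \<Xi> where "\<Xi> = lift ` B"
  have fin: "finite \<Xi>" by (simp add: \<Xi>_def)
  have inj_red: "inj_on red \<Xi>" by (auto simp: \<Xi>_def inj_on_def red_lift)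
  have red_\<Xi>: "red ` \<Xi> = B" by (auto simp: \<Xi>_def red_lift image_image)
  have sum_\<Xi>: "(\<Sum>\<xi>\<in>\<Xi>. g (red \<xi>) * red \<xi>) = (\<Sum>x\<in>B. g x * x)" for g :: "'k \<Rightarrow> 'k"
    using sum.reindex[OF inj_red, of "\<lambda>x. g x * x"] by (simp add: red_\<Xi>)
  have Zp0: "(0::'r) \<in> Zp p" and Zp1: "(1::'r) \<in> Zp p" by (simp_all add: Zp_iff \<sigma>_hom)
  have Zp_add: "x + y \<in> Zp p" and Zp_mult: "x * y \<in> Zp p" and Zp_diff: "x - y \<in> Zp p"
    if "x \<in> Zp p" "y \<in> Zp p" for x y :: 'r using that by (simp_all add: Zp_iff \<sigma>_hom \<sigma>_diff)
  have "\<exists>d :: 'r \<Rightarrow> int. \<exists>y. x = (\<Sum>\<xi>\<in>\<Xi>. of_int (d \<xi>) * \<xi>) + of_nat p * y" for x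
  proof -
    obtain m where "red x = (\<Sum>z\<in>B. of_int (m z) * z)" using B(1) by (auto simp: fp_spanning_def)
    then have "red x = red (\<Sum>\<xi>\<in>\<Xi>. of_int (m (red \<xi>)) * \<xi>)"
      by (simp add: red_hom sum_\<Xi>[of "\<lambda>z. of_int (m z)"])
    then obtain y where "x - (\<Sum>\<xi>\<in>\<Xi>. of_int (m (red \<xi>)) * \<xi>) = of_nat p * y"
      unfolding red_eq_iff by (auto elim!: dvdE)
    then have "x = (\<Sum>\<xi>\<in>\<Xi>. of_int (m (red \<xi>)) * \<xi>) + of_nat p * y" by (simp add: algebra_simps)
    then show ?thesis by (intro exI[of _ "\<lambda>\<xi>. m (red \<xi>)"] exI[of _ y])
  qed
  then obtain d :: "'r \<Rightarrow> 'r \<Rightarrow> int" and \<rho> where d: "\<And>x. x = (\<Sum>\<xi>\<in>\<Xi>. of_int (d x \<xi>) * \<xi>) + of_nat p * \<rho> x"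
    by metis
  have exists: "\<exists>c. (\<forall>\<xi>\<in>\<Xi>. c \<xi> \<in> Zp p) \<and> (\<Sum>\<xi>\<in>\<Xi>. c \<xi> * \<xi>) = x" for x
  proof -
    \<comment> \<open>Partial sums of the digit expansion of the \<xi>-coordinate. The remainder
      after n digits is p^n times the n-th iterate of \<rho>.\<close>
    define s where "s \<xi> n = (\<Sum>i<n. int p ^ i * d ((\<rho> ^^ i) x) \<xi>)" for \<xi> n
    have s: "x = (\<Sum>\<xi>\<in>\<Xi>. of_int (s \<xi> n) * \<xi>) + of_nat p ^ n * (\<rho> ^^ n) x" for n
    proof (induction n)
      case (Suc n)
      have "of_nat p ^ n * (\<rho> ^^ n) x = (\<Sum>\<xi>\<in>\<Xi>. of_int (int p ^ n * d ((\<rho> ^^ n) x) \<xi>) * \<xi>) + of_nat p ^ Suc n * (\<rho> ^^ Suc n) x"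
        using arg_cong[OF d[of "(\<rho> ^^ n) x"], of "\<lambda>z. of_nat p ^ n * z"]
        by (simp add: distrib_left sum_distrib_left mult_ac)
      moreover have "(\<Sum>\<xi>\<in>\<Xi>. of_int (s \<xi> (Suc n)) * \<xi>) = (\<Sum>\<xi>\<in>\<Xi>. of_int (s \<xi> n) * \<xi>) + (\<Sum>\<xi>\<in>\<Xi>. of_int (int p ^ n * d ((\<rho> ^^ n) x) \<xi>) * \<xi>)"
        by (simp add: s_def distrib_right sum.distrib)
      ultimately show ?case using Suc.IH by (simp add: add.assoc)
    qed (simp add: s_def)
    have "\<exists>c. \<forall>n. of_nat p ^ n dvd c - (of_int (s \<xi> n) :: 'r)" for \<xi>
      by (rule complete) (simp add: s_def)
    then obtain c where c: "\<And>\<xi> n. of_nat p ^ n dvd c \<xi> - (of_int (s \<xi> n) :: 'r)" by metis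
    have "of_nat p ^ n dvd (\<Sum>\<xi>\<in>\<Xi>. c \<xi> * \<xi>) - x" for n
    proof -
      have "(\<Sum>\<xi>\<in>\<Xi>. c \<xi> * \<xi>) - x = (\<Sum>\<xi>\<in>\<Xi>. (c \<xi> - of_int (s \<xi> n)) * \<xi>) - of_nat p ^ n * (\<rho> ^^ n) x"
        by (subst (1) s[of n]) (simp add: left_diff_distrib sum_subtractf)
      then show ?thesis using c by (auto intro!: dvd_diff dvd_sum)
    qed
    then have "(\<Sum>\<xi>\<in>\<Xi>. c \<xi> * \<xi>) - x = 0" by (rule separated)
    then show ?thesis using c by (intro exI[of _ c]) (auto simp: Zp_def)
  qed
  \<comment> \<open>Reduced modulo p, the relation forces every coefficient to be divisible by p.
    The quotients are still fixed by \<sigma> and satisfy the same relation, so the argument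
    repeats.\<close>
  have zero: "of_nat p ^ n dvd c \<xi>" if "\<And>\<xi>. \<xi> \<in> \<Xi> \<Longrightarrow> c \<xi> \<in> Zp p" "(\<Sum>\<xi>\<in>\<Xi>. c \<xi> * \<xi>) = 0" "\<xi> \<in> \<Xi>" for c n \<xi>
    using that
  proof (induction n arbitrary: c \<xi>)
    case (Suc n)
    have "\<exists>m::int. of_nat p dvd c \<xi> - of_int m" if "\<xi> \<in> \<Xi>" for \<xi>
      using Suc.prems(1)[OF that] unfolding Zp_def mem_Collect_eq by (metis power_one_right)
    then obtain m :: "'r \<Rightarrow> int" where m: "\<And>\<xi>. \<xi> \<in> \<Xi> \<Longrightarrow> of_nat p dvd c \<xi> - of_int (m \<xi>)" by metis
    have redc: "red (c \<xi>) = of_int (m \<xi>)" if "\<xi> \<in> \<Xi>" for \<xi>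
      using m[OF that] red_eq_iff[of "c \<xi>" "of_int (m \<xi>)"] by simp
    have "0 = (\<Sum>\<xi>\<in>\<Xi>. red (c \<xi>) * red \<xi>)"
      using arg_cong[OF Suc.prems(2), of red] by (simp add: red_hom)
    also have "\<dots> = (\<Sum>\<xi>\<in>\<Xi>. of_int (m (lift (red \<xi>))) * red \<xi>)"
      by (intro sum.cong) (auto simp: redc, auto simp: \<Xi>_def red_lift)
    finally have "(\<Sum>x\<in>B. of_int (m (lift x)) * x) = 0"
      unfolding sum_\<Xi>[of "\<lambda>x. of_int (m (lift x))"] by simp
    then have "int p dvd m (lift x)" if "x \<in> B" for x using B(2)[unfolded fp_independent_def, rule_format, of "\<lambda>x. m (lift x)"] that by blast
    then have "of_nat p dvd c \<xi>" if "\<xi> \<in> \<Xi>" for \<xi>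
      using that redc[OF that] of_int_k_eq_0_iff[of "m \<xi>"] red_0_iff[of "c \<xi>"] by (auto simp: \<Xi>_def)
    then obtain c' where c': "\<And>\<xi>. \<xi> \<in> \<Xi> \<Longrightarrow> c \<xi> = of_nat p * c' \<xi>" unfolding dvd_def by metis
    have "c' \<xi> \<in> Zp p" if "\<xi> \<in> \<Xi>" for \<xi>
      using Suc.prems(1)[OF that] p_nz by (simp add: Zp_iff c'[OF that] \<sigma>_hom)
    moreover have "of_nat p * (\<Sum>\<xi>\<in>\<Xi>. c' \<xi> * \<xi>) = 0"
      using Suc.prems(2) by (simp add: sum_distrib_left mult.assoc[symmetric] c')
    ultimately have "of_nat p ^ n dvd c' \<xi>" using Suc.IH[of c' \<xi>] Suc.prems(3) p_nz by simp
    then show ?case using c'[OF Suc.prems(3)] by simp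
  qed simp
  have unique: "c \<xi> = c' \<xi>" if "\<And>\<xi>. \<xi> \<in> \<Xi> \<Longrightarrow> c \<xi> \<in> Zp p" "\<And>\<xi>. \<xi> \<in> \<Xi> \<Longrightarrow> c' \<xi> \<in> Zp p"
    "(\<Sum>\<xi>\<in>\<Xi>. c \<xi> * \<xi>) = (\<Sum>\<xi>\<in>\<Xi>. c' \<xi> * \<xi>)" "\<xi> \<in> \<Xi>" for c c' \<xi>
  proof -
    have "of_nat p ^ n dvd c \<xi> - c' \<xi>" for n
      by (rule zero[of "\<lambda>\<xi>. c \<xi> - c' \<xi>"]) (use that in \<open>auto intro: Zp_diff simp: left_diff_distrib sum_subtractf\<close>)
    then have "c \<xi> - c' \<xi> = 0" by (rule separated)
    then show ?thesis by simp
  qed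
  obtain cx where cx: "\<And>x \<xi>. \<xi> \<in> \<Xi> \<Longrightarrow> cx x \<xi> \<in> Zp p" "\<And>x. (\<Sum>\<xi>\<in>\<Xi>. cx x \<xi> * \<xi>) = x"
    using exists by metis
  \<comment> \<open>The coordinates come from a mere choice; \<open>unique\<close> makes them
    additive and linear.\<close>
  have "free_coeffs (Zp p) \<Xi> (\<lambda>\<xi> x. cx x \<xi>)"
  proof
    fix \<xi> x y assume \<xi>: "\<xi> \<in> \<Xi>"
    show "cx (x + y) \<xi> = cx x \<xi> + cx y \<xi>"
      by (rule unique[OF _ _ _ \<xi>]) (simp_all add: cx Zp_add distrib_right sum.distrib)
    show "cx (c * x) \<xi> = c * cx x \<xi>" if "c \<in> Zp p" for c
      by (rule unique[OF _ _ _ \<xi>]) (simp_all add: cx Zp_mult that mult.assoc flip: sum_distrib_left)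
    show "cx \<eta> \<xi> = (if \<xi> = \<eta> then 1 else 0)" if "\<eta> \<in> \<Xi>" for \<eta>
    proof (rule unique[OF _ _ _ \<xi>])
      show "(\<Sum>\<xi>\<in>\<Xi>. cx \<eta> \<xi> * \<xi>) = (\<Sum>\<xi>\<in>\<Xi>. (if \<xi> = \<eta> then 1 else 0) * \<xi>)"
        using that fin by (simp add: cx if_distrib[of "\<lambda>c. c * _"] cong: if_cong)
    qed (simp_all add: cx Zp0 Zp1)
  qed (simp_all add: fin Zp0 Zp1 Zp_add Zp_mult cx)
  moreover have "card \<Xi> = b"
    using card_residue_basis[OF B] by (simp add: \<Xi>_def card_image inj_on_subset[OF inj_lift])
  ultimately show thesis using that by blast
qed

section \<open>The inverse Frobenius and traces of twisted maps\<close>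

definition \<tau> :: "'r \<Rightarrow> 'r" where "\<tau> = inv \<sigma>"

lemma \<sigma>_\<tau> [simp]: "\<sigma> (\<tau> x) = x" and \<tau>_\<sigma> [simp]: "\<tau> (\<sigma> x) = x"
  using bij_\<sigma> by (simp_all add: \<tau>_def bij_is_surj surj_f_inv_f bij_is_inj)

lemma \<tau>_hom: "\<tau> 1 = 1" "\<tau> (x + y) = \<tau> x + \<tau> y" "\<tau> (x * y) = \<tau> x * \<tau> y"
  by (metis \<sigma>_\<tau> \<tau>_\<sigma> \<sigma>_hom)+

lemma ring_hom_\<tau>: "ring_hom_on \<tau>"
  by (simp add: ring_hom_on_def \<tau>_hom)

lemma \<tau>_fixed_iff: "\<tau> x = x \<longleftrightarrow> x \<in> Zp p"
  unfolding Zp_iff by (metis \<sigma>_\<tau> \<tau>_\<sigma>)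

lemma \<tau>_funpow_hom: "(\<tau> ^^ k) (x + y) = (\<tau> ^^ k) x + (\<tau> ^^ k) y" "(\<tau> ^^ k) (x * y) = (\<tau> ^^ k) x * (\<tau> ^^ k) y"
  by (induction k) (simp_all add: \<tau>_hom)

lemma \<tau>_funpow_Zp: "x \<in> Zp p \<Longrightarrow> (\<tau> ^^ k) x = x"
  by (induction k) (simp_all add: \<tau>_fixed_iff)

lemma \<tau>_\<sigma>_funpow: "(\<tau> ^^ k) ((\<sigma> ^^ k) x) = x" "(\<sigma> ^^ k) ((\<tau> ^^ k) x) = x"
proof -
  show "(\<tau> ^^ k) ((\<sigma> ^^ k) x) = x"
    by (induction k arbitrary: x) (simp_all add: funpow_swap1[of \<sigma>])
  show "(\<sigma> ^^ k) ((\<tau> ^^ k) x) = x"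
    by (induction k arbitrary: x) (simp_all add: funpow_swap1[of \<tau>])
qed

lemma \<tau>_funpow_b_mult: "(\<tau> ^^ (b * k)) x = x"
proof -
  have "(\<tau> ^^ b) x = x" for x using \<tau>_\<sigma>_funpow(1)[of b x] by (simp add: \<sigma>_funpow_b)
  then have "(\<tau> ^^ b) = id" by auto
  then show ?thesis by (simp add: funpow_mult[symmetric] mult.commute[of b]) (metis eq_id_iff funpow_mult id_funpow mult.commute)
qed

text \<open>Otherwise \<open>\<sigma> ^^ l\<close> would be trivial for l = k mod b, where 0 < l <
  b, and all q residues would be roots of Y^(p^l) - Y, whose degree is less than q.\<close>

lemma \<tau>_funpow_nontrivial:
  assumes "\<not> b dvd k"
  obtains x where "(\<tau> ^^ k) x \<noteq> x"
proof (rule ccontr)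
  assume "\<not> thesis"
  then have "(\<tau> ^^ k) x = x" for x using that by blast
  then have \<sigma>k: "(\<sigma> ^^ k) x = x" for x by (metis \<tau>_\<sigma>_funpow(1))
  define l where "l = k mod b"
  have l: "0 < l" "l < b" using assms b_pos by (auto simp: l_def mod_greater_zero_iff_not_dvd)
  have "(\<sigma> ^^ (b * j)) x = x" for j x
    by (induction j) (simp_all add: funpow_add \<sigma>_funpow_b)
  moreover have "k = l + b * (k div b)" by (simp add: l_def)
  ultimately have \<sigma>l: "(\<sigma> ^^ l) x = x" for x using \<sigma>k[of x] by (metis funpow_add comp_apply)
  have "y ^ (p ^ l) = y" for y :: 'k
  proof -
    obtain x where "y = red x" using surj_red by blast
    then show ?thesis using red_\<sigma>_funpow[of l x] \<sigma>l[of x] by simp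
  qed
  moreover have "p ^ l > 1" using one_less_power[OF p_gt_1 l(1)] .
  ultimately have "CARD('k) \<le> p ^ l"
    using card_power_fixpoints_le[of "p ^ l", where 'k = 'k] by simp
  then show False using card_k l p_gt_1 by simp
qed

text \<open>y is the product of the other conjugates of z, so that \<open>z * y\<close> is the norm.
  Since \<open>\<sigma> ^^ b\<close> is the identity, \<sigma> permutes the factors of the norm
  cyclically.\<close>

lemma norm_in_Zp:
  fixes z :: 'r
  assumes "z \<noteq> 0"
  obtains y where "z * y \<in> Zp p" "z * y \<noteq> 0"
proof -
  define N where "N = (\<Prod>i<b. (\<sigma> ^^ i) z)"
  obtain c where c: "b = Suc c" using b_pos by (cases b) auto
  have \<sigma>_prod: "\<sigma> (prod f A) = (\<Prod>i\<in>A. \<sigma> (f i))" for f :: "nat \<Rightarrow> 'r" and A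
    by (induction A rule: infinite_finite_induct) (simp_all add: \<sigma>_hom)
  have "\<sigma> N = (\<Prod>i<b. (\<sigma> ^^ Suc i) z)" by (simp add: N_def \<sigma>_prod)
  also have "\<dots> = (\<Prod>i<c. (\<sigma> ^^ Suc i) z) * z" using \<sigma>_funpow_b[of z] by (simp add: c)
  also have "\<dots> = N" by (simp add: N_def c prod.lessThan_Suc_shift mult.commute del: prod.lessThan_Suc)
  finally have "N \<in> Zp p" by (simp add: Zp_iff)
  moreover have "N = z * (\<Prod>i<c. (\<sigma> ^^ Suc i) z)"
    by (simp add: N_def c prod.lessThan_Suc_shift del: prod.lessThan_Suc)
  moreover have "(\<sigma> ^^ i) z \<noteq> 0" for i
    using assms by (induction i) (simp_all, metis \<sigma>_0 \<tau>_\<sigma>)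
  then have "N \<noteq> 0" by (simp add: N_def)
  ultimately show thesis using that by metis
qed

text \<open>
  If \<open>\<phi>(x) = y \<tau>\<^sup>k(x)\<close> and \<open>m\<^sub>c\<close> is multiplication by \<open>c\<close>, then \<open>\<phi> m\<^sub>c = m\<^bsub>\<tau>^k(c)\<^esub> \<phi>\<close>, so that
  \<open>m\<^sub>z \<phi>\<close> has trace zero for \<open>z = \<tau>\<^sup>k(c) - c\<close>. As \<open>y\<close> is arbitrary and a multiple of \<open>z\<close>
  lies in \<open>\<int>\<^sub>p\<close>, all traces vanish.
\<close>

lemma trace_twisted_eq_0:
  assumes "free_coeffs (Zp p) \<Xi> cf" "\<not> b dvd k"
  shows "free_coeffs.trace0 \<Xi> cf (\<lambda>x. y * (\<tau> ^^ k) x) = 0"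
proof -
  interpret free_coeffs "Zp p" \<Xi> cf by (rule assms(1))
  obtain c where c: "(\<tau> ^^ k) c \<noteq> c" using \<tau>_funpow_nontrivial[OF assms(2)] by metis
  define z where "z = (\<tau> ^^ k) c - c"
  have lin: "linear0 (\<lambda>x. y * (\<tau> ^^ k) x)" "linear0 (\<lambda>x. c * x)" for y c
    by (auto simp: linear0_def \<tau>_funpow_hom \<tau>_funpow_Zp algebra_simps)
  have z0: "trace0 (\<lambda>x. z * y * (\<tau> ^^ k) x) = 0" for y
  proof -
    have "trace0 (\<lambda>x. y * (\<tau> ^^ k) (c * x)) = trace0 (\<lambda>x. c * (y * (\<tau> ^^ k) x))"
      by (rule trace0_commute[OF lin])
    then have "(\<Sum>\<xi>\<in>\<Xi>. cf \<xi> (y * (\<tau> ^^ k) (c * \<xi>)) - cf \<xi> (c * (y * (\<tau> ^^ k) \<xi>))) = 0"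
      by (simp add: trace0_def sum_subtractf)
    moreover have "cf \<xi> (y * (\<tau> ^^ k) (c * \<xi>)) = cf \<xi> (z * y * (\<tau> ^^ k) \<xi>) + cf \<xi> (c * (y * (\<tau> ^^ k) \<xi>))"
      if "\<xi> \<in> \<Xi>" for \<xi>
      using cf_add[OF that, symmetric] by (simp add: z_def \<tau>_funpow_hom algebra_simps)
    ultimately show ?thesis by (simp add: trace0_def)
  qed
  obtain w where w: "z * w \<in> Zp p" "z * w \<noteq> 0" using norm_in_Zp[of z] c by (auto simp: z_def)
  have "(z * w) * trace0 (\<lambda>x. y * (\<tau> ^^ k) x) = trace0 (\<lambda>x. z * w * (y * (\<tau> ^^ k) x))"
    using trace0_cmult[OF w(1)] by simp
  also have "\<dots> = 0" using z0[of "w * y"] by (simp add: mult.assoc)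
  finally show ?thesis using w(2) by simp
qed

lemma trace_twisted_Zp:
  assumes "free_coeffs (Zp p) \<Xi> cf" "card \<Xi> = b" "y \<in> Zp p"
  shows "free_coeffs.trace0 \<Xi> cf (\<lambda>x. y * (\<tau> ^^ (b * k)) x) = of_nat b * y"
proof -
  interpret free_coeffs "Zp p" \<Xi> cf by (rule assms(1))
  show ?thesis using trace0_cmult[OF assms(3), of "\<lambda>x. x"] trace0_ident assms(2)
    by (simp add: \<tau>_funpow_b_mult mult.commute)
qed

end

section \<open>Orthonormal bases of \<open>B\<close>\<close>

lemma sum_fun_apply: "(\<Sum>i\<in>I. f i) x = (\<Sum>i\<in>I. f i x)"
  by (induction I rule: infinite_finite_induct) simp_all

definition series_scale :: "'r::idom fps \<Rightarrow> ('r, 'n::finite) series \<Rightarrow> ('r, 'n) series" where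
  "series_scale c g = (\<lambda>u. c * g u)"

lemma series_scale_apply [simp]: "series_scale c g u = c * g u"
  by (simp add: series_scale_def)

lemma module_series_scale: "module series_scale"
  by unfold_locales (simp_all add: series_scale_def fun_eq_iff distrib_left distrib_right mult.assoc)

lemma fps_X_power_dvd_iff_subdegree:
  fixes f :: "'r::idom fps"
  shows "fps_X ^ n dvd f \<longleftrightarrow> f = 0 \<or> n \<le> subdegree f"
proof (cases "f = 0")
  case False
  have "(\<forall>i<n. fps_nth f i = 0) \<longleftrightarrow> n \<le> subdegree f"
  proof
    assume "\<forall>i<n. fps_nth f i = 0"
    then show "n \<le> subdegree f" using False by (intro subdegree_geI) auto
  qed (simp add: nth_less_subdegree_zero)
  then show ?thesis using False by (simp add: fps_X_power_dvd_iff)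
qed simp

lemma ord_T_ge_iff:
  assumes "D > 0"
  shows "ereal (real n / real D) \<le> ord_T D f \<longleftrightarrow> fps_X ^ n dvd f"
  using assms by (auto simp: ord_T_def fps_X_power_dvd_iff_subdegree divide_le_cancel)

lemma ord_T_ge_real_iff:
  assumes "D > 0"
  shows "ereal N \<le> ord_T D f \<longleftrightarrow> fps_X ^ nat \<lceil>N * real D\<rceil> dvd f"
  using assms by (auto simp: ord_T_def fps_X_power_dvd_iff_subdegree pos_le_divide_eq nat_le_iff ceiling_le_iff)

lemma ord_T_shift:
  assumes "D > 0" "fps_X ^ n dvd f"
  shows "ord_T D (fps_shift n f) = ord_T D f - ereal (real n / real D)"
proof (cases "f = 0")
  case False
  then have "n \<le> subdegree f" using assms by (simp add: fps_X_power_dvd_iff_subdegree)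
  moreover have "fps_shift n f \<noteq> 0" using fps_X_power_mult_shift[OF assms(2)] False by auto
  ultimately show ?thesis using False assms(1)
    by (simp add: ord_T_def diff_divide_distrib of_nat_diff)
qed (simp add: ord_T_def)

section \<open>The module B in terms of divisibility by powers of \<open>fps_X\<close>\<close>

context lattice_polytope
begin

abbreviation M :: "(int ^ 'n) set" where "M \<equiv> cone_lattice \<Delta>"

text \<open>Removes the choice of \<open>c\<close> from the definition. Since only finitely many
  exponents have bounded degree, tending to 0 with growing degree means that each bound fails at
  finitely many u only.\<close>

lemma B_module_iff:
  fixes g :: "('r::idom, 'n) series"
  shows "g \<in> B_module \<Delta> \<longleftrightarrow> (\<forall>u. u \<notin> M \<longrightarrow> g u = 0) \<and> (\<forall>u\<in>M. fps_X ^ wt u dvd g u) \<and>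
    (\<forall>n. finite {u \<in> M. \<not> fps_X ^ (n + wt u) dvd g u})" (is "_ \<longleftrightarrow> ?R")
proof
  assume "g \<in> B_module \<Delta>"
  then obtain c where g: "g = weighted \<Delta> c" and
    c: "\<And>N. \<exists>K. \<forall>u\<in>M. deg \<Delta> u \<ge> K \<longrightarrow> ord_T (denom \<Delta>) (c u) \<ge> ereal N"
    unfolding B_module_def by blast
  have gu: "g u = (if u \<in> M then fps_X ^ wt u * c u else 0)" for u
    by (simp add: g weighted_def pi_deg_eq mult.commute)
  have "finite {u \<in> M. \<not> fps_X ^ (n + wt u) dvd g u}" for n
  proof -
    obtain K where K: "\<And>u. u \<in> M \<Longrightarrow> deg \<Delta> u \<ge> K \<Longrightarrow> ord_T (denom \<Delta>) (c u) \<ge> ereal (real n / real (denom \<Delta>))"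
      using c by blast
    have "deg \<Delta> u \<le> K" if "u \<in> M" "\<not> fps_X ^ (n + wt u) dvd g u" for u
    proof (rule ccontr)
      assume "\<not> deg \<Delta> u \<le> K"
      then have "fps_X ^ n dvd c u" using K[OF that(1)] by (simp add: ord_T_ge_iff[OF denom_pos])
      then have "fps_X ^ (n + wt u) dvd g u" using that(1) by (simp add: gu power_add mult_dvd_mono mult.commute)
      with that show False by simp
    qed
    then show ?thesis by (intro finite_subset[OF _ finite_deg_le[of K]]) auto
  qed
  then show ?R by (auto simp: gu)
next
  assume R: ?R
  define c where "c u = fps_shift (wt u) (g u)" for u
  have gu: "fps_X ^ wt u * c u = g u" if "u \<in> M" for u
    unfolding c_def using R that by (intro fps_X_power_mult_shift) auto
  have "g = weighted \<Delta> c"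
    using R by (auto simp: fun_eq_iff weighted_def pi_deg_eq gu mult.commute[of _ "fps_X ^ _"])
  moreover have "\<exists>K. \<forall>u\<in>M. deg \<Delta> u \<ge> K \<longrightarrow> ord_T (denom \<Delta>) (c u) \<ge> ereal N" for N
  proof -
    let ?n = "nat \<lceil>N * real (denom \<Delta>)\<rceil>"
    let ?S = "{u \<in> M. \<not> fps_X ^ (?n + wt u) dvd g u}"
    have fin: "finite ?S" using R by blast
    then obtain K where K: "\<And>u. u \<in> ?S \<Longrightarrow> deg \<Delta> u < K"
      using finite_imageI[OF fin, of "deg \<Delta>"] by (metis (no_types, lifting) Max_ge image_eqI less_add_one order.strict_trans1)
    have "ord_T (denom \<Delta>) (c u) \<ge> ereal N" if "u \<in> M" "deg \<Delta> u \<ge> K" for u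
    proof -
      have "fps_X ^ (?n + wt u) dvd g u" using K[of u] that by auto
      then have "fps_X ^ ?n dvd c u"
        unfolding c_def using R that(1) by (subst fps_X_power_dvd_shift_iff) auto
      then show ?thesis by (simp add: ord_T_ge_real_iff[OF denom_pos])
    qed
    then show ?thesis by blast
  qed
  ultimately show "g \<in> B_module \<Delta>" unfolding B_module_def by blast
qed

lemma B_moduleD:
  assumes "g \<in> B_module \<Delta>"
  shows "u \<notin> M \<Longrightarrow> g u = 0" "u \<in> M \<Longrightarrow> fps_X ^ wt u dvd g u" "finite {u \<in> M. \<not> fps_X ^ (n + wt u) dvd g u}"
  using assms unfolding B_module_iff by blast+

text \<open>The ball in which \<open>ord_B\<close> is at least n/D, so that the norm is measured in
  steps of 1/D.\<close>

definition small :: "nat \<Rightarrow> ('r::idom, 'n) series \<Rightarrow> bool" where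
  "small n g \<longleftrightarrow> (\<forall>u\<in>M. fps_X ^ (n + wt u) dvd g u)"

lemma small_add: "small n g \<Longrightarrow> small n h \<Longrightarrow> small n (g + h)"
  and small_scale: "small n g \<Longrightarrow> small n (series_scale c g)"
  by (auto simp: small_def)

lemma small_scale': "g \<in> B_module \<Delta> \<Longrightarrow> fps_X ^ n dvd c \<Longrightarrow> small n (series_scale c g)"
  by (auto simp: small_def power_add dest: B_moduleD(2) intro: mult_dvd_mono)

lemma small_sum: "(\<And>i. i \<in> I \<Longrightarrow> small n (g i)) \<Longrightarrow> small n (sum g I)"
  by (induction I rule: infinite_finite_induct) (auto simp: small_def)

lemma ord_B_ge_iff: "ereal (real n / real (denom \<Delta>)) \<le> ord_B \<Delta> g \<longleftrightarrow> small n g"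
proof -
  have "ereal (real n / real (denom \<Delta>)) \<le> ord_T (denom \<Delta>) (g u) - ereal (deg \<Delta> u)
      \<longleftrightarrow> ereal (real (n + wt u) / real (denom \<Delta>)) \<le> ord_T (denom \<Delta>) (g u)" if "u \<in> M" for u
    using deg_eq[OF that] by (cases "ord_T (denom \<Delta>) (g u)") (auto simp: add_divide_distrib)
  then show ?thesis
    unfolding ord_B_def le_INF_iff small_def ord_T_ge_iff[OF denom_pos, symmetric] by blast
qed

text \<open>Within B the ball is the multiple of B by \<open>fps_X ^ n\<close>. This turns norm
  convergence as in \<open>coords\<close> into the congruence \<open>veq\<close>.\<close>

lemma B_module_small:
  assumes "g \<in> B_module \<Delta>" "small n g"
  obtains k where "k \<in> B_module \<Delta>" "g = series_scale (fps_X ^ n) k"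
proof
  let ?k = "\<lambda>u. fps_shift n (g u)"
  have dvd: "fps_X ^ n dvd g u" for u
    using assms by (cases "u \<in> M") (auto simp: small_def power_add B_moduleD(1) dest!: bspec dest: dvd_mult_left)
  have iff: "fps_X ^ (m + wt u) dvd ?k u \<longleftrightarrow> fps_X ^ ((m + n) + wt u) dvd g u" for m u
    by (simp add: fps_X_power_dvd_shift_iff[OF dvd] add_ac)
  show "?k \<in> B_module \<Delta>"
    unfolding B_module_iff
  proof (intro conjI allI impI ballI)
    show "?k u = 0" if "u \<notin> M" for u using B_moduleD(1)[OF assms(1) that] by simp
    show "fps_X ^ wt u dvd ?k u" if "u \<in> M" for u
      using iff[of 0 u] assms(2) that by (simp add: small_def)
    show "finite {u \<in> M. \<not> fps_X ^ (m + wt u) dvd ?k u}" for m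
      unfolding iff by (rule B_moduleD(3)[OF assms(1)])
  qed
  show "g = series_scale (fps_X ^ n) ?k"
    by (simp add: fun_eq_iff fps_X_power_mult_shift[OF dvd])
qed

lemma B_module_0: "0 \<in> B_module \<Delta>"
  by (simp add: B_module_iff)

lemma B_module_add:
  assumes "g \<in> B_module \<Delta>" "h \<in> B_module \<Delta>"
  shows "g + h \<in> B_module \<Delta>"
  unfolding B_module_iff
proof (intro conjI allI impI ballI)
  fix n
  have "{u \<in> M. \<not> fps_X ^ (n + wt u) dvd (g + h) u} \<subseteq>
    {u \<in> M. \<not> fps_X ^ (n + wt u) dvd g u} \<union> {u \<in> M. \<not> fps_X ^ (n + wt u) dvd h u}" by auto
  then show "finite {u \<in> M. \<not> fps_X ^ (n + wt u) dvd (g + h) u}"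
    using finite_subset B_moduleD(3)[OF assms(1)] B_moduleD(3)[OF assms(2)] by blast
qed (use assms in \<open>auto simp: B_moduleD(1,2)\<close>)

lemma B_module_scale:
  assumes "g \<in> B_module \<Delta>"
  shows "series_scale c g \<in> B_module \<Delta>"
  unfolding B_module_iff
proof (intro conjI allI impI ballI)
  fix n
  have "{u \<in> M. \<not> fps_X ^ (n + wt u) dvd series_scale c g u} \<subseteq> {u \<in> M. \<not> fps_X ^ (n + wt u) dvd g u}"
    by auto
  then show "finite {u \<in> M. \<not> fps_X ^ (n + wt u) dvd series_scale c g u}"
    using finite_subset B_moduleD(3)[OF assms] by blast
qed (use assms in \<open>auto simp: B_moduleD(1,2)\<close>)

lemma B_module_diff:
  assumes "g \<in> B_module \<Delta>" "h \<in> B_module \<Delta>"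
  shows "g - h \<in> B_module \<Delta>"
proof -
  have "g - h = g + series_scale (-1) h" by (simp add: fun_eq_iff)
  then show ?thesis using assms B_module_add B_module_scale by metis
qed

lemma ord_T_less_iff: "ord_T (denom \<Delta>) f < ereal N \<longleftrightarrow> \<not> fps_X ^ nat \<lceil>N * real (denom \<Delta>)\<rceil> dvd f"
  using ord_T_ge_real_iff[OF denom_pos] by (simp add: not_le[symmetric])

text \<open>The real thresholds N are rounded up to nonnegative multiples of 1/D.\<close>

lemma coords_iff:
  "coords \<Delta> R E c g \<longleftrightarrow> (\<forall>e\<in>E. c e \<in> R) \<and> (\<forall>e. e \<notin> E \<longrightarrow> c e = 0) \<and> null_family c E \<and>
    (\<forall>n. \<forall>\<^sub>F F in finite_subsets_at_top E. small n (g - (\<Sum>e\<in>F. series_scale (c e) e)))"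
proof -
  have "(\<forall>N::real. finite {e \<in> E. ord_T (denom \<Delta>) (c e) < ereal N}) \<longleftrightarrow> null_family c E"
  proof
    assume fin: "\<forall>N::real. finite {e \<in> E. ord_T (denom \<Delta>) (c e) < ereal N}"
    have "finite {e \<in> E. \<not> fps_X ^ n dvd c e}" for n
      using fin[rule_format, of "real n / real (denom \<Delta>)"] denom_pos by (simp add: ord_T_less_iff)
    then show "null_family c E" by (simp add: null_family_def)
  qed (simp add: ord_T_less_iff null_family_def)
  moreover have "(\<forall>N::real. \<forall>\<^sub>F F in finite_subsets_at_top E. ord_B \<Delta> (\<lambda>u. g u - (\<Sum>e\<in>F. c e * e u)) \<ge> ereal N)
    \<longleftrightarrow> (\<forall>n. \<forall>\<^sub>F F in finite_subsets_at_top E. small n (g - (\<Sum>e\<in>F. series_scale (c e) e)))"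
    (is "?l \<longleftrightarrow> ?r")
  proof -
    have eq: "(\<lambda>u. g u - (\<Sum>e\<in>F. c e * e u)) = g - (\<Sum>e\<in>F. series_scale (c e) e)" for F
      by (simp add: fun_eq_iff sum_fun_apply)
    show ?thesis
      unfolding eq
    proof
      assume l: "\<forall>N::real. \<forall>\<^sub>F F in finite_subsets_at_top E. ereal N \<le> ord_B \<Delta> (g - (\<Sum>e\<in>F. series_scale (c e) e))"
      show "\<forall>n. \<forall>\<^sub>F F in finite_subsets_at_top E. small n (g - (\<Sum>e\<in>F. series_scale (c e) e))"
        unfolding ord_B_ge_iff[symmetric] using l by blast
    next
      assume r: "\<forall>n. \<forall>\<^sub>F F in finite_subsets_at_top E. small n (g - (\<Sum>e\<in>F. series_scale (c e) e))"
      show "\<forall>N::real. \<forall>\<^sub>F F in finite_subsets_at_top E. ereal N \<le> ord_B \<Delta> (g - (\<Sum>e\<in>F. series_scale (c e) e))"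
      proof
        fix N :: real
        let ?n = "nat \<lceil>N * real (denom \<Delta>)\<rceil>"
        have "N * real (denom \<Delta>) \<le> real ?n" by linarith
        then have "N \<le> real ?n / real (denom \<Delta>)" using denom_pos by (simp add: pos_le_divide_eq)
        then have "ereal N \<le> ord_B \<Delta> h" if "small ?n h" for h :: "('a, 'n) series"
          using that unfolding ord_B_ge_iff[symmetric] by (meson ereal_less_eq(3) order.trans)
        then show "\<forall>\<^sub>F F in finite_subsets_at_top E. ereal N \<le> ord_B \<Delta> (g - (\<Sum>e\<in>F. series_scale (c e) e))"
          by (rule eventually_mono[OF r[rule_format, of ?n]])
      qed
    qed
  qed
  ultimately show ?thesis unfolding coords_def by simp
qed

lemma coords_add:
  assumes "coords \<Delta> R E c g" "coords \<Delta> R E d h" "\<And>x y. x \<in> R \<Longrightarrow> y \<in> R \<Longrightarrow> x + y \<in> R"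
  shows "coords \<Delta> R E (\<lambda>e. c e + d e) (g + h)"
  unfolding coords_iff
proof (intro conjI allI ballI impI)
  note cd = assms(1,2)[unfolded coords_iff]
  show "c e + d e \<in> R" if "e \<in> E" for e by (rule assms(3)) (use cd that in blast)+
  show "c e + d e = 0" if "e \<notin> E" for e using cd that by simp
  show "null_family (\<lambda>e. c e + d e) E" by (rule null_family_add) (use cd in blast)+
  fix n
  have "\<forall>\<^sub>F F in finite_subsets_at_top E. small n (g - (\<Sum>e\<in>F. series_scale (c e) e))"
    "\<forall>\<^sub>F F in finite_subsets_at_top E. small n (h - (\<Sum>e\<in>F. series_scale (d e) e))"
    using cd by blast+
  then show "\<forall>\<^sub>F F in finite_subsets_at_top E. small n (g + h - (\<Sum>e\<in>F. series_scale (c e + d e) e))"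
  proof eventually_elim
    case (elim F)
    have "(\<Sum>e\<in>F. series_scale (c e + d e) e) = (\<Sum>e\<in>F. series_scale (c e) e) + (\<Sum>e\<in>F. series_scale (d e) e)"
      by (simp add: fun_eq_iff sum_fun_apply distrib_right sum.distrib)
    then have "g + h - (\<Sum>e\<in>F. series_scale (c e + d e) e) =
      (g - (\<Sum>e\<in>F. series_scale (c e) e)) + (h - (\<Sum>e\<in>F. series_scale (d e) e))" by simp
    then show ?case by (simp only: small_add[OF elim])
  qed
qed

lemma coords_scale:
  assumes "coords \<Delta> R E c g" "r \<in> R" "\<And>x y. x \<in> R \<Longrightarrow> y \<in> R \<Longrightarrow> x * y \<in> R"
  shows "coords \<Delta> R E (\<lambda>e. r * c e) (series_scale r g)"
  unfolding coords_iff
proof (intro conjI allI ballI impI)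
  note c = assms(1)[unfolded coords_iff]
  show "r * c e \<in> R" if "e \<in> E" for e by (rule assms(3)[OF assms(2)]) (use c that in blast)
  show "r * c e = 0" if "e \<notin> E" for e using c that by simp
  show "null_family (\<lambda>e. r * c e) E" by (rule null_family_mono[of c]) (use c in simp_all)
  fix n
  have "\<forall>\<^sub>F F in finite_subsets_at_top E. small n (g - (\<Sum>e\<in>F. series_scale (c e) e))"
    using c by blast
  then show "\<forall>\<^sub>F F in finite_subsets_at_top E. small n (series_scale r g - (\<Sum>e\<in>F. series_scale (r * c e) e))"
  proof eventually_elim
    case (elim F)
    have "series_scale r g - (\<Sum>e\<in>F. series_scale (r * c e) e) = series_scale r (g - (\<Sum>e\<in>F. series_scale (c e) e))"
      by (rule ext) (simp add: sum_fun_apply right_diff_distrib sum_distrib_left mult.assoc)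
    then show ?case by (simp only: small_scale[OF elim])
  qed
qed

lemma coords_basis:
  assumes "e \<in> E" "0 \<in> R" "1 \<in> R"
  shows "coords \<Delta> R E (\<lambda>x. if x = e then 1 else 0) e"
  unfolding coords_iff
proof (intro conjI allI ballI impI)
  show "null_family (\<lambda>x. if x = e then 1 else 0) E"
    unfolding null_family_def by (rule allI, rule finite_subset[of _ "{e}"]) auto
  fix n
  show "\<forall>\<^sub>F F in finite_subsets_at_top E. small n (e - (\<Sum>x\<in>F. series_scale (if x = e then 1 else 0) x))"
    unfolding eventually_finite_subsets_at_top
  proof (intro exI[of _ "{e}"] conjI allI impI)
    fix F assume F: "finite F \<and> {e} \<subseteq> F \<and> F \<subseteq> E"
    have "(\<Sum>x\<in>F. series_scale (if x = e then 1 else 0) x) = (\<Sum>x\<in>F. if x = e then x else 0)"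
      by (intro sum.cong) (auto simp: fun_eq_iff)
    then have "e - (\<Sum>x\<in>F. series_scale (if x = e then 1 else 0) x) = 0" using F by simp
    then show "small n (e - (\<Sum>x\<in>F. series_scale (if x = e then 1 else 0) x))" by (simp add: small_def)
  qed (use assms in auto)
qed (use assms in auto)

text \<open>Uniqueness of coordinates makes them additive and R-linear, so the definite description
  behaves like a coordinate map.\<close>

lemma orthonormal_basis_fps_basis:
  fixes R :: "'r::idom fps set" and E :: "('r, 'n) series set"
  assumes R: "fps_module series_scale (B_module \<Delta>) R"
    and E: "orthonormal_basis \<Delta> R E"
  shows "fps_basis series_scale (B_module \<Delta>) R E (\<lambda>g. THE c. coords \<Delta> R E c g)"
proof -
  interpret fps_module series_scale "B_module \<Delta>" R by (rule R)
  let ?\<kappa> = "\<lambda>g. THE c. coords \<Delta> R E c g"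
  have EB: "e \<in> B_module \<Delta>" if "e \<in> E" for e using E that by (auto simp: orthonormal_basis_def)
  have ex1: "\<exists>!c. coords \<Delta> R E c g" if "g \<in> B_module \<Delta>" for g :: "('r, 'n) series"
    using E that by (auto simp: orthonormal_basis_def)
  have \<kappa>: "coords \<Delta> R E (?\<kappa> g) g" if "g \<in> B_module \<Delta>" for g :: "('r, 'n) series"
    using theI'[OF ex1[OF that]] .
  have \<kappa>_eq: "?\<kappa> g = c" if "g \<in> B_module \<Delta>" "coords \<Delta> R E c g" for g :: "('r, 'n) series" and c
    by (rule the1_equality[OF ex1[OF that(1)]]) (rule that(2))
  have R_1: "1 \<in> R" using R_X[of 0] by simp
  show ?thesis
  proof
    fix e assume e: "e \<in> E"
    show "e \<in> B_module \<Delta>" using EB[OF e] .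
    fix g :: "('r, 'n) series" assume g: "g \<in> B_module \<Delta>"
    show "?\<kappa> g e \<in> R" using \<kappa>[OF g] e by (auto simp: coords_iff)
    show "?\<kappa> (g + h) e = ?\<kappa> g e + ?\<kappa> h e" if h: "h \<in> B_module \<Delta>" for h :: "('r, 'n) series"
      using \<kappa>_eq[OF B_module_add[OF g h] coords_add[OF \<kappa>[OF g] \<kappa>[OF h] R_add]] by (rule fun_cong)
    show "?\<kappa> (series_scale c g) e = c * ?\<kappa> g e" if c: "c \<in> R" for c
      using \<kappa>_eq[OF B_module_scale[OF g] coords_scale[OF \<kappa>[OF g] c R_mult]] by (rule fun_cong)
  next
    fix g :: "('r, 'n) series" assume g: "g \<in> B_module \<Delta>"
    show "null_family (?\<kappa> g) E" using \<kappa>[OF g] by (simp add: coords_iff)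
  next
    fix e e' assume e: "e \<in> E" "e' \<in> E"
    show "?\<kappa> e e' = (if e = e' then 1 else 0)"
      using fun_cong[OF \<kappa>_eq[OF EB[OF e(1)] coords_basis[OF e(1) R_0 R_1]], of e'] by simp
  next
    fix g :: "('r, 'n) series" and F n assume g: "g \<in> B_module \<Delta>" and F: "finite F" "F \<subseteq> E"
      and dvd: "\<And>e. e \<in> E - F \<Longrightarrow> fps_X ^ n dvd ?\<kappa> g e"
    let ?s = "\<lambda>F. \<Sum>e\<in>F. series_scale (?\<kappa> g e) e"
    have "\<forall>\<^sub>F F in finite_subsets_at_top E. small n (g - ?s F)"
      using \<kappa>[OF g] by (simp add: coords_iff)
    then obtain X where X: "finite X \<and> X \<subseteq> E \<and> (\<forall>Y. finite Y \<and> X \<subseteq> Y \<and> Y \<subseteq> E \<longrightarrow> small n (g - ?s Y))"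
      unfolding eventually_finite_subsets_at_top ..
    \<comment> \<open>Convergence controls only sums over sets containing X. The terms of X outside
      F are removed afterwards; they are small because their coefficients are divisible by
      \<open>fps_X ^ n\<close>.\<close>
    have "small n (g - ?s (X \<union> F))"
      by (rule X[THEN conjunct2, THEN conjunct2, rule_format]) (use X F in simp)
    moreover have "small n (?s ((X \<union> F) - F))"
      using X F by (intro small_sum small_scale' EB dvd) auto
    ultimately have "small n ((g - ?s (X \<union> F)) + ?s ((X \<union> F) - F))" by (rule small_add)
    also have "(g - ?s (X \<union> F)) + ?s ((X \<union> F) - F) = g - ?s F"
      using X F by (simp add: sum_diff)
    finally have "small n (g - ?s F)" .
    moreover have "g - ?s F \<in> B_module \<Delta>"
      using F by (intro B_module_diff g V_sum B_module_scale EB) auto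
    ultimately obtain k where k: "k \<in> B_module \<Delta>" "g - ?s F = series_scale (fps_X ^ n) k"
      using B_module_small by blast
    have "g = ?s F + series_scale (fps_X ^ n) k" unfolding k(2)[symmetric] by simp
    then show "veq n g (?s F)" unfolding veq_def using k(1) by blast
  qed
qed

end

section \<open>The standard orthonormal basis over either ground ring\<close>

locale polytope_coeffs = lattice_polytope \<Delta> + free_coeffs R0 \<Xi> cf
  for \<Delta> :: "(real ^ 'n) set" and R0 :: "'r::idom set" and \<Xi> cf
begin

definition R :: "'r fps set" where "R = {f. \<forall>i. fps_nth f i \<in> R0}"

lemma R0_sum: "(\<And>i. i \<in> I \<Longrightarrow> f i \<in> R0) \<Longrightarrow> sum f I \<in> R0"
  by (induction I rule: infinite_finite_induct) (auto intro: R0_0 R0_add)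

lemma fps_module_R: "fps_module series_scale (B_module \<Delta> :: ('r, 'n) series set) R"
proof -
  interpret module "series_scale :: 'r fps \<Rightarrow> ('r, 'n) series \<Rightarrow> ('r, 'n) series" by (rule module_series_scale)
  show ?thesis
  proof
    show "c * d \<in> R" if "c \<in> R" "d \<in> R" for c d
      using that by (auto simp: R_def fps_mult_nth intro!: R0_sum R0_mult)
    show "fps_X ^ n \<in> R" for n by (auto simp: R_def fps_X_power_nth R0_0 R0_1)
  qed (auto simp: R_def R0_0 R0_add intro: B_module_0 B_module_add B_module_scale)
qed

text \<open>The vector \<xi> \<pi>^{deg(u)} x^u; over a subring of the coefficients the monomials
  alone would not span.\<close>

definition bvec :: "'r \<Rightarrow> int ^ 'n \<Rightarrow> ('r, 'n) series" where
  "bvec \<xi> u = (\<lambda>w. if w = u then fps_const \<xi> * fps_X ^ wt u else 0)"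

definition std :: "('r, 'n) series set" where
  "std = (\<lambda>(\<xi>, u). bvec \<xi> u) ` (\<Xi> \<times> M)"

lemma stdE:
  assumes "e \<in> std"
  obtains \<xi> u where "\<xi> \<in> \<Xi>" "u \<in> M" "e = bvec \<xi> u"
  using assms by (auto simp: std_def)

lemma bvec_in_std: "\<xi> \<in> \<Xi> \<Longrightarrow> u \<in> M \<Longrightarrow> bvec \<xi> u \<in> std"
  by (auto simp: std_def)

lemma basis_nz: "\<xi> \<in> \<Xi> \<Longrightarrow> \<xi> \<noteq> 0"
  using cf_basis[of \<xi> \<xi>] cf_0[of \<xi>] by auto

lemma bvec_eq_iff:
  assumes "\<xi> \<in> \<Xi>" "\<eta> \<in> \<Xi>"
  shows "bvec \<xi> u = bvec \<eta> v \<longleftrightarrow> \<xi> = \<eta> \<and> u = v"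
proof
  assume eq: "bvec \<xi> u = bvec \<eta> v"
  have "u = v"
  proof (rule ccontr)
    assume "u \<noteq> v"
    then have "fps_const \<xi> * fps_X ^ wt u = 0" using fun_cong[OF eq, of u] by (simp add: bvec_def)
    then show False using basis_nz[OF assms(1)] by simp
  qed
  moreover from this have "fps_const \<xi> * fps_X ^ wt u = fps_const \<eta> * fps_X ^ wt u"
    using fun_cong[OF eq, of u] by (simp add: bvec_def)
  then have "fps_const \<xi> = fps_const \<eta>" by simp
  then have "fps_nth (fps_const \<xi>) 0 = fps_nth (fps_const \<eta>) 0" by simp
  then have "\<xi> = \<eta>" by simp
  ultimately show "\<xi> = \<eta> \<and> u = v" by simp
qed simp

lemma inj_bvec: "inj_on (\<lambda>(\<xi>, u). bvec \<xi> u) (\<Xi> \<times> M)"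
  by (auto simp: inj_on_def bvec_eq_iff)

lemma bvec_in_B: "u \<in> M \<Longrightarrow> bvec \<xi> u \<in> B_module \<Delta>"
  unfolding B_module_iff
proof (intro conjI allI impI ballI)
  fix n
  show "finite {w \<in> M. \<not> fps_X ^ (n + wt w) dvd bvec \<xi> u w}"
    by (rule finite_subset[of _ "{u}"]) (auto simp: bvec_def)
qed (auto simp: bvec_def)

lemma std_subset_B: "std \<subseteq> B_module \<Delta>"
  by (auto simp: std_def bvec_in_B)

definition coord_at :: "('r, 'n) series \<Rightarrow> 'r \<Rightarrow> int ^ 'n \<Rightarrow> 'r fps" where
  "coord_at g \<xi> u = fps_map (cf \<xi>) (fps_shift (wt u) (g u))"

text \<open>Bases index themselves, so the pair of \<xi> and u is recovered from the vector e. The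
  value 0 off \<open>std\<close> is what \<open>coords\<close> demands.\<close>

definition std_coord :: "('r, 'n) series \<Rightarrow> ('r, 'n) series \<Rightarrow> 'r fps" where
  "std_coord g e = (if e \<in> std then
     case inv_into (\<Xi> \<times> M) (\<lambda>(\<xi>, u). bvec \<xi> u) e of (\<xi>, u) \<Rightarrow> coord_at g \<xi> u else 0)"

lemma std_coord_bvec: "\<xi> \<in> \<Xi> \<Longrightarrow> u \<in> M \<Longrightarrow> std_coord g (bvec \<xi> u) = coord_at g \<xi> u"
  using inv_into_f_f[OF inj_bvec, of "(\<xi>, u)"] by (auto simp: std_coord_def std_def)

lemma coord_at_expand: "(\<Sum>\<xi>\<in>\<Xi>. coord_at g \<xi> u * fps_const \<xi>) = fps_shift (wt u) (g u)"
  by (rule fps_ext) (simp add: coord_at_def fps_sum_nth fps_mult_right_const_nth cf_expand)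

lemma coord_at_dvd:
  assumes "g \<in> B_module \<Delta>" "\<xi> \<in> \<Xi>" "u \<in> M" "fps_X ^ (n + wt u) dvd g u"
  shows "fps_X ^ n dvd coord_at g \<xi> u"
  unfolding coord_at_def using assms B_moduleD(2)[OF assms(1,3)]
  by (intro fps_X_power_dvd_map cf_0) (auto simp: fps_X_power_dvd_shift_iff)

lemma sum_std:
  assumes "finite F" "F \<subseteq> std" "(\<lambda>\<xi>. bvec \<xi> u) ` \<Xi> \<subseteq> F"
  shows "(\<Sum>e\<in>F. series_scale (c e) e) u = fps_X ^ wt u * (\<Sum>\<xi>\<in>\<Xi>. c (bvec \<xi> u) * fps_const \<xi>)"
proof -
  have "(\<Sum>e\<in>F. series_scale (c e) e) u = (\<Sum>e\<in>F. c e * e u)" by (simp add: sum_fun_apply)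
  also have "\<dots> = (\<Sum>e\<in>(\<lambda>\<xi>. bvec \<xi> u) ` \<Xi>. c e * e u)"
  proof (rule sum.mono_neutral_right[OF assms(1,3)])
    show "\<forall>e\<in>F - (\<lambda>\<xi>. bvec \<xi> u) ` \<Xi>. c e * e u = 0"
    proof
      fix e assume e: "e \<in> F - (\<lambda>\<xi>. bvec \<xi> u) ` \<Xi>"
      then have "e \<in> std" using assms(2) by blast
      then obtain \<xi> v where "\<xi> \<in> \<Xi>" "e = bvec \<xi> v" by (rule stdE)
      moreover from this have "v \<noteq> u" using e by auto
      ultimately show "c e * e u = 0" by (simp add: bvec_def)
    qed
  qed
  also have "\<dots> = (\<Sum>\<xi>\<in>\<Xi>. c (bvec \<xi> u) * bvec \<xi> u u)"
    by (subst sum.reindex) (auto simp: inj_on_def bvec_eq_iff)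
  finally show ?thesis by (simp add: bvec_def sum_distrib_left mult_ac)
qed

lemma coords_std:
  assumes g: "g \<in> B_module \<Delta>"
  shows "coords \<Delta> R std (std_coord g) g"
  unfolding coords_iff
proof (intro conjI allI ballI impI)
  show "std_coord g e \<in> R" if "e \<in> std" for e
    using that by (auto simp: std_def std_coord_bvec coord_at_def R_def cf_in)
  show "std_coord g e = 0" if "e \<notin> std" for e using that by (simp add: std_coord_def)
  define S where "S n = (\<lambda>(\<xi>, u). bvec \<xi> u) ` (\<Xi> \<times> {u \<in> M. \<not> fps_X ^ (n + wt u) dvd g u})" for n
  have fin_S: "finite (S n)" for n
    unfolding S_def using B_moduleD(3)[OF g] by (intro finite_imageI finite_cartesian_product fin)
  have S_std: "S n \<subseteq> std" for n by (auto simp: S_def std_def)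
  have dvd: "fps_X ^ n dvd std_coord g e" if "e \<in> std" "e \<notin> S n" for n e
  proof -
    obtain \<xi> u where e: "\<xi> \<in> \<Xi>" "u \<in> M" "e = bvec \<xi> u" using \<open>e \<in> std\<close> by (rule stdE)
    then have "fps_X ^ (n + wt u) dvd g u" using \<open>e \<notin> S n\<close> by (auto simp: S_def)
    then show ?thesis using e coord_at_dvd[OF g] by (simp add: std_coord_bvec)
  qed
  show "null_family (std_coord g) std"
    unfolding null_family_def by (rule allI, rule finite_subset[OF _ fin_S]) (use dvd in blast)
  fix n
  show "\<forall>\<^sub>F F in finite_subsets_at_top std. small n (g - (\<Sum>e\<in>F. series_scale (std_coord g e) e))"
    unfolding eventually_finite_subsets_at_top
  proof (intro exI[of _ "S n"] conjI allI impI fin_S S_std)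
    fix F assume F: "finite F \<and> S n \<subseteq> F \<and> F \<subseteq> std"
    show "small n (g - (\<Sum>e\<in>F. series_scale (std_coord g e) e))"
      unfolding small_def
    proof
      fix u assume u: "u \<in> M"
      show "fps_X ^ (n + wt u) dvd (g - (\<Sum>e\<in>F. series_scale (std_coord g e) e)) u"
      \<comment> \<open>If g is small at u, so is every term of the sum. Otherwise all basis vectors
        above u belong to \<open>S n\<close>, hence to F, and the sum at u is exactly g u.\<close>
      proof (cases "fps_X ^ (n + wt u) dvd g u")
        case True
        have "fps_X ^ (n + wt u) dvd std_coord g e * e u" if eF: "e \<in> F" for e
        proof -
          have "e \<in> std" using eF F by blast
          then obtain \<xi> v where e: "\<xi> \<in> \<Xi>" "v \<in> M" "e = bvec \<xi> v" by (rule stdE)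
          show ?thesis
          proof (cases "v = u")
            case v: True
            have "fps_X ^ n dvd std_coord g e" using e v True coord_at_dvd[OF g] by (simp add: std_coord_bvec)
            then show ?thesis
              unfolding power_add by (intro mult_dvd_mono) (simp_all add: e v bvec_def)
          qed (simp add: e bvec_def)
        qed
        then show ?thesis using True by (auto simp: sum_fun_apply intro!: dvd_diff dvd_sum)
      next
        case False
        have "(\<Sum>e\<in>F. series_scale (std_coord g e) e) u
            = fps_X ^ wt u * (\<Sum>\<xi>\<in>\<Xi>. std_coord g (bvec \<xi> u) * fps_const \<xi>)"
          using F False u by (intro sum_std) (auto simp: S_def)
        also have "\<dots> = g u"
          using B_moduleD(2)[OF g u] u by (simp add: std_coord_bvec coord_at_expand fps_X_power_mult_shift)
        finally show ?thesis by simp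
      qed
    qed
  qed
qed

text \<open>At u only the finitely many basis vectors above u contribute, so the sum at u
  stabilises. Dividing it by \<pi>^{deg(u)} and applying \<open>cf\<close> recovers the
  coefficients, over which \<open>cf\<close> is linear because they lie in R.\<close>

lemma coords_std_unique:
  assumes g: "g \<in> B_module \<Delta>" and c: "coords \<Delta> R std c g"
  shows "c = std_coord g"
proof
  fix e
  note c = c[unfolded coords_iff]
  show "c e = std_coord g e"
  proof (cases "e \<in> std")
    case True
    then obtain \<eta> u where e: "\<eta> \<in> \<Xi>" "u \<in> M" "e = bvec \<eta> u" by (rule stdE)
    let ?s = "\<Sum>\<xi>\<in>\<Xi>. c (bvec \<xi> u) * fps_const \<xi>"
    have "fps_eq_mod n (fps_shift (wt u) (g u)) ?s" for n
    proof -
      have "\<forall>\<^sub>F F in finite_subsets_at_top std. small n (g - (\<Sum>e\<in>F. series_scale (c e) e))"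
        using c by blast
      then obtain X where X: "finite X \<and> X \<subseteq> std \<and>
          (\<forall>Y. finite Y \<and> X \<subseteq> Y \<and> Y \<subseteq> std \<longrightarrow> small n (g - (\<Sum>e\<in>Y. series_scale (c e) e)))"
        unfolding eventually_finite_subsets_at_top ..
      let ?Y = "X \<union> (\<lambda>\<xi>. bvec \<xi> u) ` \<Xi>"
      have Y: "finite ?Y" "?Y \<subseteq> std" using X fin bvec_in_std[OF _ e(2)] by auto
      have "small n (g - (\<Sum>e\<in>?Y. series_scale (c e) e))"
        by (rule X[THEN conjunct2, THEN conjunct2, rule_format]) (use Y in simp)
      then have "fps_X ^ (n + wt u) dvd g u - (\<Sum>e\<in>?Y. series_scale (c e) e) u"
        using e(2) by (simp add: small_def)
      also have "(\<Sum>e\<in>?Y. series_scale (c e) e) u = fps_X ^ wt u * ?s"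
        by (rule sum_std[OF Y]) simp
      also have "g u - fps_X ^ wt u * ?s = fps_X ^ wt u * (fps_shift (wt u) (g u) - ?s)"
        by (simp add: right_diff_distrib fps_X_power_mult_shift[OF B_moduleD(2)[OF g e(2)]])
      finally show ?thesis
        unfolding fps_eq_mod_def power_add mult.commute[of "fps_X ^ n"] by (subst (asm) dvd_mult_cancel_left) simp
    qed
    then have "fps_shift (wt u) (g u) = ?s" by (rule fps_eq_mod_all_imp_eq)
    then have "coord_at g \<eta> u = (\<Sum>\<xi>\<in>\<Xi>. fps_map (cf \<eta>) (c (bvec \<xi> u) * fps_const \<xi>))"
      unfolding coord_at_def using e(1) by (simp add: fps_map_sum cf_0 cf_add)
    also have "\<dots> = (\<Sum>\<xi>\<in>\<Xi>. c (bvec \<xi> u) * (if \<xi> = \<eta> then 1 else 0))"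
    proof (intro sum.cong refl)
      fix \<xi> assume \<xi>: "\<xi> \<in> \<Xi>"
      have "c (bvec \<xi> u) \<in> R" using c bvec_in_std[OF \<xi> e(2)] by blast
      then have "fps_map (cf \<eta>) (c (bvec \<xi> u) * fps_const \<xi>) = fps_map (\<lambda>x. x) (c (bvec \<xi> u)) * fps_map (cf \<eta>) (fps_const \<xi>)"
        using e(1) by (intro fps_map_mult) (auto simp: cf_0 cf_add cf_mult R_def)
      moreover have "fps_map (cf \<eta>) (fps_const \<xi>) = fps_const (cf \<eta> \<xi>)"
        using e(1) by (simp add: fps_eq_iff cf_0)
      ultimately show "fps_map (cf \<eta>) (c (bvec \<xi> u) * fps_const \<xi>) = c (bvec \<xi> u) * (if \<xi> = \<eta> then 1 else 0)"
        using \<xi> e(1) by (simp add: fps_map_ident cf_basis)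
    qed
    also have "\<dots> = c e" using fin e by (simp add: if_distrib[of "\<lambda>x. _ * x"] cong: if_cong)
    finally show ?thesis using e by (simp add: std_coord_bvec)
  next
    case False
    then show ?thesis using c by (simp add: std_coord_def)
  qed
qed

text \<open>A coordinate functional cannot lower the order, and the leading coefficient of a nonzero
  series has some nonzero coordinate, which gives a coordinate of the same order.\<close>

lemma ord_B_std:
  assumes g: "g \<in> B_module \<Delta>"
  shows "ord_B \<Delta> g = (INF e\<in>std. ord_T (denom \<Delta>) (std_coord g e))"
proof (rule antisym)
  have shift: "ord_T (denom \<Delta>) (g u) - ereal (deg \<Delta> u) = ord_T (denom \<Delta>) (fps_shift (wt u) (g u))"
    if "u \<in> M" for u
    using ord_T_shift[OF denom_pos B_moduleD(2)[OF g that]] deg_eq[OF that] by simp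
  show "ord_B \<Delta> g \<le> (INF e\<in>std. ord_T (denom \<Delta>) (std_coord g e))"
  proof (rule INF_greatest)
    fix e assume "e \<in> std"
    then obtain \<xi> u where e: "\<xi> \<in> \<Xi>" "u \<in> M" "e = bvec \<xi> u" by (rule stdE)
    have "ord_T (denom \<Delta>) f \<le> ord_T (denom \<Delta>) (fps_map (cf \<xi>) f)" for f
    proof (cases "f = 0")
      case True
      then show ?thesis using e(1) by (simp add: fps_map_0 cf_0)
    next
      case False
      have "fps_X ^ subdegree f dvd fps_map (cf \<xi>) f"
        using e(1) by (intro fps_X_power_dvd_map cf_0) (simp_all add: fps_X_power_dvd_iff_subdegree)
      then have "ereal (real (subdegree f) / real (denom \<Delta>)) \<le> ord_T (denom \<Delta>) (fps_map (cf \<xi>) f)"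
        by (simp add: ord_T_ge_iff[OF denom_pos])
      then show ?thesis using False by (simp add: ord_T_def)
    qed
    then have "ord_T (denom \<Delta>) (fps_shift (wt u) (g u)) \<le> ord_T (denom \<Delta>) (std_coord g e)"
      using e by (simp add: std_coord_bvec coord_at_def)
    moreover have "ord_B \<Delta> g \<le> ord_T (denom \<Delta>) (g u) - ereal (deg \<Delta> u)"
      unfolding ord_B_def by (rule INF_lower[OF e(2)])
    ultimately show "ord_B \<Delta> g \<le> ord_T (denom \<Delta>) (std_coord g e)" using shift[OF e(2)] by simp
  qed
  show "(INF e\<in>std. ord_T (denom \<Delta>) (std_coord g e)) \<le> ord_B \<Delta> g"
    unfolding ord_B_def
  proof (rule INF_greatest)
    fix u assume u: "u \<in> M"
    let ?f = "fps_shift (wt u) (g u)"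
    have "(INF e\<in>std. ord_T (denom \<Delta>) (std_coord g e)) \<le> ord_T (denom \<Delta>) ?f"
    proof (cases "?f = 0")
      case False
      let ?k = "subdegree ?f"
      have "(\<Sum>\<xi>\<in>\<Xi>. cf \<xi> (fps_nth ?f ?k) * \<xi>) \<noteq> 0"
        unfolding cf_expand using False by (rule nth_subdegree_nonzero)
      then obtain \<xi> where \<xi>: "\<xi> \<in> \<Xi>" "cf \<xi> (fps_nth ?f ?k) \<noteq> 0" by (metis (no_types, lifting) mult_zero_left sum.neutral)
      have nz: "fps_nth (coord_at g \<xi> u) ?k \<noteq> 0" using \<xi>(2) by (simp add: coord_at_def del: fps_shift_nth)
      then have "subdegree (coord_at g \<xi> u) \<le> ?k" "coord_at g \<xi> u \<noteq> 0"
        by (auto intro: subdegree_leI)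
      then have "ord_T (denom \<Delta>) (coord_at g \<xi> u) \<le> ord_T (denom \<Delta>) ?f"
        using False by (auto simp: ord_T_def divide_right_mono)
      moreover have "bvec \<xi> u \<in> std" using \<xi>(1) u by (rule bvec_in_std)
      ultimately show ?thesis
        using std_coord_bvec[OF \<xi>(1) u, of g] by (metis INF_lower order.trans)
    qed (simp add: ord_T_def)
    then show "(INF e\<in>std. ord_T (denom \<Delta>) (std_coord g e)) \<le> ord_T (denom \<Delta>) (g u) - ereal (deg \<Delta> u)"
      using shift[OF u] by simp
  qed
qed

lemma orthonormal_basis_std: "orthonormal_basis \<Delta> R std"
  unfolding orthonormal_basis_def
proof (intro conjI ballI allI impI std_subset_B)
  fix g :: "('r, 'n) series" assume g: "g \<in> B_module \<Delta>"
  show "\<exists>!c. coords \<Delta> R std c g"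
    by (rule ex1I[of _ "std_coord g"]) (rule coords_std[OF g], rule coords_std_unique[OF g])
  fix c assume "coords \<Delta> R std c g"
  then have "c = std_coord g" by (rule coords_std_unique[OF g])
  then show "ord_B \<Delta> g = (INF e\<in>std. ord_T (denom \<Delta>) (c e))" using ord_B_std[OF g] by simp
qed

abbreviation basis_coord :: "('r, 'n) series set \<Rightarrow> ('r, 'n) series \<Rightarrow> ('r, 'n) series \<Rightarrow> 'r fps" where
  "basis_coord E \<equiv> (\<lambda>g. THE c. coords \<Delta> R E c g)"

lemma basis_coord_std:
  assumes "g \<in> B_module \<Delta>" "\<xi> \<in> \<Xi>" "u \<in> M"
  shows "basis_coord std g (bvec \<xi> u) = coord_at g \<xi> u"
proof -
  have "(THE c. coords \<Delta> R std c g) = std_coord g"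
    by (rule the_equality) (rule coords_std[OF assms(1)], rule coords_std_unique[OF assms(1)])
  then show ?thesis using std_coord_bvec[OF assms(2,3)] by simp
qed

sublocale fps_module series_scale "B_module \<Delta> :: ('r, 'n) series set" R
  by (rule fps_module_R)

sublocale std: fps_basis series_scale "B_module \<Delta> :: ('r, 'n) series set" R std "basis_coord std"
  by (rule orthonormal_basis_fps_basis[OF fps_module_R orthonormal_basis_std])

text \<open>The description in \<open>fredholm_det\<close> ranges over the determinants in all
  orthonormal bases: \<open>std\<close> supplies one, and independence of the basis shows that there
  is only one.\<close>

theorem fredholm_det_eq:
  assumes "semilinear (\<lambda>x. x) \<Phi>" "compact_op std (basis_coord std) \<Phi>"
    and char: "\<And>k. k > 0 \<Longrightarrow> (of_nat k :: 'r) \<noteq> 0"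
  shows "fredholm_det \<Delta> R \<Phi> = Abs_fps (\<lambda>m. (-1) ^ m * std.char_coeff \<Phi> m)"
proof -
  have det: "det_series E (matrix_of \<Delta> R E \<Phi>) = Abs_fps (\<lambda>m. (-1) ^ m * std.char_coeff \<Phi> m)"
    if "orthonormal_basis \<Delta> R E" for E
  proof -
    interpret E: fps_basis series_scale "B_module \<Delta>" R E "basis_coord E"
      by (rule orthonormal_basis_fps_basis[OF fps_module_R that])
    have "det_series E (matrix_of \<Delta> R E \<Phi>) = Abs_fps (\<lambda>m. (-1) ^ m * E.char_coeff \<Phi> m)"
      unfolding det_series_def E.char_coeff_def matrix_of_def ..
    also have "E.char_coeff \<Phi> = std.char_coeff \<Phi>"
      by (rule char_coeff_basis_independent[OF std.fps_basis_axioms E.fps_basis_axioms assms])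
    finally show ?thesis .
  qed
  show ?thesis
    unfolding fredholm_det_def
  proof (rule the_equality)
    show "\<exists>E. orthonormal_basis \<Delta> R E \<and>
        Abs_fps (\<lambda>m. (-1) ^ m * std.char_coeff \<Phi> m) = det_series E (matrix_of \<Delta> R E \<Phi>)"
      by (rule exI[of _ std]) (simp add: orthonormal_basis_std det)
  qed (auto simp: det)
qed

text \<open>A version of \<open>range_mod\<close> in terms of exponents instead of basis vectors, so
  that one set U can serve for both ground rings.\<close>

definition finite_mod :: "nat \<Rightarrow> (('r, 'n) series \<Rightarrow> ('r, 'n) series) \<Rightarrow> (int ^ 'n) set \<Rightarrow> bool" where
  "finite_mod n \<Phi> U \<longleftrightarrow> finite U \<and> U \<subseteq> M \<and>
     (\<forall>g\<in>B_module \<Delta>. \<forall>u\<in>M - U. fps_X ^ (n + wt u) dvd \<Phi> g u)"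

lemma range_mod_std:
  assumes "finite_mod n \<Phi> U" "\<Phi> \<in> B_module \<Delta> \<rightarrow> B_module \<Delta>"
  shows "range_mod n std (basis_coord std) \<Phi> ((\<lambda>(\<xi>, u). bvec \<xi> u) ` (\<Xi> \<times> U))"
  unfolding range_mod_def
proof (intro conjI ballI)
  show "finite ((\<lambda>(\<xi>, u). bvec \<xi> u) ` (\<Xi> \<times> U))" using assms(1) fin by (simp add: finite_mod_def)
  show "(\<lambda>(\<xi>, u). bvec \<xi> u) ` (\<Xi> \<times> U) \<subseteq> std" using assms(1) by (auto simp: finite_mod_def std_def)
  fix e g :: "('r, 'n) series"
  assume e: "e \<in> std - (\<lambda>(\<xi>, u). bvec \<xi> u) ` (\<Xi> \<times> U)" and g: "g \<in> B_module \<Delta>"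
  obtain \<xi> u where e': "\<xi> \<in> \<Xi>" "u \<in> M - U" "e = bvec \<xi> u" using e by (auto simp: std_def)
  have "\<Phi> g \<in> B_module \<Delta>" using assms(2) g by blast
  then show "fps_X ^ n dvd basis_coord std (\<Phi> g) e"
    using e' assms(1) g by (simp add: basis_coord_std finite_mod_def coord_at_dvd)
qed

lemma trace_std_eq_mod:
  assumes "compact_op std (basis_coord std) \<Phi>" "finite_mod n \<Phi> U" "\<Phi> \<in> B_module \<Delta> \<rightarrow> B_module \<Delta>"
  shows "fps_eq_mod n (trace std (basis_coord std) \<Phi>) (\<Sum>u\<in>U. \<Sum>\<xi>\<in>\<Xi>. coord_at (\<Phi> (bvec \<xi> u)) \<xi> u)"
proof -
  have U: "U \<subseteq> M" using assms(2) by (simp add: finite_mod_def)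
  have "fps_eq_mod n (trace std (basis_coord std) \<Phi>)
      (\<Sum>e\<in>(\<lambda>(\<xi>, u). bvec \<xi> u) ` (\<Xi> \<times> U). basis_coord std (\<Phi> e) e)"
    by (rule std.trace_eq_mod[OF assms(1) range_mod_std[OF assms(2,3)]])
  also have "(\<Sum>e\<in>(\<lambda>(\<xi>, u). bvec \<xi> u) ` (\<Xi> \<times> U). basis_coord std (\<Phi> e) e)
      = (\<Sum>(\<xi>, u)\<in>\<Xi> \<times> U. basis_coord std (\<Phi> (bvec \<xi> u)) (bvec \<xi> u))"
    using U by (subst sum.reindex[OF inj_on_subset[OF inj_bvec]]) (auto simp: case_prod_unfold)
  also have "\<dots> = (\<Sum>(\<xi>, u)\<in>\<Xi> \<times> U. coord_at (\<Phi> (bvec \<xi> u)) \<xi> u)"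
  proof (intro sum.cong refl, clarify)
    fix \<xi> u assume "\<xi> \<in> \<Xi>" "u \<in> U"
    moreover from this have "\<Phi> (bvec \<xi> u) \<in> B_module \<Delta>" using assms(3) bvec_in_B U by blast
    ultimately show "basis_coord std (\<Phi> (bvec \<xi> u)) (bvec \<xi> u) = coord_at (\<Phi> (bvec \<xi> u)) \<xi> u"
      using U by (intro basis_coord_std) auto
  qed
  also have "\<dots> = (\<Sum>u\<in>U. \<Sum>\<xi>\<in>\<Xi>. coord_at (\<Phi> (bvec \<xi> u)) \<xi> u)"
    by (subst sum.swap) (simp add: sum.cartesian_product)
  finally show ?thesis .
qed

end

section \<open>The operator \<open>\<Psi>\<close>\<close>

context lattice_polytope
begin

lemma cone_lattice_of_nat: "u \<in> M \<Longrightarrow> of_nat k *s u \<in> M"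
  by (cases "k = 0") (simp_all add: cone_lattice_scale_iff)

lemma cone_lattice_sum:
  assumes "\<And>i. i \<in> I \<Longrightarrow> v i \<in> M"
  shows "sum v I \<in> M" and wt_sum_le: "wt (sum v I) \<le> (\<Sum>i\<in>I. wt (v i))"
proof -
  have "sum v I \<in> M \<and> wt (sum v I) \<le> (\<Sum>i\<in>I. wt (v i))"
    using assms
  proof (induction I rule: infinite_finite_induct)
    case (insert i I)
    then have IH: "sum v I \<in> M" "wt (sum v I) \<le> (\<Sum>i\<in>I. wt (v i))" and vi: "v i \<in> M" by auto
    have "wt (v i + sum v I) \<le> wt (v i) + wt (sum v I)" using vi IH(1) by (rule wt_add_le)
    then show ?case using insert.hyps IH vi cone_lattice_add[OF vi IH(1)] by simp
  qed auto
  then show "sum v I \<in> M" "wt (sum v I) \<le> (\<Sum>i\<in>I. wt (v i))" by auto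
qed

lemma L_module_iff: "g \<in> L_module \<Delta> \<longleftrightarrow> (\<forall>u. u \<notin> M \<longrightarrow> g u = 0) \<and> (\<forall>u\<in>M. fps_X ^ wt u dvd g u)"
proof
  assume "(\<forall>u. u \<notin> M \<longrightarrow> g u = 0) \<and> (\<forall>u\<in>M. fps_X ^ wt u dvd g u)"
  then have "g = weighted \<Delta> (\<lambda>u. fps_shift (wt u) (g u))"
    by (auto simp: fun_eq_iff weighted_def pi_deg_eq mult.commute[of "fps_shift _ _"] fps_X_power_mult_shift)
  then show "g \<in> L_module \<Delta>" unfolding L_module_def by (metis rangeI)
qed (auto simp: L_module_def weighted_def pi_deg_eq)

lemma L_moduleD:
  assumes "g \<in> L_module \<Delta>"
  shows "u \<notin> M \<Longrightarrow> g u = 0" "u \<in> M \<Longrightarrow> fps_X ^ wt u dvd g u"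
  using assms unfolding L_module_iff by blast+

text \<open>The k-th term carries \<pi>^k, of weight kD, while the weight of ku is k times that of
  u, hence at most kD.\<close>

lemma artin_hasse_monomial_in_L:
  fixes z :: "'r::idom"
  assumes "rvec u \<in> \<Delta>"
  shows "artin_hasse_monomial p (denom \<Delta>) z u \<in> L_module \<Delta>"
  unfolding L_module_iff
proof (intro conjI allI impI ballI)
  fix w
  show "artin_hasse_monomial p (denom \<Delta>) z u w = 0" if "w \<notin> M"
  proof -
    have "{k. of_nat k *s u = w} = {}" using that cone_lattice_of_nat wt_le_denom(1)[OF assms] by blast
    then show ?thesis by (simp only: artin_hasse_monomial_def infsum_empty)
  qed
  show "fps_X ^ wt w dvd artin_hasse_monomial p (denom \<Delta>) z u w"
    unfolding artin_hasse_monomial_def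
  proof (intro fps_X_power_dvd_infsum dvd_mult)
    fix k assume "k \<in> {k. of_nat k *s u = w}"
    then have "wt w = k * wt u" using wt_scale[OF wt_le_denom(1)[OF assms]] by auto
    then have "wt w \<le> denom \<Delta> * k" using wt_le_denom(2)[OF assms] by simp
    then show "fps_X ^ wt w dvd ((fps_X :: 'r fps) ^ denom \<Delta>) ^ k"
      unfolding power_mult[symmetric] by (rule le_imp_power_dvd)
  qed
qed

text \<open>By subadditivity of weights, each way of writing w as a sum of exponents contributes a
  term of sufficient order.\<close>

lemma series_prod_in_L:
  fixes g :: "'i \<Rightarrow> ('r::idom, 'n) series"
  assumes I: "finite I" and g: "\<And>i. i \<in> I \<Longrightarrow> g i \<in> L_module \<Delta>"
  shows "series_prod I g \<in> L_module \<Delta>"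
  unfolding L_module_iff
proof (intro conjI allI impI ballI)
  have zero: "(\<Prod>i\<in>I. g i (v i)) = 0" if "i \<in> I" "v i \<notin> M" for v i
    using I that L_moduleD(1)[OF g] by (intro prod_zero) auto
  fix w
  show "series_prod I g w = 0" if w: "w \<notin> M"
    unfolding series_prod_def
  proof (rule infsum_0)
    fix v assume v: "v \<in> {v \<in> I \<rightarrow>\<^sub>E UNIV. sum v I = w}"
    then obtain i where "i \<in> I" "v i \<notin> M" using cone_lattice_sum[of I v] w by auto
    then show "(\<Prod>i\<in>I. g i (v i)) = 0" by (rule zero)
  qed
  show "fps_X ^ wt w dvd series_prod I g w"
    unfolding series_prod_def
  proof (rule fps_X_power_dvd_infsum)
    fix v assume v: "v \<in> {v \<in> I \<rightarrow>\<^sub>E UNIV. sum v I = w}"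
    show "fps_X ^ wt w dvd (\<Prod>i\<in>I. g i (v i))"
    proof (cases "\<forall>i\<in>I. v i \<in> M")
      case True
      then have "wt w \<le> (\<Sum>i\<in>I. wt (v i))" using wt_sum_le[of I v] v by auto
      then have "fps_X ^ wt w dvd (\<Prod>i\<in>I. (fps_X :: 'r fps) ^ wt (v i))"
        unfolding power_sum[symmetric] by (rule le_imp_power_dvd)
      also have "\<dots> dvd (\<Prod>i\<in>I. g i (v i))"
        using True L_moduleD(2)[OF g] by (intro prod_dvd_prod) auto
      finally show ?thesis .
    next
      case False
      then show ?thesis using zero[of _ v] by auto
    qed
  qed
qed

lemma E_f_in_L: "E_f p red \<Delta> a \<in> L_module \<Delta>"
  unfolding E_f_def
proof (rule series_prod_in_L)
  show "finite {u. rvec u \<in> \<Delta> \<and> a u \<noteq> 0}"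
    by (rule finite_subset[OF _ finite_lattice_points[OF compact_imp_bounded[OF compact]]]) auto
qed (auto intro: artin_hasse_monomial_in_L)

section \<open>Multiplication of B by an element of L\<close>

context
  fixes h :: "('r::idom, 'n) series"
  assumes h: "h \<in> L_module \<Delta>"
begin

text \<open>The coefficients of the factor in B tend to 0, which makes the convolution
  converge.\<close>

lemma null_family_mult:
  assumes g: "g \<in> B_module \<Delta>"
  shows "null_family (\<lambda>v. h (w - v) * g v) UNIV"
  unfolding null_family_def
proof
  fix n
  have "{v \<in> UNIV. \<not> fps_X ^ n dvd h (w - v) * g v} \<subseteq> {v \<in> M. \<not> fps_X ^ (n + wt v) dvd g v}"
  proof clarify
    fix v assume v: "\<not> fps_X ^ n dvd h (w - v) * g v"
    then have "g v \<noteq> 0" by auto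
    then have "v \<in> M" using B_moduleD(1)[OF g] by blast
    moreover have "\<not> fps_X ^ (n + wt v) dvd g v"
    proof
      assume "fps_X ^ (n + wt v) dvd g v"
      then have "fps_X ^ n dvd g v" unfolding power_add by (rule dvd_mult_left)
      with v show False by simp
    qed
    ultimately show "v \<in> M \<and> \<not> fps_X ^ (n + wt v) dvd g v" by simp
  qed
  then show "finite {v \<in> UNIV. \<not> fps_X ^ n dvd h (w - v) * g v}"
    using finite_subset B_moduleD(3)[OF g] by blast
qed

lemma series_mult_add:
  assumes "g \<in> B_module \<Delta>" "g' \<in> B_module \<Delta>"
  shows "series_mult h (g + g') w = series_mult h g w + series_mult h g' w"
  using infsum_fps_add[OF null_family_mult[OF assms(1)] null_family_mult[OF assms(2)]]
  by (simp add: series_mult_def distrib_left)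

lemma series_mult_scale:
  assumes "g \<in> B_module \<Delta>"
  shows "series_mult h (series_scale c g) w = c * series_mult h g w"
  using infsum_fps_cmult[OF null_family_mult[OF assms], of c]
  by (simp add: series_mult_def mult.left_commute)

lemma series_mult_in_L:
  assumes g: "g \<in> B_module \<Delta>"
  shows "series_mult h g \<in> L_module \<Delta>"
  unfolding L_module_iff
proof (intro conjI allI impI ballI)
  have zero: "h (w - v) * g v = 0" if "\<not> (w - v \<in> M \<and> v \<in> M)" for w v
    using that B_moduleD(1)[OF g] L_moduleD(1)[OF h] by auto
  fix w
  show "series_mult h g w = 0" if w: "w \<notin> M"
    unfolding series_mult_def
  proof (rule infsum_0)
    fix v
    have "\<not> (w - v \<in> M \<and> v \<in> M)" using cone_lattice_add[of "w - v" v] w by auto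
    then show "h (w - v) * g v = 0" by (rule zero)
  qed
  show "fps_X ^ wt w dvd series_mult h g w"
    unfolding series_mult_def
  proof (rule fps_X_power_dvd_infsum)
    fix v
    show "fps_X ^ wt w dvd h (w - v) * g v"
    proof (cases "w - v \<in> M \<and> v \<in> M")
      case True
      then have "wt w \<le> wt (w - v) + wt v" using wt_add_le[of "w - v" v] by simp
      then have "fps_X ^ wt w dvd (fps_X ^ (wt (w - v) + wt v) :: 'r fps)" by (rule le_imp_power_dvd)
      also have "\<dots> dvd h (w - v) * g v"
        unfolding power_add using True B_moduleD(2)[OF g] L_moduleD(2)[OF h] by (intro mult_dvd_mono) auto
      finally show ?thesis .
    qed (simp add: zero)
  qed
qed

end

end

section \<open>Estimates and semilinearity for \<Psi>\<close>

locale exponential_sum = lattice_polytope \<Delta> + witt_frobenius p b red \<sigma>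
  for \<Delta> :: "(real ^ 'n) set" and p b and red :: "'r::idom \<Rightarrow> 'k::{field,finite}" and \<sigma> +
  fixes a :: "int ^ 'n \<Rightarrow> 'k"
begin

abbreviation \<Psi> :: "('r, 'n) series \<Rightarrow> ('r, 'n) series" where "\<Psi> \<equiv> Psi p red \<sigma> \<Delta> a"

abbreviation B :: "('r, 'n) series set" where "B \<equiv> B_module \<Delta>"

lemma \<Psi>_apply: "\<Psi> g u = fps_map \<tau> (series_mult (E_f p red \<Delta> a) g (of_nat p *s u))"
  by (simp add: Psi_def coeff_map_def Psi_p_def fps_map_def \<tau>_def)

lemma \<tau>_0 [simp]: "\<tau> 0 = 0"
  using \<tau>_\<sigma>[of 0] by simp

lemma multiplier_in_L: "E_f p red \<Delta> a \<in> L_module \<Delta>"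
  by (rule E_f_in_L)

lemma \<Psi>_0: "g \<in> B \<Longrightarrow> u \<notin> M \<Longrightarrow> \<Psi> g u = 0"
  using L_moduleD(1)[OF series_mult_in_L[OF multiplier_in_L], of g "of_nat p *s u"] p_gt_1
  by (simp add: \<Psi>_apply cone_lattice_scale_iff fps_map_0)

text \<open>\<open>Psi_p\<close> moves the coefficient at pu to u. The surplus of (p - 1) times
  \<open>wt u\<close> over what B requires is the source of complete continuity.\<close>

lemma \<Psi>_dvd: "g \<in> B \<Longrightarrow> u \<in> M \<Longrightarrow> fps_X ^ (p * wt u) dvd \<Psi> g u"
  using L_moduleD(2)[OF series_mult_in_L[OF multiplier_in_L], of g "of_nat p *s u"] p_gt_1
  by (simp add: \<Psi>_apply cone_lattice_scale_iff wt_scale fps_X_power_dvd_map)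

text \<open>As p is at least 2, the surplus is at least n as soon as the weight is.\<close>

lemma \<Psi>_dvd':
  assumes "g \<in> B" "u \<in> M" "n \<le> wt u"
  shows "fps_X ^ (n + wt u) dvd \<Psi> g u"
proof -
  have "n + wt u \<le> 2 * wt u" using assms(3) by simp
  also have "\<dots> \<le> p * wt u" using p_gt_1 by (intro mult_right_mono) auto
  finally show ?thesis using \<Psi>_dvd[OF assms(1,2)] by (meson dvd_trans le_imp_power_dvd)
qed

lemma finite_wt_less: "finite {u \<in> M. wt u < n}"
  by (rule finite_subset[OF _ finite_wt_le[of n]]) auto

lemma \<Psi>_in_B:
  assumes g: "g \<in> B"
  shows "\<Psi> g \<in> B"
  unfolding B_module_iff
proof (intro conjI allI impI ballI)
  show "\<Psi> g u = 0" if "u \<notin> M" for u using \<Psi>_0[OF g that] .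
  show "fps_X ^ wt u dvd \<Psi> g u" if "u \<in> M" for u using \<Psi>_dvd'[OF g that, of 0] by simp
  show "finite {u \<in> M. \<not> fps_X ^ (n + wt u) dvd \<Psi> g u}" for n
    by (rule finite_subset[OF _ finite_wt_less[of n]]) (use \<Psi>_dvd'[OF g] in \<open>auto simp: not_le[symmetric]\<close>)
qed

lemma \<Psi>_add: "g \<in> B \<Longrightarrow> h \<in> B \<Longrightarrow> \<Psi> (g + h) = \<Psi> g + \<Psi> h"
  by (simp add: fun_eq_iff \<Psi>_apply series_mult_add[OF multiplier_in_L] fps_map_ring_hom[OF ring_hom_\<tau>])

lemma \<Psi>_scale: "g \<in> B \<Longrightarrow> \<Psi> (series_scale c g) = series_scale (fps_map \<tau> c) (\<Psi> g)"
  by (simp add: fun_eq_iff \<Psi>_apply series_mult_scale[OF multiplier_in_L] fps_map_ring_hom[OF ring_hom_\<tau>])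

lemma \<Psi>_maps: "\<Psi> \<in> B \<rightarrow> B"
  using \<Psi>_in_B by blast

lemma \<Psi>_funpow_in_B: "g \<in> B \<Longrightarrow> (\<Psi> ^^ k) g \<in> B"
  by (induction k) (auto intro: \<Psi>_in_B)

lemma \<Psi>_funpow_scale: "g \<in> B \<Longrightarrow> (\<Psi> ^^ k) (series_scale c g) = series_scale (fps_map (\<tau> ^^ k) c) ((\<Psi> ^^ k) g)"
  by (induction k) (simp_all add: \<Psi>_scale \<Psi>_funpow_in_B fps_map_map fps_map_ident o_def)

text \<open>Only the outermost application of \<Psi> is estimated, so the exceptional set is the
  same for all positive powers and for both ground rings.\<close>

lemma finite_mod_\<Psi>:
  fixes R0 :: "'r set"
  assumes "polytope_coeffs \<Delta> R0 \<Xi> cf"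
  shows "polytope_coeffs.finite_mod \<Delta> n (\<Psi> ^^ Suc k) {u \<in> M. wt u < n}"
proof -
  interpret polytope_coeffs \<Delta> R0 \<Xi> cf by (rule assms)
  show ?thesis
    unfolding finite_mod_def
    using \<Psi>_dvd'[OF \<Psi>_funpow_in_B] by (auto simp: finite_wt_less not_less)
qed

sublocale Q: polytope_coeffs \<Delta> UNIV "{1 :: 'r}" "\<lambda>_ x. x"
  by (rule polytope_coeffs.intro[OF lattice_polytope_axioms free_coeffs_trivial])

end

text \<open>
  The recursion for \<open>A'\<close> says that \<open>\<Sum> A'\<^sub>i s\<^sup>i = exp(- \<Sum>\<^sub>k P\<^sub>k s\<^sup>k / k)\<close>, and likewise for \<open>A\<close> and \<open>q\<close>;
  so the claim is \<open>\<Sum> A'\<^sub>i s\<^sup>i = \<Sum> A\<^sub>i s\<^bsup>bi\<^esup>\<close>.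
\<close>

lemma newton_recursion_power:
  fixes A A' P q :: "nat \<Rightarrow> 'c::idom"
  assumes b: "b > 0" and char: "\<And>k. k > 0 \<Longrightarrow> (of_nat k :: 'c) \<noteq> 0"
    and A: "A 0 = 1" "\<And>m. of_nat (Suc m) * A (Suc m) = - (\<Sum>k\<le>m. q (Suc k) * A (m - k))"
    and A': "A' 0 = 1" "\<And>m. of_nat (Suc m) * A' (Suc m) = - (\<Sum>k\<le>m. P (Suc k) * A' (m - k))"
    and P: "\<And>k. k > 0 \<Longrightarrow> P (b * k) = of_nat b * q k" "\<And>k. \<not> b dvd k \<Longrightarrow> P k = 0"
  shows "A' i = (if b dvd i then A (i div b) else 0)"
proof (induction i rule: less_induct)
  case (less i)
  have shift: "(\<Sum>k\<le>m. f (Suc k) * g (m - k)) = (\<Sum>l\<in>{1..Suc m}. f l * g (Suc m - l))" for f g :: "nat \<Rightarrow> 'c" and m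
    by (rule sum.reindex_bij_witness[of _ "\<lambda>l. l - 1" Suc]) auto
  show ?case
  proof (cases "i = 0")
    case True
    then show ?thesis using A(1) A'(1) by simp
  next
    case False
    then have rec: "of_nat i * A' i = - (\<Sum>l\<in>{1..i}. P l * A' (i - l))"
      using A'(2)[of "i - 1"] shift[of P A' "i - 1"] by simp
    show ?thesis
    proof (cases "b dvd i")
      case False
      have zero: "P l * A' (i - l) = 0" if "l \<in> {1..i}" for l
      proof (cases "b dvd l")
        case True
        then have "\<not> b dvd i - l" using False that dvd_add[of b "i - l" l] by auto
        then show ?thesis using less[of "i - l"] that by simp
      qed (simp add: P(2))
      have "(\<Sum>l\<in>{1..i}. P l * A' (i - l)) = 0" by (rule sum.neutral) (use zero in blast)
      then have "of_nat i * A' i = 0" by (simp only: rec minus_zero)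
      then show ?thesis using False \<open>i \<noteq> 0\<close> char[of i] by simp
    next
      case True
      then obtain n where n: "i = b * n" by blast
      then have n0: "n > 0" using \<open>i \<noteq> 0\<close> by auto
      have "(\<Sum>l\<in>{1..i}. P l * A' (i - l)) = (\<Sum>l\<in>(*) b ` {1..n}. P l * A' (i - l))"
      proof (rule sum.mono_neutral_right)
        show "(*) b ` {1..n} \<subseteq> {1..i}" using b by (auto simp: n)
        show "\<forall>l\<in>{1..i} - (*) b ` {1..n}. P l * A' (i - l) = 0"
        proof
          fix l assume l: "l \<in> {1..i} - (*) b ` {1..n}"
          have "\<not> b dvd l"
          proof
            assume "b dvd l"
            then obtain r where r: "l = b * r" by blast
            with l b have "r \<in> {1..n}" by (auto simp: n)
            with l r show False by blast
          qed
          then show "P l * A' (i - l) = 0" by (simp add: P(2))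
        qed
      qed simp
      also have "\<dots> = (\<Sum>r\<in>{1..n}. P (b * r) * A' (i - b * r))"
        using b by (subst sum.reindex) (auto simp: inj_on_def)
      also have "\<dots> = (\<Sum>r\<in>{1..n}. of_nat b * (q r * A (n - r)))"
      proof (intro sum.cong refl)
        fix r assume r: "r \<in> {1..n}"
        have i: "i - b * r = b * (n - r)" by (simp add: n right_diff_distrib')
        have "A' (i - b * r) = A (n - r)" using less[of "i - b * r"] r b n0 unfolding i by (simp add: n)
        then show "P (b * r) * A' (i - b * r) = of_nat b * (q r * A (n - r))" using r by (simp add: P(1))
      qed
      also have "\<dots> = of_nat b * (\<Sum>r\<in>{1..n}. q r * A (n - r))" by (simp add: sum_distrib_left)
      also have "(\<Sum>r\<in>{1..n}. q r * A (n - r)) = - (of_nat n * A n)"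
        using A(2)[of "n - 1"] shift[of q A "n - 1"] n0 by simp
      finally have "of_nat i * A' i = of_nat i * A n" unfolding rec by (simp add: n)
      then show ?thesis using True \<open>i \<noteq> 0\<close> char[of i] b by (simp add: n)
    qed
  qed
qed

text \<open>Absorbing the sign into the coefficients, as in det(1 - \<Phi> s), brings Newton's
  identities into the form that \<open>newton_recursion_power\<close> expects.\<close>

lemma newton_recursion_signed:
  fixes d q :: "nat \<Rightarrow> 'c::comm_ring_1"
  assumes "of_nat (Suc m) * d (Suc m) = (\<Sum>k\<le>m. (-1) ^ k * q (Suc k) * d (m - k))"
  shows "of_nat (Suc m) * ((-1) ^ Suc m * d (Suc m)) = - (\<Sum>k\<le>m. q (Suc k) * ((-1) ^ (m - k) * d (m - k)))"
proof -
  have "(-1) ^ m = (-1 :: 'c) ^ k * (-1) ^ (m - k)" if "k \<le> m" for k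
    using that by (simp add: power_add[symmetric])
  then have "(-1) ^ m * ((-1) ^ k * q (Suc k) * d (m - k)) = q (Suc k) * ((-1) ^ (m - k) * d (m - k))" if "k \<le> m" for k
    using that by (simp add: mult_ac power_mult_distrib[symmetric] left_minus_one_mult_self)
  then have "(-1) ^ m * (of_nat (Suc m) * d (Suc m)) = (\<Sum>k\<le>m. q (Suc k) * ((-1) ^ (m - k) * d (m - k)))"
    unfolding assms sum_distrib_left by (intro sum.cong) auto
  then show ?thesis by (simp add: mult_ac)
qed

section \<open>Comparison of the traces over the two ground rings\<close>

context exponential_sum
begin

lemma Q_semilinear: "Q.semilinear (\<tau> ^^ k) (\<Psi> ^^ k)"
  by (rule Q.semilinear_funpow)
    (unfold Q.semilinear_def, simp add: ring_hom_\<tau> Q.R_def \<Psi>_in_B \<Psi>_add \<Psi>_scale)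

lemma Q_compact: "Q.compact_op Q.std (Q.basis_coord Q.std) (\<Psi> ^^ Suc k)"
  unfolding Q.compact_op_def
  using Q.range_mod_std[OF finite_mod_\<Psi>[OF Q.polytope_coeffs_axioms] Q.funpow_maps[OF \<Psi>_maps]] by blast

abbreviation trace_q :: "nat \<Rightarrow> 'r fps" where
  "trace_q m \<equiv> Q.trace Q.std (Q.basis_coord Q.std) (\<Psi> ^^ m)"

text \<open>\<open>\<Psi>\<^bsup>bk\<^esup>\<close> commutes with \<open>\<Psi>\<close>, so its trace is fixed by \<open>\<sigma>\<close>.\<close>

lemma trace_q_in_Zp: "fps_nth (trace_q (b * Suc k)) i \<in> Zp p"
proof -
  define j where "j = b * Suc k - 1"
  have m: "b * Suc k = Suc j" using b_pos by (simp add: j_def)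
  have \<tau>m: "(\<tau> ^^ j) (\<tau> x) = x" for x
    using \<tau>_funpow_b_mult[of "Suc k" x] unfolding m by (simp add: funpow_swap1)
  \<comment> \<open>The power is split as \<open>\<Psi> ^^ j\<close> after \<Psi>. The two twists
    compose to \<open>\<tau> ^^ (b * Suc k)\<close>, which is the identity, as the exchange of the
    factors requires.\<close>
  have "trace_q (Suc j) = fps_map (\<tau> ^^ j) (trace_q (Suc j))"
    using Q.trace_commute[OF Q.std.fps_basis_axioms Q.std.fps_basis_axioms Q_semilinear[of j] Q_semilinear[of "Suc 0"] Q_compact[of 0]] \<tau>m
    by (simp add: comp_def funpow_swap1)
  then have "(\<tau> ^^ j) (fps_nth (trace_q (Suc j)) i) = fps_nth (trace_q (Suc j)) i"
    by (metis fps_nth_map)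
  then have "\<tau> (fps_nth (trace_q (Suc j)) i) = fps_nth (trace_q (Suc j)) i"
    using \<tau>m[of "fps_nth (trace_q (Suc j)) i"] by (simp add: funpow_swap1[symmetric])
  then show ?thesis unfolding m \<tau>_fixed_iff .
qed

context
  fixes \<Xi> :: "'r set" and cf
  assumes coeffs: "free_coeffs (Zp p) \<Xi> cf" and card_\<Xi>: "card \<Xi> = b"
begin

interpretation P: polytope_coeffs \<Delta> "Zp p" \<Xi> cf
  by (rule polytope_coeffs.intro[OF lattice_polytope_axioms coeffs])

abbreviation trace_p :: "nat \<Rightarrow> 'r fps" where
  "trace_p m \<equiv> P.trace P.std (P.basis_coord P.std) (\<Psi> ^^ m)"

lemma P_R: "P.R = Rp p"
  by (simp add: P.R_def Rp_def)

lemma Rp_fixed: "c \<in> P.R \<Longrightarrow> fps_map \<tau> c = c"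
  by (simp add: P.R_def fps_eq_iff \<tau>_fixed_iff)

lemma P_semilinear: "P.semilinear (\<lambda>x. x) \<Psi>"
  by (simp add: P.semilinear_def ring_hom_on_def fps_map_ident \<Psi>_in_B \<Psi>_add \<Psi>_scale Rp_fixed)

lemma P_compact: "P.compact_op P.std (P.basis_coord P.std) (\<Psi> ^^ Suc k)"
  unfolding P.compact_op_def
  using P.range_mod_std[OF finite_mod_\<Psi>[OF P.polytope_coeffs_axioms] P.funpow_maps[OF \<Psi>_maps]] by blast

text \<open>Above u the basis vectors over Z_p are \<xi> times a single basis vector over Z_q, and
  semilinearity moves \<xi> out, twisted by \<tau>. So a diagonal entry y over Z_q becomes the block
  sending x to y times the twist of x. The trace of this block is additive in y, so it can be taken
  after summation over u.\<close>

lemma trace_p_eq_mod: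
  "fps_eq_mod n (trace_p (Suc k)) (fps_map (\<lambda>y. P.trace0 (\<lambda>x. y * (\<tau> ^^ Suc k) x)) (trace_q (Suc k)))"
proof -
  let ?U = "{u \<in> M. wt u < n}" and ?m = "Suc k"
  let ?\<theta> = "\<lambda>y. P.trace0 (\<lambda>x. y * (\<tau> ^^ ?m) x)"
  let ?G = "\<lambda>u. fps_shift (wt u) ((\<Psi> ^^ ?m) (Q.bvec 1 u) u)"
  have \<theta>: "?\<theta> 0 = 0" "\<And>x y. ?\<theta> (x + y) = ?\<theta> x + ?\<theta> y"
    by (auto simp: P.trace0_def P.cf_0 P.cf_add distrib_right sum.distrib simp del: funpow.simps)
  have "fps_eq_mod n (trace_p ?m) (\<Sum>u\<in>?U. \<Sum>\<xi>\<in>\<Xi>. P.coord_at ((\<Psi> ^^ ?m) (P.bvec \<xi> u)) \<xi> u)"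
    by (rule P.trace_std_eq_mod[OF P_compact finite_mod_\<Psi>[OF P.polytope_coeffs_axioms] P.funpow_maps[OF \<Psi>_maps]])
  also have "(\<Sum>u\<in>?U. \<Sum>\<xi>\<in>\<Xi>. P.coord_at ((\<Psi> ^^ ?m) (P.bvec \<xi> u)) \<xi> u) = (\<Sum>u\<in>?U. fps_map ?\<theta> (?G u))"
  proof (intro sum.cong refl)
    fix u assume u: "u \<in> ?U"
    have "P.coord_at ((\<Psi> ^^ ?m) (P.bvec \<xi> u)) \<xi> u = fps_map (\<lambda>y. cf \<xi> (y * (\<tau> ^^ ?m) \<xi>)) (?G u)" for \<xi>
    proof -
      have "P.bvec \<xi> u = series_scale (fps_const \<xi>) (Q.bvec 1 u)"
        by (simp add: fun_eq_iff P.bvec_def Q.bvec_def)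
      then have "(\<Psi> ^^ ?m) (P.bvec \<xi> u) = series_scale (fps_map (\<tau> ^^ ?m) (fps_const \<xi>)) ((\<Psi> ^^ ?m) (Q.bvec 1 u))"
        using \<Psi>_funpow_scale[OF Q.bvec_in_B] u by (simp del: funpow.simps)
      also have "fps_map (\<tau> ^^ ?m) (fps_const \<xi>) = fps_const ((\<tau> ^^ ?m) \<xi>)"
        using \<tau>_funpow_Zp[OF P.R0_0, of ?m] by (simp add: fps_eq_iff del: funpow.simps)
      finally show ?thesis
        by (simp add: P.coord_at_def fps_eq_iff mult.commute del: funpow.simps)
    qed
    then show "(\<Sum>\<xi>\<in>\<Xi>. P.coord_at ((\<Psi> ^^ ?m) (P.bvec \<xi> u)) \<xi> u) = fps_map ?\<theta> (?G u)"
      by (simp add: fps_eq_iff fps_sum_nth P.trace0_def del: funpow.simps)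
  qed
  also have "\<dots> = fps_map ?\<theta> (\<Sum>u\<in>?U. ?G u)"
    by (rule fps_map_sum[OF \<theta>, symmetric])
  also have "(\<Sum>u\<in>?U. ?G u) = (\<Sum>u\<in>?U. \<Sum>\<xi>\<in>{1}. Q.coord_at ((\<Psi> ^^ ?m) (Q.bvec \<xi> u)) \<xi> u)"
    by (simp add: Q.coord_at_def fps_map_ident del: funpow.simps)
  also have "fps_eq_mod n (fps_map ?\<theta> \<dots>) (fps_map ?\<theta> (trace_q ?m))"
    by (intro fps_eq_mod_map, rule fps_eq_mod_sym)
      (rule Q.trace_std_eq_mod[OF Q_compact finite_mod_\<Psi>[OF Q.polytope_coeffs_axioms] Q.funpow_maps[OF \<Psi>_maps]])
  finally show ?thesis .
qed

lemma trace_p_eq: "trace_p (Suc k) = fps_map (\<lambda>y. P.trace0 (\<lambda>x. y * (\<tau> ^^ Suc k) x)) (trace_q (Suc k))"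
  by (rule fps_eq_mod_all_imp_eq[OF trace_p_eq_mod])

lemma trace_p_eq_0: "\<not> b dvd m \<Longrightarrow> trace_p m = 0"
  using trace_p_eq[of "m - 1"] trace_twisted_eq_0[OF coeffs, of m]
  by (cases m) (simp_all add: fps_eq_iff del: funpow.simps)

lemma trace_p_mult: "k > 0 \<Longrightarrow> trace_p (b * k) = of_nat b * trace_q (b * k)"
proof -
  assume "k > 0"
  then obtain l where l: "k = Suc l" by (cases k) auto
  obtain j where j: "b * k = Suc j" using b_pos l by (cases "b * k") auto
  have "trace_p (b * k) = fps_map (\<lambda>y. of_nat b * y) (trace_q (b * k))"
    unfolding j trace_p_eq
  proof (rule fps_ext)
    fix i
    have "P.trace0 (\<lambda>x. fps_nth (trace_q (b * k)) i * (\<tau> ^^ (b * k)) x) = of_nat b * fps_nth (trace_q (b * k)) i"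
      by (rule trace_twisted_Zp[OF coeffs card_\<Xi>]) (simp add: l trace_q_in_Zp del: mult_Suc_right)
    then show "fps_nth (fps_map (\<lambda>y. P.trace0 (\<lambda>x. y * (\<tau> ^^ Suc j) x)) (trace_q (Suc j))) i
        = fps_nth (fps_map ((*) (of_nat b)) (trace_q (Suc j))) i"
      by (simp add: j del: funpow.simps)
  qed
  then show ?thesis by (simp add: fps_eq_iff fps_of_nat[symmetric])
qed

theorem fredholm_det_power:
  "fps_nth (fredholm_det \<Delta> (Rp p) \<Psi>) (b * m) = fps_nth (fredholm_det \<Delta> UNIV (\<Psi> ^^ b)) m"
proof -
  have Q_lin: "Q.semilinear (\<lambda>x. x) (\<Psi> ^^ b)"
  proof -
    have "\<tau> ^^ b = (\<lambda>x. x)" using \<tau>_funpow_b_mult[of 1] by auto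
    then show ?thesis using Q_semilinear[of b] by simp
  qed
  have Q_cpt: "Q.compact_op Q.std (Q.basis_coord Q.std) (\<Psi> ^^ b)"
    using Q_compact[of "b - 1"] b_pos by (simp del: funpow.simps)
  have P_cpt: "P.compact_op P.std (P.basis_coord P.std) \<Psi>"
    using P_compact[of 0] by simp
  have charX: "(of_nat k :: 'r fps) \<noteq> 0" if "k > 0" for k
    using char_0[OF that] by (metis fps_of_nat fps_const_eq_0_iff)
  let ?d = "Q.std.char_coeff (\<Psi> ^^ b)" and ?e = "P.std.char_coeff \<Psi>"
  have Q_det: "fredholm_det \<Delta> UNIV (\<Psi> ^^ b) = Abs_fps (\<lambda>m. (-1) ^ m * ?d m)"
    using Q.fredholm_det_eq[OF Q_lin Q_cpt char_0] by (simp add: Q.R_def)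
  have P_det: "fredholm_det \<Delta> (Rp p) \<Psi> = Abs_fps (\<lambda>m. (-1) ^ m * ?e m)"
    using P.fredholm_det_eq[OF P_semilinear P_cpt char_0] by (simp add: P_R)
  have Q_rec: "of_nat (Suc m) * ?d (Suc m) = (\<Sum>k\<le>m. (-1) ^ k * trace_q (b * Suc k) * ?d (m - k))" for m
    using Q.std.char_coeff_newton[OF Q_lin Q_cpt char_0, of m] by (simp only: funpow_mult mult.commute[of b])
  have P_rec: "of_nat (Suc m) * ?e (Suc m) = (\<Sum>k\<le>m. (-1) ^ k * trace_p (Suc k) * ?e (m - k))" for m
    by (rule P.std.char_coeff_newton[OF P_semilinear P_cpt char_0])
  \<comment> \<open>In \<open>newton_recursion_power\<close>, \<open>A\<close> and \<open>A'\<close>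
    are the signed coefficients over Z_q and Z_p, and \<open>q k\<close> is the trace of the k-th
    power of \<open>\<Psi> ^^ b\<close>; the hypotheses on \<open>P\<close> are
    \<open>trace_p_mult\<close> and \<open>trace_p_eq_0\<close>.\<close>
  have "(-1) ^ (b * m) * ?e (b * m) = (if b dvd b * m then (-1) ^ (b * m div b) * ?d (b * m div b) else 0)"
    by (rule newton_recursion_power[where q = "\<lambda>k. trace_q (b * k)" and P = trace_p, OF b_pos charX _
          newton_recursion_signed[OF Q_rec] _ newton_recursion_signed[OF P_rec]])
      (simp_all add: Q.std.char_coeff_0 P.std.char_coeff_0 trace_p_mult trace_p_eq_0 del: of_nat_Suc)
  then show ?thesis using b_pos by (simp add: Q_det P_det)
qed

end

end

lemma ord_T_minus_one_power: "ord_T D ((-1) ^ k * f) = ord_T D f"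
  by (cases "even k") (simp_all add: ord_T_def)

theorem theorem2p3:
  fixes p b :: nat
    and red :: "'r::idom \<Rightarrow> 'k::{field,finite}"
    and \<sigma> :: "'r \<Rightarrow> 'r"
    and \<Delta> :: "(real ^ 'n) set"
    and a :: "int ^ 'n \<Rightarrow> 'k"
    and c :: "nat \<Rightarrow> 'r fps"
  assumes "prime p"
    and "CARD('k) = p ^ b"
    and "witt_vectors p red"
    and "frobenius p \<sigma>"
    and "integral_polytope \<Delta>"
    and "{0} \<subset> \<Delta>"
    and "\<And>u. rvec u extreme_point_of \<Delta> \<Longrightarrow> u \<noteq> 0 \<Longrightarrow> a u \<noteq> 0"
    and "fredholm_det \<Delta> (Rp p) (Psi p red \<sigma> \<Delta> a) = Abs_fps (\<lambda>i. (-1) ^ i * c i)"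
  shows "newton_polygon (denom \<Delta>) (fredholm_det \<Delta> UNIV (Psi p red \<sigma> \<Delta> a ^^ b)) =
         lower_convex_closure (\<lambda>m. ord_T (denom \<Delta>) (c (b * m)))"
proof -
  interpret exponential_sum \<Delta> p b red \<sigma> a
    using assms(1-6) by unfold_locales auto
  obtain \<Xi> :: "'r set" and cf where "free_coeffs (Zp p) \<Xi> cf" "card \<Xi> = b"
    by (rule Zp_basis)
  \<comment> \<open>The coefficients agree only up to a sign in terms of \<open>c\<close>, and
    orders do not see the sign.\<close>
  then have "fps_nth (fredholm_det \<Delta> UNIV (Psi p red \<sigma> \<Delta> a ^^ b)) m = (-1) ^ (b * m) * c (b * m)" for m
    using fredholm_det_power[of \<Xi> cf m] by (simp add: assms(8))
  then show ?thesis
    unfolding newton_polygon_def by (simp add: ord_T_minus_one_power)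
qed

end
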